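(* Let $\mathbb{A}$ be a finite algebra whose clone of term operations is a minimal clone and which has a Taylor term. Then, up to term equivalence, $\mathbb{A}$ is either an affine algebra, a majority algebra, or a spiral.
   Context: The clone of an algebra is the set of all its term operations; two algebras on the same underlying set are term equivalent if they have the same term operations. A clone is a minimal clone if it contains an operation that is not a projection, and every proper subclone consists only of projections. A Taylor term is an idempotent term $t$ of some arity $n$ such that for every $i\in\{1,\dots,n\}$ the algebra satisfies an identity $t(u_1,\dots,u_n)\approx t(v_1,\dots,v_n)$ with all $u_j,v_j\in\{x,y\}$ and $u_i=x$, $v_i=y$. An algebra is affine if there is a module structure on its underlying set such that $x-y+z$ is a term operation of the algebra and every term operation is an affine map of that module (of the form $\sum_i r_ix_i+c$ with $r_i$ in the ring and $c$ a constant). A majority algebra is an algebra with a ternary operation $g$ satisfying $g(x,x,y)\approx g(x,y,x)\approx g(y,x,x)\approx x$. A spiral is an algebra $(A,f)$ where $f$ is a commutative idempotent binary operation such that every subalgebra generated by two distinct elements either has size two or has a surjective homomorphism onto the free semilattice on two generators (a three-element semilattice). *)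

theory Defs
  imports HOL.Hull "HOL-Algebra.Module" "HOL-Library.NList"
begin

section \<open>Algebras and term operations\<close>

record ('f, 'a) ualgebra = "'a partial_object" +
  symbols :: "'f set"
  arity :: "'f \<Rightarrow> nat"
  interp :: "'f \<Rightarrow> 'a list \<Rightarrow> 'a"

locale universal_algebra =
  fixes \<AA> :: "('f, 'a) ualgebra"
  assumes carrier_not_empty: "carrier \<AA> \<noteq> {}"
    and interp_closed: "\<And>f xs. f \<in> symbols \<AA> \<Longrightarrow> xs \<in> nlists (arity \<AA> f) (carrier \<AA>) \<Longrightarrow>
      interp \<AA> f xs \<in> carrier \<AA>"

datatype 'f trm = Var nat | App 'f "'f trm list"

text \<open>Terms in the variables \<open>Var 0, \<dots>, Var (n - 1)\<close>, not all of which have to occur.\<close>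

inductive_set terms :: "('f, 'a) ualgebra \<Rightarrow> nat \<Rightarrow> 'f trm set"
  for \<AA> :: "('f, 'a) ualgebra" and n :: nat where
  Var: "i < n \<Longrightarrow> Var i \<in> terms \<AA> n"
| App: "f \<in> symbols \<AA> \<Longrightarrow> length ts = arity \<AA> f \<Longrightarrow> (\<forall>t\<in>set ts. t \<in> terms \<AA> n) \<Longrightarrow>
    App f ts \<in> terms \<AA> n"

primrec eval_term :: "('f, 'a) ualgebra \<Rightarrow> 'a list \<Rightarrow> 'f trm \<Rightarrow> 'a" where
  "eval_term \<AA> xs (Var i) = xs ! i"
| "eval_term \<AA> xs (App f ts) = interp \<AA> f (map (eval_term \<AA> xs) ts)"

text \<open>
  An \<open>n\<close>-ary operation on \<open>A\<close> is an extensional function on \<^term>\<open>nlists n A\<close>, and a set of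
  finitary operations on \<open>A\<close> is a family indexed by the arity. The index is needed since constant
  operations of different arities may be represented by the same function. Arity \<open>0\<close> is allowed.
\<close>

definition term_ops :: "('f, 'a) ualgebra \<Rightarrow> nat \<Rightarrow> ('a list \<Rightarrow> 'a) set" where
  "term_ops \<AA> n = (\<lambda>t. \<lambda>xs\<in>nlists n (carrier \<AA>). eval_term \<AA> xs t) ` terms \<AA> n"

definition term_equivalent :: "('f, 'a) ualgebra \<Rightarrow> ('g, 'a) ualgebra \<Rightarrow> bool" where
  "term_equivalent \<AA> \<BB> \<longleftrightarrow> carrier \<AA> = carrier \<BB> \<and> term_ops \<AA> = term_ops \<BB>"

section \<open>Clones\<close>

definition projections :: "'a set \<Rightarrow> nat \<Rightarrow> ('a list \<Rightarrow> 'a) set" where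
  "projections A n = {\<lambda>xs\<in>nlists n A. xs ! i | i. i < n}"

definition clone_on :: "'a set \<Rightarrow> (nat \<Rightarrow> ('a list \<Rightarrow> 'a) set) \<Rightarrow> bool" where
  "clone_on A C \<longleftrightarrow>
    (\<forall>n. C n \<subseteq> nlists n A \<rightarrow>\<^sub>E A) \<and>
    (\<forall>n. projections A n \<subseteq> C n) \<and>
    (\<forall>k n. \<forall>f\<in>C k. \<forall>gs\<in>nlists k (C n).
      (\<lambda>xs\<in>nlists n A. f (map (\<lambda>g. g xs) gs)) \<in> C n)"

definition minimal_clone :: "'a set \<Rightarrow> (nat \<Rightarrow> ('a list \<Rightarrow> 'a) set) \<Rightarrow> bool" where
  "minimal_clone A C \<longleftrightarrow>
    clone_on A C \<and>
    (\<exists>n. \<not> C n \<subseteq> projections A n) \<and>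
    (\<forall>D. clone_on A D \<and> D < C \<longrightarrow> (\<forall>n. D n \<subseteq> projections A n))"

section \<open>Taylor terms\<close>

text \<open>
  The two sides of an identity \<open>t(u\<^sub>1,\<dots>,u\<^sub>n) \<approx> t(v\<^sub>1,\<dots>,v\<^sub>n)\<close> in the variables \<open>x\<close> and \<open>y\<close> are given
  by lists of Booleans, where \<^term>\<open>True\<close> stands for \<open>x\<close> and \<^term>\<open>False\<close> for \<open>y\<close>.
\<close>

definition taylor_term :: "('f, 'a) ualgebra \<Rightarrow> nat \<Rightarrow> 'f trm \<Rightarrow> bool" where
  "taylor_term \<AA> n t \<longleftrightarrow>
    t \<in> terms \<AA> n \<and>
    (\<forall>x\<in>carrier \<AA>. eval_term \<AA> (replicate n x) t = x) \<and>
    (\<forall>i<n. \<exists>u v :: bool list. length u = n \<and> length v = n \<and> u ! i = True \<and> v ! i = False \<and>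
      (\<forall>x\<in>carrier \<AA>. \<forall>y\<in>carrier \<AA>.
        eval_term \<AA> (map (\<lambda>b. if b then x else y) u) t =
        eval_term \<AA> (map (\<lambda>b. if b then x else y) v) t))"

section \<open>Affine algebras\<close>

text \<open>The locale \<^locale>\<open>module\<close> requires a commutative ring of scalars.\<close>

locale left_module = R?: ring R + M?: abelian_group M
  for R :: "('r, 'm) ring_scheme" (structure) and M :: "('r, 'a, 'n) module_scheme" (structure) +
  assumes smult_closed:
      "\<lbrakk>r \<in> carrier R; x \<in> carrier M\<rbrakk> \<Longrightarrow> r \<odot>\<^bsub>M\<^esub> x \<in> carrier M"
    and smult_l_distr:
      "\<lbrakk>r \<in> carrier R; s \<in> carrier R; x \<in> carrier M\<rbrakk> \<Longrightarrow>
      (r \<oplus> s) \<odot>\<^bsub>M\<^esub> x = r \<odot>\<^bsub>M\<^esub> x \<oplus>\<^bsub>M\<^esub> s \<odot>\<^bsub>M\<^esub> x"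
    and smult_r_distr:
      "\<lbrakk>r \<in> carrier R; x \<in> carrier M; y \<in> carrier M\<rbrakk> \<Longrightarrow>
      r \<odot>\<^bsub>M\<^esub> (x \<oplus>\<^bsub>M\<^esub> y) = r \<odot>\<^bsub>M\<^esub> x \<oplus>\<^bsub>M\<^esub> r \<odot>\<^bsub>M\<^esub> y"
    and smult_assoc1:
      "\<lbrakk>r \<in> carrier R; s \<in> carrier R; x \<in> carrier M\<rbrakk> \<Longrightarrow>
      (r \<otimes> s) \<odot>\<^bsub>M\<^esub> x = r \<odot>\<^bsub>M\<^esub> (s \<odot>\<^bsub>M\<^esub> x)"
    and smult_one: "x \<in> carrier M \<Longrightarrow> \<one> \<odot>\<^bsub>M\<^esub> x = x"

text \<open>
  The scalars are taken in the type \<^typ>\<open>'a \<Rightarrow> 'a\<close>. This is no restriction: replacing an arbitrary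
  ring of scalars by its image in the endomorphism ring of the additive group (represented by
  extensional functions on the carrier) does not change the affine maps.
\<close>

definition affine_algebra :: "('f, 'a) ualgebra \<Rightarrow> bool" where
  "affine_algebra \<AA> \<longleftrightarrow>
    (\<exists>(R :: ('a \<Rightarrow> 'a) ring) (M :: ('a \<Rightarrow> 'a, 'a) module).
      left_module R M \<and> carrier M = carrier \<AA> \<and>
      (\<lambda>xs\<in>nlists 3 (carrier \<AA>). (xs ! 0 \<ominus>\<^bsub>M\<^esub> xs ! 1) \<oplus>\<^bsub>M\<^esub> xs ! 2) \<in> term_ops \<AA> 3 \<and>
      (\<forall>n. \<forall>f\<in>term_ops \<AA> n. \<exists>r\<in>{..<n} \<rightarrow> carrier R. \<exists>c\<in>carrier M.
        \<forall>xs\<in>nlists n (carrier \<AA>).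
          f xs = (\<Oplus>\<^bsub>M\<^esub>i\<in>{..<n}. r i \<odot>\<^bsub>M\<^esub> (xs ! i)) \<oplus>\<^bsub>M\<^esub> c))"

section \<open>Majority algebras and spirals\<close>

text \<open>Algebras \<open>(A, g)\<close> with a single basic operation have the signature \<^typ>\<open>unit\<close>.\<close>

definition single_op_algebra :: "'a set \<Rightarrow> nat \<Rightarrow> ('a list \<Rightarrow> 'a) \<Rightarrow> (unit, 'a) ualgebra" where
  "single_op_algebra A n g =
    \<lparr>carrier = A, symbols = UNIV, arity = (\<lambda>_. n), interp = (\<lambda>_. g)\<rparr>"

definition majority_algebra :: "(unit, 'a) ualgebra \<Rightarrow> bool" where
  "majority_algebra \<AA> \<longleftrightarrow> universal_algebra \<AA> \<and>
    (\<exists>A g. \<AA> = single_op_algebra A 3 g \<and>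
      (\<forall>x\<in>A. \<forall>y\<in>A. g [x, x, y] = x \<and> g [x, y, x] = x \<and> g [y, x, x] = x))"

definition subuniverse :: "('f, 'a) ualgebra \<Rightarrow> 'a set \<Rightarrow> bool" where
  "subuniverse \<AA> S \<longleftrightarrow> S \<subseteq> carrier \<AA> \<and>
    (\<forall>f\<in>symbols \<AA>. \<forall>xs\<in>nlists (arity \<AA> f) S. interp \<AA> f xs \<in> S)"

definition generated_subalgebra :: "('f, 'a) ualgebra \<Rightarrow> 'a set \<Rightarrow> ('f, 'a) ualgebra" where
  "generated_subalgebra \<AA> X = \<AA>\<lparr>carrier := subuniverse \<AA> hull X\<rparr>"

definition homomorphism :: "('f, 'a) ualgebra \<Rightarrow> ('f, 'b) ualgebra \<Rightarrow> ('a \<Rightarrow> 'b) \<Rightarrow> bool" where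
  "homomorphism \<AA> \<BB> h \<longleftrightarrow>
    symbols \<AA> = symbols \<BB> \<and> (\<forall>f\<in>symbols \<AA>. arity \<AA> f = arity \<BB> f) \<and>
    h \<in> carrier \<AA> \<rightarrow> carrier \<BB> \<and>
    (\<forall>f\<in>symbols \<AA>. \<forall>xs\<in>nlists (arity \<AA> f) (carrier \<AA>).
      h (interp \<AA> f xs) = interp \<BB> f (map h xs))"

text \<open>
  The free semilattice on the two generators \<open>{False}\<close> and \<open>{True}\<close>: the nonempty subsets of
  \<^typ>\<open>bool\<close> under union.
\<close>

definition free_semilattice2 :: "(unit, bool set) ualgebra" where
  "free_semilattice2 = single_op_algebra (- {{}}) 2 (\<lambda>xs. xs ! 0 \<union> xs ! 1)"

definition spiral :: "(unit, 'a) ualgebra \<Rightarrow> bool" where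
  "spiral \<AA> \<longleftrightarrow> universal_algebra \<AA> \<and>
    (\<exists>A f. \<AA> = single_op_algebra A 2 f \<and>
      (\<forall>x\<in>A. \<forall>y\<in>A. f [x, y] = f [y, x]) \<and>
      (\<forall>x\<in>A. f [x, x] = x) \<and>
      (\<forall>a\<in>A. \<forall>b\<in>A. a \<noteq> b \<longrightarrow>
        card (carrier (generated_subalgebra \<AA> {a, b})) = 2 \<or>
        (\<exists>h. homomorphism (generated_subalgebra \<AA> {a, b}) free_semilattice2 h \<and>
          h ` carrier (generated_subalgebra \<AA> {a, b}) = carrier free_semilattice2)))"

end

theory Submission
  imports Defs
begin

text \<open>
  Every operation of a minimal clone that is not a projection generates the clone. Together with
  the Taylor identities this shows that an operation acting as a projection on two distinct
  elements is a projection.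

  If all binary operations are projections, a ternary operation that is not a projection yields a
  majority operation or a minority operation; in the latter case \<open>p(s, t, w) \<approx> w\<close> transfers every
  identity \<open>s \<approx> t\<close> of \<open>x + y + z\<close> from a two-element subset to the whole algebra.

  Otherwise consider a subalgebra \<open>B\<close> that is minimal among those with at least two elements. If
  there is no commutative operation, or if \<open>B\<close> has more than two elements, then no binary
  operation other than a projection takes a value in \<open>{a, b}\<close> at a pair \<open>a \<noteq> b\<close> of \<open>B\<close>, unless
  \<open>f(x, c) = c\<close> for a commutative \<open>f\<close> and some \<open>x \<noteq> c\<close> in \<open>B\<close>, which is impossible. Hence the
  translations are permutations, there is a Maltsev operation, and the clone is affine. The
  remaining case is that of a commutative operation \<open>f\<close> and a two-element semilattice. Then there
  is a partial semilattice operation, and the subalgebra generated by \<open>a \<noteq> b\<close> is \<open>{a, b} \<union> M\<close> for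
  its maximal strongly connected component \<open>M\<close>, which is an ideal. If \<open>M\<close> contains neither
  generator, collapsing \<open>M\<close> gives the free semilattice; if \<open>a \<in> M\<close>, a linkedness argument
  shows \<open>f(a, b) = a\<close>.
\<close>

subsection \<open>Minimal clones with a Taylor operation\<close>

text \<open>A fact seen on a pair or on the minimal subalgebra \<open>B\<close> passes to
  \<open>A\<close> only if it says that some operation is a coordinate. This bottleneck shapes the
  constructions: identities are recoded as coordinate statements by a Maltsev operation, and a
  constructed operation is shown to be no projection by following its value on one fixed pair.
  Minimality acts as an induction over compositions of any convenient non-projection. Its most
  useful form, \<open>coord_induct\<close>, concerns a preorder: if one non-projection always moves
  upwards from a fixed argument, then every operation moves upwards from one of its arguments.
  Equality, a congruence, absorption and reachability along semilattice edges are the preorders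
  used; a commutative operation that follows one argument follows both, which gives either a
  contradiction or twice the information. The choice of a minimal \<open>B\<close> pays off because,
  by idempotence, rows of compatible relations are subalgebras: such a row has at most one element
  or is all of \<open>B\<close>.\<close>

lemma obtain_idempotent_power:
  assumes fin: "finite A" and cl: "\<And>x y. x \<in> A \<Longrightarrow> y \<in> A \<Longrightarrow> f x y \<in> A"
  obtains N where "N > 0" "\<And>x y. x \<in> A \<Longrightarrow> y \<in> A \<Longrightarrow> (f x ^^ N) ((f x ^^ N) y) = (f x ^^ N) y"
proof -
  have it: "(f x ^^ k) y \<in> A" if "x \<in> A" "y \<in> A" for k x y
    using that by (induction k) (auto intro: cl)
  \<comment> \<open>All maps \<open>f x\<close> are packed into one element of a finite function
    space, so that the exponent is the same for every \<open>x\<close> and the power is again one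
    binary operation.\<close>
  define \<phi> where "\<phi> k = (\<lambda>(x, y)\<in>A \<times> A. (f x ^^ k) y)" for k
  have "range \<phi> \<subseteq> A \<times> A \<rightarrow>\<^sub>E A"
  proof (rule image_subsetI)
    fix k show "\<phi> k \<in> A \<times> A \<rightarrow>\<^sub>E A" unfolding \<phi>_def restrict_PiE_iff using it by auto
  qed
  then have "finite (range \<phi>)"
    by (rule finite_subset) (intro finite_PiE finite_cartesian_product fin)
  then have "\<not> inj \<phi>" using finite_imageD[of \<phi> UNIV] by auto
  then obtain i0 j0 where ij0: "i0 \<noteq> j0" "\<phi> i0 = \<phi> j0" by (auto simp: inj_def simp del: PiE_eq_iff)
  obtain i j where ij: "i < j" "\<phi> i = \<phi> j"
  proof (cases "i0 < j0")
    case True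
    with ij0 show ?thesis by (intro that[of i0 j0])
  next
    case False
    with ij0 show ?thesis by (intro that[of j0 i0]) simp_all
  qed
  have per: "(f x ^^ (m + (j - i))) y = (f x ^^ m) y" if "i \<le> m" "x \<in> A" "y \<in> A" for m x y
  proof -
    have "(f x ^^ i) y = (f x ^^ j) y"
      using fun_cong[OF ij(2), of "(x, y)"] that by (simp add: \<phi>_def)
    then have "(f x ^^ (m - i)) ((f x ^^ i) y) = (f x ^^ (m - i)) ((f x ^^ j) y)" by simp
    then have eq: "(f x ^^ (m - i + i)) y = (f x ^^ (m - i + j)) y" by (simp only: funpow_add o_apply)
    have e: "m - i + i = m" "m - i + j = m + (j - i)" using that ij by auto
    show ?thesis using eq unfolding e by (rule sym)
  qed
  have pers: "(f x ^^ (m + k * (j - i))) y = (f x ^^ m) y" if "i \<le> m" "x \<in> A" "y \<in> A" for m k x y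
  proof (induction k)
    case (Suc k)
    have "(f x ^^ (m + k * (j - i) + (j - i))) y = (f x ^^ (m + k * (j - i))) y"
      using that by (intro per) auto
    also have "m + k * (j - i) + (j - i) = m + Suc k * (j - i)" by simp
    finally show ?case using Suc by simp
  qed simp
  \<comment> \<open>A multiple of the period \<open>j - i\<close> that is positive and not below the
    preperiod \<open>i\<close>, also for \<open>i = 0\<close>.\<close>
  let ?N = "Suc i * (j - i)"
  have "Suc i * 1 \<le> ?N" using ij by (intro mult_le_mono) auto
  then have N: "?N > 0" "i \<le> ?N" by auto
  moreover have "(f x ^^ ?N) ((f x ^^ ?N) y) = (f x ^^ ?N) y" if "x \<in> A" "y \<in> A" for x y
    using pers[OF N(2) that, of "Suc i"] by (simp only: funpow_add o_apply)
  ultimately show ?thesis using that by blast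
qed

text \<open>The Taylor identities enter only through \<open>taylor\<close>, a statement about single
  pairs. Terms stay out of sight until the clone is turned back into an algebra.\<close>

locale minimal_taylor_clone =
  fixes A :: "'a set" and C :: "nat \<Rightarrow> ('a list \<Rightarrow> 'a) set"
  assumes finite_A: "finite A"
    and nontrivial_A: "\<exists>a\<in>A. \<exists>b\<in>A. a \<noteq> b"
    and minimal: "minimal_clone A C"
    and taylor: "a \<in> A \<Longrightarrow> b \<in> A \<Longrightarrow> a \<noteq> b \<Longrightarrow>
      \<exists>n. \<exists>t\<in>C n. (\<forall>x\<in>A. t (replicate n x) = x) \<and>
        \<not> (\<exists>i<n. \<forall>xs\<in>nlists n {a, b}. t xs = xs ! i)"
begin

lemma clone: "clone_on A C"
  using minimal by (simp add: minimal_clone_def)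

lemma C_funcset: "C n \<subseteq> nlists n A \<rightarrow>\<^sub>E A"
  using clone by (simp add: clone_on_def)

lemma C_closed: "f \<in> C n \<Longrightarrow> xs \<in> nlists n A \<Longrightarrow> f xs \<in> A"
  by (rule PiE_mem[OF subsetD[OF C_funcset]])

lemma C_restrict: "f \<in> C n \<Longrightarrow> (\<lambda>xs\<in>nlists n A. f xs) = f"
  using PiE_restrict[OF subsetD[OF C_funcset]] by simp

lemma C_proj: "i < n \<Longrightarrow> (\<lambda>xs\<in>nlists n A. xs ! i) \<in> C n"
proof -
  have "projections A n \<subseteq> C n" using clone by (simp add: clone_on_def)
  then show "i < n \<Longrightarrow> (\<lambda>xs\<in>nlists n A. xs ! i) \<in> C n" by (auto simp: projections_def)
qed

lemma C_comp:
  "f \<in> C k \<Longrightarrow> gs \<in> nlists k (C n) \<Longrightarrow> (\<lambda>xs\<in>nlists n A. f (map (\<lambda>g. g xs) gs)) \<in> C n"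
  by (rule clone[unfolded clone_on_def, THEN conjunct2, THEN conjunct2, rule_format])

lemma map_closed:
  assumes "gs \<in> nlists k (C n)" "xs \<in> nlists n A"
  shows "map (\<lambda>g. g xs) gs \<in> nlists k A"
proof -
  have "g xs \<in> A" if "g \<in> set gs" for g
    using C_closed[of g n xs] assms nlistsE_set[OF assms(1)] that by blast
  then show ?thesis using nlistsE_length[OF assms(1)] by (intro nlistsI) auto
qed

text \<open>The operations with property \<open>Q\<close> form a clone that contains the
  non-projection \<open>g\<close>, so by minimality it is the whole of \<open>C\<close>.\<close>

lemma min_induct:
  assumes g: "g \<in> C k" "g \<notin> projections A k" "Q k g"
    and proj: "\<And>n i. i < n \<Longrightarrow> Q n (\<lambda>xs\<in>nlists n A. xs ! i)"
    and comp: "\<And>k n f gs. f \<in> C k \<Longrightarrow> Q k f \<Longrightarrow> gs \<in> nlists k (C n) \<Longrightarrow> (\<And>g. g \<in> set gs \<Longrightarrow> Q n g) \<Longrightarrow>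
      Q n (\<lambda>xs\<in>nlists n A. f (map (\<lambda>g. g xs) gs))"
    and f: "f \<in> C n"
  shows "Q n f"
proof -
  define D where "D n = {f \<in> C n. Q n f}" for n
  have sub: "D n \<subseteq> C n" for n by (auto simp: D_def)
  have "clone_on A D"
    unfolding clone_on_def
  proof (intro conjI allI ballI)
    show "D n \<subseteq> nlists n A \<rightarrow>\<^sub>E A" for n
      using C_funcset sub by blast
    show "projections A n \<subseteq> D n" for n
      using C_proj proj by (auto simp: projections_def D_def)
    fix k n f gs assume f: "f \<in> D k" and gs: "gs \<in> nlists k (D n)"
    have gs': "gs \<in> nlists k (C n)" using gs nlists_mono[OF sub] by blast
    have Q: "Q n g" if "g \<in> set gs" for g
      using nlistsE_set[OF gs] that unfolding D_def by blast
    have "f \<in> C k" "Q k f" using f by (simp_all add: D_def)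
    then show "(\<lambda>xs\<in>nlists n A. f (map (\<lambda>g. g xs) gs)) \<in> D n"
      using C_comp[OF _ gs'] comp[OF _ _ gs' Q] by (simp add: D_def)
  qed
  moreover have "\<not> D k \<subseteq> projections A k" using g by (auto simp: D_def)
  ultimately have "\<not> D < C" using minimal by (auto simp: minimal_clone_def)
  moreover have "D \<le> C" using sub by (simp add: le_fun_def)
  ultimately have "C n = D n" by (simp add: less_le)
  with f have "f \<in> D n" by simp
  then show ?thesis by (simp add: D_def)
qed

lemma projections_iff:
  assumes "f \<in> C n"
  shows "f \<in> projections A n \<longleftrightarrow> (\<exists>i<n. \<forall>xs\<in>nlists n A. f xs = xs ! i)"
proof
  assume "f \<in> projections A n"
  then show "\<exists>i<n. \<forall>xs\<in>nlists n A. f xs = xs ! i" by (auto simp: projections_def)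
next
  assume "\<exists>i<n. \<forall>xs\<in>nlists n A. f xs = xs ! i"
  then obtain i where i: "i < n" "\<forall>xs\<in>nlists n A. f xs = xs ! i" by blast
  have "f = (\<lambda>xs\<in>nlists n A. xs ! i)"
    using C_restrict[OF assms] i by (metis restrict_ext)
  then show "f \<in> projections A n" using i by (auto simp: projections_def)
qed

text \<open>A Taylor operation for some pair is an idempotent non-projection, and idempotence
  survives composition. Arity \<open>0\<close> is included: with two elements in \<open>A\<close>
  there are no nullary operations.\<close>

lemma idempotent:
  assumes "f \<in> C n" "x \<in> A"
  shows "f (replicate n x) = x"
proof -
  obtain a b where ab: "a \<in> A" "b \<in> A" "a \<noteq> b" using nontrivial_A by blast
  obtain m t where t: "t \<in> C m" "\<forall>x\<in>A. t (replicate m x) = x"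
    "\<not> (\<exists>i<m. \<forall>xs\<in>nlists m {a, b}. t xs = xs ! i)"
    using taylor[OF ab] by blast
  have nl: "nlists m {a, b} \<subseteq> nlists m A" using ab by (intro nlists_mono) auto
  have np: "t \<notin> projections A m" using t(3) nl by (auto simp: projections_iff[OF t(1)])
  have "\<forall>x\<in>A. f (replicate n x) = x"
  proof (rule min_induct[OF t(1) np _ _ _ assms(1), where Q = "\<lambda>n f. \<forall>x\<in>A. f (replicate n x) = x"])
    show "\<forall>x\<in>A. t (replicate m x) = x" by fact
  next
    fix k n f gs
    assume *: "\<forall>x\<in>A. f (replicate k x) = x" "gs \<in> nlists k (C n)"
      "\<And>g. g \<in> set gs \<Longrightarrow> \<forall>x\<in>A. g (replicate n x) = x"
    have "map (\<lambda>g. g (replicate n x)) gs = replicate k x" if x: "x \<in> A" for x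
    proof (rule replicate_eqI)
      show "length (map (\<lambda>g. g (replicate n x)) gs) = k" using *(2) by simp
      fix y assume "y \<in> set (map (\<lambda>g. g (replicate n x)) gs)"
      then obtain g where "g \<in> set gs" "y = g (replicate n x)" by auto
      then show "y = x" using *(3)[of g] x by simp
    qed
    then show "\<forall>x\<in>A. (\<lambda>xs\<in>nlists n A. f (map (\<lambda>g. g xs) gs)) (replicate n x) = x"
      using *(1) by (simp add: nlists_replicateI)
  qed (auto simp: nlists_replicateI)
  then show ?thesis using assms by blast
qed

text \<open>If \<open>f\<close> follows its argument \<open>i\<close> and the inner operation at
  \<open>i\<close> follows coordinate \<open>j\<close>, the composition follows \<open>j\<close>;
  transitivity of \<open>\<rho>\<close> joins the two moves.\<close>

lemma coord_induct:
  assumes g: "g \<in> C k" "g \<notin> projections A k" and X: "X \<subseteq> A"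
    and refl: "\<And>x. x \<in> X \<Longrightarrow> \<rho> x x"
    and trans: "\<And>x y z. x \<in> X \<Longrightarrow> y \<in> X \<Longrightarrow> z \<in> X \<Longrightarrow> \<rho> x y \<Longrightarrow> \<rho> y z \<Longrightarrow> \<rho> x z"
    and "\<exists>i<k. \<forall>xs\<in>nlists k X. g xs \<in> X \<and> \<rho> (xs ! i) (g xs)"
    and f: "f \<in> C n"
  shows "\<exists>i<n. \<forall>xs\<in>nlists n X. f xs \<in> X \<and> \<rho> (xs ! i) (f xs)"
proof (rule min_induct[OF g _ _ _ f,
      where Q = "\<lambda>n f. \<exists>i<n. \<forall>xs\<in>nlists n X. f xs \<in> X \<and> \<rho> (xs ! i) (f xs)"])
  have nl: "nlists n X \<subseteq> nlists n A" for n using X by (rule nlists_mono)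
  show "\<exists>i<k. \<forall>xs\<in>nlists k X. g xs \<in> X \<and> \<rho> (xs ! i) (g xs)" by fact
  show "\<exists>j<n. \<forall>xs\<in>nlists n X. (\<lambda>xs\<in>nlists n A. xs ! i) xs \<in> X \<and>
      \<rho> (xs ! j) ((\<lambda>xs\<in>nlists n A. xs ! i) xs)" if "i < n" for n i
    using that nl[of n] refl nlistsE_nth_in[of _ n X i] by (intro exI[of _ i]) auto
  fix k n f gs
  assume f: "f \<in> C k" "\<exists>i<k. \<forall>xs\<in>nlists k X. f xs \<in> X \<and> \<rho> (xs ! i) (f xs)"
    and gs: "gs \<in> nlists k (C n)"
    and gs': "\<And>g. g \<in> set gs \<Longrightarrow> \<exists>i<n. \<forall>xs\<in>nlists n X. g xs \<in> X \<and> \<rho> (xs ! i) (g xs)"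
  obtain i where i: "i < k" "\<forall>xs\<in>nlists k X. f xs \<in> X \<and> \<rho> (xs ! i) (f xs)" using f by blast
  have len: "length gs = k" using gs by simp
  obtain j where j: "j < n" "\<forall>xs\<in>nlists n X. (gs ! i) xs \<in> X \<and> \<rho> (xs ! j) ((gs ! i) xs)"
    using gs'[of "gs ! i"] i len by auto
  have "f (map (\<lambda>g. g xs) gs) \<in> X \<and> \<rho> (xs ! j) (f (map (\<lambda>g. g xs) gs))" if xs: "xs \<in> nlists n X" for xs
  proof -
    have "g xs \<in> X" if "g \<in> set gs" for g using gs'[OF that] xs by blast
    then have m: "map (\<lambda>g. g xs) gs \<in> nlists k X" using len by (intro nlistsI) auto
    then have "f (map (\<lambda>g. g xs) gs) \<in> X" "\<rho> ((gs ! i) xs) (f (map (\<lambda>g. g xs) gs))"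
      using i len by auto
    moreover have "xs ! j \<in> X" using xs j by (auto intro: nlistsE_nth_in)
    ultimately show ?thesis using j xs trans by blast
  qed
  then show "\<exists>i<n. \<forall>xs\<in>nlists n X. (\<lambda>xs\<in>nlists n A. f (map (\<lambda>g. g xs) gs)) xs \<in> X \<and>
    \<rho> (xs ! i) ((\<lambda>xs\<in>nlists n A. f (map (\<lambda>g. g xs) gs)) xs)"
    using j(1) nl[of n] by (intro exI[of _ j]) auto
qed

text \<open>
  If \<open>g\<close> is a coordinate on a pair but not on \<open>A\<close>, then it generates the clone, so every operation
  is a coordinate on that pair, which the Taylor identities exclude.
\<close>

lemma coordinate_on_pair:
  assumes g: "g \<in> C k" and ab: "a \<in> A" "b \<in> A" "a \<noteq> b"
    and i: "i < k" "\<forall>xs\<in>nlists k {a, b}. g xs = xs ! i" and ys: "ys \<in> nlists k A"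
  shows "g ys = ys ! i"
proof -
  obtain m t where t: "t \<in> C m" "\<not> (\<exists>i<m. \<forall>xs\<in>nlists m {a, b}. t xs = xs ! i)"
    using taylor[OF ab] by blast
  have "g \<in> projections A k"
  proof (rule ccontr)
    assume np: "g \<notin> projections A k"
    have "\<exists>i<m. \<forall>xs\<in>nlists m {a, b}. t xs \<in> {a, b} \<and> xs ! i = t xs"
    proof (rule coord_induct[OF g np _ _ _ _ t(1), where \<rho> = "(=)"])
      show "\<exists>i<k. \<forall>xs\<in>nlists k {a, b}. g xs \<in> {a, b} \<and> xs ! i = g xs"
        using i nlistsE_nth_in by (metis (no_types, lifting))
    qed (use ab in auto)
    then show False using t(2) by auto
  qed
  then have "\<exists>j<k. \<forall>xs\<in>nlists k A. g xs = xs ! j" by (simp add: projections_iff[OF g])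
  then obtain j where j: "j < k" "\<forall>xs\<in>nlists k A. g xs = xs ! j" by blast
  have "j = i"
  proof (rule ccontr)
    assume ne: "j \<noteq> i"
    let ?xs = "(replicate k a)[i := b]"
    have "?xs \<in> nlists k {a, b}"
      by (intro nlists_update_in_list nlists_replicateI) simp_all
    moreover from this have "?xs \<in> nlists k A" using ab nlists_mono[of "{a,b}" A k] by blast
    ultimately have "?xs ! i = ?xs ! j" using i j by metis
    then show False using ne i j ab by simp
  qed
  then show ?thesis using j ys by simp
qed

text \<open>
  Operations are written as total functions, of which only the values on \<open>A\<close> matter.
\<close>

definition opn :: "nat \<Rightarrow> ('a list \<Rightarrow> 'a) \<Rightarrow> bool" where
  "opn n F \<longleftrightarrow> (\<lambda>xs\<in>nlists n A. F xs) \<in> C n"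

definition bin :: "('a \<Rightarrow> 'a \<Rightarrow> 'a) \<Rightarrow> bool" where
  "bin g \<longleftrightarrow> opn 2 (\<lambda>xs. g (xs ! 0) (xs ! 1))"

definition ter :: "('a \<Rightarrow> 'a \<Rightarrow> 'a \<Rightarrow> 'a) \<Rightarrow> bool" where
  "ter g \<longleftrightarrow> opn 3 (\<lambda>xs. g (xs ! 0) (xs ! 1) (xs ! 2))"

lemma opn_C: "f \<in> C n \<Longrightarrow> opn n f"
  by (simp add: opn_def C_restrict)

lemma opn_closed: "opn n F \<Longrightarrow> xs \<in> nlists n A \<Longrightarrow> F xs \<in> A"
  unfolding opn_def using C_closed by fastforce

lemma opn_proj: "i < n \<Longrightarrow> opn n (\<lambda>xs. xs ! i)"
  unfolding opn_def by (rule C_proj)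

lemma opn_comp:
  assumes F: "opn k F" and G: "\<And>i. i < k \<Longrightarrow> opn n (G i)"
  shows "opn n (\<lambda>xs. F (map (\<lambda>i. G i xs) [0..<k]))"
proof -
  let ?gs = "map (\<lambda>i. \<lambda>xs\<in>nlists n A. G i xs) [0..<k]"
  have gs: "?gs \<in> nlists k (C n)" using G by (intro nlistsI) (auto simp: opn_def)
  have "(\<lambda>xs\<in>nlists n A. (\<lambda>xs\<in>nlists k A. F xs) (map (\<lambda>g. g xs) ?gs)) \<in> C n"
    using C_comp[OF _ gs] F unfolding opn_def by blast
  also have "(\<lambda>xs\<in>nlists n A. (\<lambda>xs\<in>nlists k A. F xs) (map (\<lambda>g. g xs) ?gs)) =
      (\<lambda>xs\<in>nlists n A. F (map (\<lambda>i. G i xs) [0..<k]))"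
  proof (rule restrict_ext)
    fix xs assume xs: "xs \<in> nlists n A"
    then have eq: "map (\<lambda>g. g xs) ?gs = map (\<lambda>i. G i xs) [0..<k]" by simp
    show "(\<lambda>xs\<in>nlists k A. F xs) (map (\<lambda>g. g xs) ?gs) = F (map (\<lambda>i. G i xs) [0..<k])"
      using map_closed[OF gs xs] unfolding eq by simp
  qed
  finally show ?thesis unfolding opn_def .
qed

lemma opn_bin:
  assumes "bin g" "opn n F" "opn n G"
  shows "opn n (\<lambda>xs. g (F xs) (G xs))"
  using opn_comp[of 2 "\<lambda>xs. g (xs ! 0) (xs ! 1)" n "\<lambda>i. if i = 0 then F else G"] assms
  by (simp add: bin_def)

lemma opn_ter:
  assumes "ter g" "opn n F" "opn n G" "opn n H"
  shows "opn n (\<lambda>xs. g (F xs) (G xs) (H xs))"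
  using opn_comp[of 3 "\<lambda>xs. g (xs ! 0) (xs ! 1) (xs ! 2)" n
      "\<lambda>i. if i = 0 then F else if i = 1 then G else H"] assms
  by (simp add: ter_def)

lemma nlists_2: "xs \<in> nlists 2 X \<longleftrightarrow> (\<exists>x\<in>X. \<exists>y\<in>X. xs = [x, y])"
  by (auto simp: numeral_2_eq_2 in_nlists_Suc_iff)

lemma nlists_3: "xs \<in> nlists 3 X \<longleftrightarrow> (\<exists>x\<in>X. \<exists>y\<in>X. \<exists>z\<in>X. xs = [x, y, z])"
  by (auto simp: numeral_3_eq_3 in_nlists_Suc_iff)

lemma ball_nlists_2: "(\<forall>xs\<in>nlists 2 X. P xs) \<longleftrightarrow> (\<forall>x\<in>X. \<forall>y\<in>X. P [x, y])"
  by (auto simp: nlists_2)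

lemma ball_nlists_3: "(\<forall>xs\<in>nlists 3 X. P xs) \<longleftrightarrow> (\<forall>x\<in>X. \<forall>y\<in>X. \<forall>z\<in>X. P [x, y, z])"
  by (auto simp: nlists_3)

lemma bin_C: "bin g \<Longrightarrow> (\<lambda>xs\<in>nlists 2 A. g (xs ! 0) (xs ! 1)) \<in> C 2"
  by (simp add: bin_def opn_def)

lemma ter_C: "ter g \<Longrightarrow> (\<lambda>xs\<in>nlists 3 A. g (xs ! 0) (xs ! 1) (xs ! 2)) \<in> C 3"
  by (simp add: ter_def opn_def)

lemma bin_fst: "bin (\<lambda>x y. x)" and bin_snd: "bin (\<lambda>x y. y)"
  unfolding bin_def by (simp_all add: opn_proj)

lemma ter_1: "ter (\<lambda>x y z. x)" and ter_2: "ter (\<lambda>x y z. y)" and ter_3: "ter (\<lambda>x y z. z)"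
  unfolding ter_def by (simp_all add: opn_proj)

lemma bin_comp: "bin g \<Longrightarrow> bin h \<Longrightarrow> bin k \<Longrightarrow> bin (\<lambda>x y. g (h x y) (k x y))"
  using opn_bin[of g 2] unfolding bin_def by simp

lemma bin_ter: "ter g \<Longrightarrow> bin h \<Longrightarrow> bin k \<Longrightarrow> bin l \<Longrightarrow> bin (\<lambda>x y. g (h x y) (k x y) (l x y))"
  using opn_ter[of g 2] unfolding bin_def by simp

lemma ter_comp: "ter g \<Longrightarrow> ter h \<Longrightarrow> ter k \<Longrightarrow> ter l \<Longrightarrow> ter (\<lambda>x y z. g (h x y z) (k x y z) (l x y z))"
  using opn_ter[of g 3] unfolding ter_def by simp

lemma ter_bin: "bin g \<Longrightarrow> ter h \<Longrightarrow> ter k \<Longrightarrow> ter (\<lambda>x y z. g (h x y z) (k x y z))"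
  using opn_bin[of g 3] unfolding ter_def by simp

lemma bin_swap: "bin g \<Longrightarrow> bin (\<lambda>x y. g y x)"
  using bin_comp[OF _ bin_snd bin_fst] by blast

lemma bin_closed: "bin g \<Longrightarrow> x \<in> A \<Longrightarrow> y \<in> A \<Longrightarrow> g x y \<in> A"
  unfolding bin_def using opn_closed[of 2 _ "[x, y]"] by (fastforce simp: nlists_2)

lemma ter_closed: "ter g \<Longrightarrow> x \<in> A \<Longrightarrow> y \<in> A \<Longrightarrow> z \<in> A \<Longrightarrow> g x y z \<in> A"
  unfolding ter_def using opn_closed[of 3 _ "[x, y, z]"] by (fastforce simp: nlists_3)

lemma bin_idem: "bin g \<Longrightarrow> x \<in> A \<Longrightarrow> g x x = x"
  using idempotent[OF bin_C, of g x] by (simp add: numeral_2_eq_2 nlists_2[unfolded numeral_2_eq_2])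

lemma ter_idem: "ter g \<Longrightarrow> x \<in> A \<Longrightarrow> g x x x = x"
  using idempotent[OF ter_C, of g x] by (simp add: numeral_3_eq_3 nlists_3[unfolded numeral_3_eq_3])

lemma ter_not_projection:
  assumes "ter s" "a \<in> A" "b \<in> A" "\<And>i. i < 3 \<Longrightarrow>
    s a a b \<noteq> [a, a, b] ! i \<or> s a b a \<noteq> [a, b, a] ! i \<or> s b a a \<noteq> [b, a, a] ! i"
  shows "(\<lambda>xs\<in>nlists 3 A. s (xs ! 0) (xs ! 1) (xs ! 2)) \<notin> projections A 3"
proof
  assume "(\<lambda>xs\<in>nlists 3 A. s (xs ! 0) (xs ! 1) (xs ! 2)) \<in> projections A 3"
  then obtain i where "i < 3" "\<forall>xs\<in>nlists 3 A. (\<lambda>xs\<in>nlists 3 A. s (xs ! 0) (xs ! 1) (xs ! 2)) xs = xs ! i"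
    using projections_iff[OF ter_C[OF assms(1)]] by blast
  moreover from this have "s b a a = [b, a, a] ! i" "s a b a = [a, b, a] ! i" "s a a b = [a, a, b] ! i"
    using assms(2,3) by (simp_all add: ball_nlists_3 nlists_3)
  ultimately show False using assms(4) by blast
qed

section \<open>Binary non-projections and subalgebras\<close>

definition proper :: "('a \<Rightarrow> 'a \<Rightarrow> 'a) \<Rightarrow> bool" where
  "proper g \<longleftrightarrow> bin g \<and> \<not> (\<forall>x\<in>A. \<forall>y\<in>A. g x y = x) \<and> \<not> (\<forall>x\<in>A. \<forall>y\<in>A. g x y = y)"

lemma proper_bin: "proper g \<Longrightarrow> bin g"
  by (simp add: proper_def)

lemma proper_not_projection:
  assumes "proper g"
  shows "(\<lambda>xs\<in>nlists 2 A. g (xs ! 0) (xs ! 1)) \<notin> projections A 2"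
proof
  assume "(\<lambda>xs\<in>nlists 2 A. g (xs ! 0) (xs ! 1)) \<in> projections A 2"
  then obtain i where i: "i < 2" "\<forall>xs\<in>nlists 2 A. g (xs ! 0) (xs ! 1) = xs ! i"
    using projections_iff[OF bin_C[OF proper_bin[OF assms]]] by auto
  then have "\<forall>x\<in>A. \<forall>y\<in>A. g x y = [x, y] ! i" by (simp add: ball_nlists_2)
  moreover have "i = 0 \<or> i = 1" using i by auto
  ultimately show False using assms by (auto simp: proper_def)
qed

lemma pair_fst:
  assumes "bin g" "a \<in> A" "b \<in> A" "a \<noteq> b" "g a b = a" "g b a = b" "x \<in> A" "y \<in> A"
  shows "g x y = x"
  using coordinate_on_pair[OF bin_C[OF assms(1)] assms(2-4), of 0 "[x, y]"] assms
  by (auto simp: nlists_2 ball_nlists_2 bin_idem)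

lemma pair_snd:
  assumes "bin g" "a \<in> A" "b \<in> A" "a \<noteq> b" "g a b = b" "g b a = a" "x \<in> A" "y \<in> A"
  shows "g x y = y"
  using pair_fst[OF bin_swap[OF assms(1)] assms(2-4), of y x] assms by simp

definition sub :: "'a set \<Rightarrow> bool" where
  "sub X \<longleftrightarrow> X \<subseteq> A \<and> (\<forall>n. \<forall>f\<in>C n. \<forall>xs\<in>nlists n X. f xs \<in> X)"

text \<open>Preserving \<open>X\<close> is inherited by compositions. Subalgebras can thus be
  recognised with whichever non-projection is at hand, even one built for that single
  purpose.\<close>

lemma sub_min:
  assumes g: "g \<in> C k" "g \<notin> projections A k" and X: "X \<subseteq> A" "\<forall>xs\<in>nlists k X. g xs \<in> X"
  shows "sub X"
proof -
  have nl: "nlists n X \<subseteq> nlists n A" for n using X by (intro nlists_mono)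
  have "\<forall>xs\<in>nlists n X. f xs \<in> X" if f: "f \<in> C n" for n f
  proof (rule min_induct[OF g _ _ _ f, where Q = "\<lambda>n f. \<forall>xs\<in>nlists n X. f xs \<in> X"])
    show "\<forall>xs\<in>nlists k X. g xs \<in> X" by fact
    show "\<forall>xs\<in>nlists n X. (\<lambda>xs\<in>nlists n A. xs ! i) xs \<in> X" if "i < n" for i n
      using that nl[of n] nlistsE_nth_in[of _ n X i] by auto
    fix k n f gs
    assume f: "\<forall>xs\<in>nlists k X. f xs \<in> X" "gs \<in> nlists k (C n)"
      "\<And>g. g \<in> set gs \<Longrightarrow> \<forall>xs\<in>nlists n X. g xs \<in> X"
    have "f (map (\<lambda>g. g xs) gs) \<in> X" if "xs \<in> nlists n X" for xs
    proof -
      have "g xs \<in> X" if "g \<in> set gs" for g using f(3)[OF that] \<open>xs \<in> nlists n X\<close> by blast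
      then have "map (\<lambda>g. g xs) gs \<in> nlists k X"
        using nlistsE_length[OF f(2)] by (intro nlistsI) auto
      then show ?thesis using f by blast
    qed
    then show "\<forall>xs\<in>nlists n X. (\<lambda>xs\<in>nlists n A. f (map (\<lambda>g. g xs) gs)) xs \<in> X"
      using nl[of n] by auto
  qed
  then show ?thesis using X unfolding sub_def by blast
qed

lemma sub_proper:
  assumes "proper g" "X \<subseteq> A" "\<And>x y. x \<in> X \<Longrightarrow> y \<in> X \<Longrightarrow> g x y \<in> X"
  shows "sub X"
proof (rule sub_min[OF bin_C[OF proper_bin[OF assms(1)]] proper_not_projection[OF assms(1)] assms(2)])
  show "\<forall>xs\<in>nlists 2 X. (\<lambda>xs\<in>nlists 2 A. g (xs ! 0) (xs ! 1)) xs \<in> X"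
    using assms(2,3) by (auto simp: nlists_2 subset_iff)
qed

lemma sub_subset: "sub X \<Longrightarrow> x \<in> X \<Longrightarrow> x \<in> A"
  by (auto simp: sub_def)

lemma sub_C: "sub X \<Longrightarrow> f \<in> C n \<Longrightarrow> xs \<in> nlists n X \<Longrightarrow> f xs \<in> X"
  by (simp add: sub_def)

lemma sub_bin:
  assumes "sub X" "bin g" "x \<in> X" "y \<in> X"
  shows "g x y \<in> X"
  using sub_C[OF assms(1) bin_C[OF assms(2)], of "[x, y]"] assms sub_subset[OF assms(1)]
  by (simp add: nlists_2)

lemma sub_ter:
  assumes "sub X" "ter g" "x \<in> X" "y \<in> X" "z \<in> X"
  shows "g x y z \<in> X"
  using sub_C[OF assms(1) ter_C[OF assms(2)], of "[x, y, z]"] assms sub_subset[OF assms(1)]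
  by (simp add: nlists_3)

lemma sub_A: "sub A"
  by (simp add: sub_def C_closed)

text \<open>Only \<open>g\<close> is known to follow its first argument; \<open>h\<close> may be
  generated with the arguments swapped, hence the disjunction.\<close>

lemma bin_coord_induct:
  assumes g: "proper g" and X: "X \<subseteq> A"
    and refl: "\<And>x. x \<in> X \<Longrightarrow> \<rho> x x"
    and trans: "\<And>x y z. x \<in> X \<Longrightarrow> y \<in> X \<Longrightarrow> z \<in> X \<Longrightarrow> \<rho> x y \<Longrightarrow> \<rho> y z \<Longrightarrow> \<rho> x z"
    and gX: "\<And>x y. x \<in> X \<Longrightarrow> y \<in> X \<Longrightarrow> g x y \<in> X \<and> \<rho> x (g x y)"
    and h: "bin h"
  shows "(\<forall>x\<in>X. \<forall>y\<in>X. \<rho> x (h x y)) \<or> (\<forall>x\<in>X. \<forall>y\<in>X. \<rho> y (h x y))"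
proof -
  have "\<exists>i<2. \<forall>xs\<in>nlists 2 X. (\<lambda>xs\<in>nlists 2 A. h (xs ! 0) (xs ! 1)) xs \<in> X \<and>
      \<rho> (xs ! i) ((\<lambda>xs\<in>nlists 2 A. h (xs ! 0) (xs ! 1)) xs)"
  proof (rule coord_induct[OF bin_C[OF proper_bin[OF g]] proper_not_projection[OF g] X refl trans _ bin_C[OF h]])
    show "\<exists>i<2. \<forall>xs\<in>nlists 2 X. (\<lambda>xs\<in>nlists 2 A. g (xs ! 0) (xs ! 1)) xs \<in> X \<and>
      \<rho> (xs ! i) ((\<lambda>xs\<in>nlists 2 A. g (xs ! 0) (xs ! 1)) xs)"
      using gX X by (intro exI[of _ 0]) (auto simp: ball_nlists_2 nlists_2 subset_iff)
  qed
  then obtain i where "i < 2" and "\<forall>xs\<in>nlists 2 X. (\<lambda>xs\<in>nlists 2 A. h (xs ! 0) (xs ! 1)) xs \<in> X \<and>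
      \<rho> (xs ! i) ((\<lambda>xs\<in>nlists 2 A. h (xs ! 0) (xs ! 1)) xs)" by blast
  then have i: "i < 2" "\<forall>x\<in>X. \<forall>y\<in>X. \<rho> ([x, y] ! i) (h x y)"
    using X by (auto simp: ball_nlists_2 nlists_2 subset_iff)
  moreover have "i = 0 \<or> i = 1" using i by auto
  ultimately show ?thesis by auto
qed

subsection \<open>Ternary operations\<close>

lemma opn_coordinate:
  assumes "opn k F" "a \<in> A" "b \<in> A" "a \<noteq> b" "i < k" "\<And>xs. xs \<in> nlists k {a, b} \<Longrightarrow> F xs = xs ! i"
    and ys: "ys \<in> nlists k A"
  shows "F ys = ys ! i"
proof -
  have "nlists k {a, b} \<subseteq> nlists k A" using assms by (intro nlists_mono) auto
  then have "(\<lambda>xs\<in>nlists k A. F xs) ys = ys ! i"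
    by (intro coordinate_on_pair[OF assms(1)[unfolded opn_def] assms(2-5) _ ys]) (auto simp: assms(6))
  then show ?thesis using ys by simp
qed

text \<open>Among three arguments from a pair two agree, so the equations make \<open>g\<close> the
  first coordinate on a pair, and then everywhere.\<close>

lemma ter_fst:
  assumes g: "ter g" and eq: "\<And>x y. x \<in> A \<Longrightarrow> y \<in> A \<Longrightarrow> g x x y = x \<and> g x y x = x \<and> g y x x = y"
    and xyz: "x \<in> A" "y \<in> A" "z \<in> A"
  shows "g x y z = x"
proof -
  obtain a b where ab: "a \<in> A" "b \<in> A" "a \<noteq> b" using nontrivial_A by blast
  have "g ([x, y, z] ! 0) ([x, y, z] ! 1) ([x, y, z] ! 2) = [x, y, z] ! 0"
    by (rule opn_coordinate[OF g[unfolded ter_def] ab])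
      (use ab xyz eq in \<open>auto simp: nlists_3\<close>)
  then show ?thesis by simp
qed

definition majority where
  "majority g \<longleftrightarrow> ter g \<and> (\<forall>x\<in>A. \<forall>y\<in>A. g x x y = x \<and> g x y x = x \<and> g y x x = x)"

definition malcev where
  "malcev p \<longleftrightarrow> ter p \<and> (\<forall>x\<in>A. \<forall>y\<in>A. p x y y = x \<and> p y y x = x)"

text \<open>For \<open>p x y z = x - y + z\<close> the operation \<open>p _ c _\<close> is addition
  with zero \<open>c\<close>, and the condition says that \<open>p\<close> is additive for it. The
  parameter \<open>X\<close> allows a check on a pair before the transfer to
  \<open>A\<close>.\<close>

definition medial_on where
  "medial_on X p \<longleftrightarrow> (\<forall>u1\<in>X. \<forall>u2\<in>X. \<forall>u3\<in>X. \<forall>c\<in>X. \<forall>v1\<in>X. \<forall>v2\<in>X. \<forall>v3\<in>X.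
    p (p u1 c v1) (p u2 c v2) (p u3 c v3) = p (p u1 u2 u3) c (p v1 v2 v3))"

text \<open>The hypotheses are the Pixley identities, and \<open>g x (g x y z) z\<close> is the
  classical majority term obtained from them.\<close>

lemma pixley_majority:
  assumes g: "ter g" and eq: "\<And>x y. x \<in> A \<Longrightarrow> y \<in> A \<Longrightarrow> g x x y = y \<and> g x y x = x \<and> g y x x = y"
  shows "\<exists>m. majority m"
proof -
  have "ter (\<lambda>x y z. g x (g x y z) z)"
    by (intro ter_comp[OF g ter_1 _ ter_3] g)
  moreover have "g x (g x x y) y = x \<and> g x (g x y x) x = x \<and> g y (g y x x) x = x" if "x \<in> A" "y \<in> A" for x y
    using eq[OF that] eq[OF that(2,1)] ter_idem[OF g] that by simp
  ultimately show ?thesis unfolding majority_def by blast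
qed

text \<open>
  With a Maltsev operation, an identity \<open>s \<approx> t\<close> is equivalent to \<open>p(s, t, w) \<approx> w\<close> for a fresh
  variable \<open>w\<close>, and the latter says that an operation is a coordinate, so a single pair suffices.
\<close>

lemma medial_transfer:
  assumes p: "malcev p" and ab: "a \<in> A" "b \<in> A" "a \<noteq> b" and m: "medial_on {a, b} p"
  shows "medial_on A p"
proof -
  have tp: "ter p" and mal: "\<And>x y. x \<in> A \<Longrightarrow> y \<in> A \<Longrightarrow> p x y y = x \<and> p y y x = x"
    using p by (auto simp: malcev_def)
  \<comment> \<open>Coordinates \<open>0\<close> to \<open>6\<close> stand for
    \<open>u1 u2 u3 c v1 v2 v3\<close>, coordinate \<open>7\<close> for the fresh variable.\<close>
  define L where "L xs = p (p (xs ! 0) (xs ! 3) (xs ! 4)) (p (xs ! 1) (xs ! 3) (xs ! 5))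
    (p (xs ! 2) (xs ! 3) (xs ! 6))" for xs
  define R where "R xs = p (p (xs ! 0) (xs ! 1) (xs ! 2)) (xs ! 3) (p (xs ! 4) (xs ! 5) (xs ! 6))" for xs
  have oL: "opn 8 L" and oR: "opn 8 R"
    unfolding L_def R_def by (intro opn_ter[OF tp] opn_proj; simp)+
  have o: "opn 8 (\<lambda>xs. p (L xs) (R xs) (xs ! 7))"
    by (intro opn_ter[OF tp] oL oR opn_proj) simp
  have nl: "nlists 8 {a, b} \<subseteq> nlists 8 A" using ab by (intro nlists_mono) auto
  have "p (L xs) (R xs) (xs ! 7) = xs ! 7" if xs: "xs \<in> nlists 8 {a, b}" for xs
  proof -
    have i: "xs ! i \<in> {a, b}" if "i < 8" for i using that xs by (rule nlistsE_nth_in[rotated])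
    have "L xs = R xs"
      unfolding L_def R_def by (rule m[unfolded medial_on_def, rule_format]) (rule i, simp)+
    moreover have "R xs \<in> A" "xs ! 7 \<in> A"
      using xs nl opn_closed[OF oR, of xs] i[of 7] ab by auto
    ultimately show ?thesis using mal by simp
  qed
  then have *: "p (L xs) (R xs) (xs ! 7) = xs ! 7" if "xs \<in> nlists 8 A" for xs
    using opn_coordinate[OF o ab, of 7] that by simp
  show ?thesis
    unfolding medial_on_def
  proof (intro ballI)
    fix u1 u2 u3 c v1 v2 v3 assume A: "u1 \<in> A" "u2 \<in> A" "u3 \<in> A" "c \<in> A" "v1 \<in> A" "v2 \<in> A" "v3 \<in> A"
    let ?l = "p (p u1 c v1) (p u2 c v2) (p u3 c v3)"
    let ?r = "p (p u1 u2 u3) c (p v1 v2 v3)"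
    have lr: "?l \<in> A" "?r \<in> A" using A by (auto intro!: ter_closed[OF tp])
    \<comment> \<open>The fresh variable receives the right-hand side: \<open>p ?l ?r ?r\<close> is
      \<open>?r\<close> as a coordinate and \<open>?l\<close> by the Maltsev law.\<close>
    let ?xs = "[u1, u2, u3, c, v1, v2, v3, ?r]"
    have "?xs \<in> nlists 8 A" using A lr by (intro nlistsI) auto
    from *[OF this] have "p ?l ?r ?r = ?r" by (simp add: L_def R_def)
    then show "?l = ?r" using mal lr by simp
  qed
qed

text \<open>
  If all ternary operations are projections, then the sets \<open>S\<close> such that a Taylor operation takes
  the value \<open>a\<close> at the tuple that is \<open>a\<close> on \<open>S\<close> and \<open>b\<close> elsewhere form an ultrafilter.
\<close>

lemma exists_ternary:
  "\<exists>g. ter g \<and> \<not> (\<forall>x\<in>A. \<forall>y\<in>A. \<forall>z\<in>A. g x y z = x) \<and> \<not> (\<forall>x\<in>A. \<forall>y\<in>A. \<forall>z\<in>A. g x y z = y)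
    \<and> \<not> (\<forall>x\<in>A. \<forall>y\<in>A. \<forall>z\<in>A. g x y z = z)"
proof (rule ccontr)
  assume no: "\<not> ?thesis"
  obtain a b where ab: "a \<in> A" "b \<in> A" "a \<noteq> b" using nontrivial_A by blast
  obtain n t where t: "t \<in> C n" "\<not> (\<exists>i<n. \<forall>xs\<in>nlists n {a, b}. t xs = xs ! i)"
    using taylor[OF ab] by blast
  define v where "v S = t (map (\<lambda>i. if i \<in> S then a else b) [0..<n])" for S
  \<comment> \<open>Identifying the arguments of \<open>t\<close> within \<open>S\<close>, within
    \<open>T\<close> and within the rest gives a ternary operation, a projection by assumption. The
    three cases tell which block decides.\<close>
  have split: "v S = a \<and> v (S \<union> T) = a \<and> v T = b \<or> v S = b \<and> v T = a \<and> v (S \<union> T) = a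
      \<or> v S = b \<and> v T = b \<and> v (S \<union> T) = b" if ST: "S \<inter> T = {}" for S T
  proof -
    define g where "g x y z = t (map (\<lambda>i. if i \<in> S then x else if i \<in> T then y else z) [0..<n])" for x y z
    have "opn 3 (\<lambda>xs. if i \<in> S then xs ! 0 else if i \<in> T then xs ! 1 else xs ! 2)" for i
      by (cases "i \<in> S"; cases "i \<in> T"; simp add: opn_proj)
    then have "ter g"
      unfolding ter_def g_def
      by (rule opn_comp[OF opn_C[OF t(1)], where G = "\<lambda>i xs. if i \<in> S then xs ! 0 else if i \<in> T then xs ! 1 else xs ! 2"])
    then have "(\<forall>x\<in>A. \<forall>y\<in>A. \<forall>z\<in>A. g x y z = x) \<or> (\<forall>x\<in>A. \<forall>y\<in>A. \<forall>z\<in>A. g x y z = y)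
      \<or> (\<forall>x\<in>A. \<forall>y\<in>A. \<forall>z\<in>A. g x y z = z)" using no by blast
    then have "g a b b = a \<and> g b a b = b \<and> g a a b = a \<or> g a b b = b \<and> g b a b = a \<and> g a a b = a
      \<or> g a b b = b \<and> g b a b = b \<and> g a a b = b" using ab by (elim disjE) auto
    moreover have "g a b b = v S"
      unfolding g_def v_def by (intro arg_cong[of _ _ t] map_cong) auto
    moreover have "g a a b = v (S \<union> T)"
      unfolding g_def v_def by (intro arg_cong[of _ _ t] map_cong) auto
    moreover have "g b a b = v T"
      unfolding g_def v_def using ST by (intro arg_cong[of _ _ t] map_cong) auto
    ultimately show ?thesis by auto
  qed
  have empty: "v {} = b"
    using idempotent[OF t(1) ab(2)] by (simp add: v_def map_replicate_const)
  have "map (\<lambda>i. if i \<in> {..<n} then a else b) [0..<n] = replicate n a"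
    by (intro nth_equalityI) auto
  then have full: "v {..<n} = a"
    using idempotent[OF t(1) ab(1)] by (simp add: v_def)
  have "\<exists>S. (S \<subseteq> {..<n} \<and> v S = a) \<and> (\<forall>T. T \<subseteq> {..<n} \<and> v T = a \<longrightarrow> card S \<le> card T)"
    using full by (intro ex_has_least_nat[of _ "{..<n}"]) simp
  \<comment> \<open>Cutting a smallest set of value \<open>a\<close> into \<open>{i}\<close> and the
    rest leaves the value \<open>a\<close> to \<open>{i}\<close>. So the ultrafilter is principal
    and \<open>t\<close> is the coordinate \<open>i\<close> on the pair.\<close>
  then obtain S where S: "S \<subseteq> {..<n}" "v S = a" and min: "\<And>T. T \<subseteq> {..<n} \<Longrightarrow> v T = a \<Longrightarrow> card S \<le> card T"
    by blast
  have "S \<noteq> {}" using S empty ab by auto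
  then obtain i where i: "i \<in> S" by blast
  have fin: "finite S" using S(1) by (rule finite_subset) simp
  have "card (S - {i}) < card S" using i fin by (rule card_Diff1_less[rotated])
  then have "v (S - {i}) \<noteq> a" using min[of "S - {i}"] S(1) by auto
  moreover have "{i} \<union> (S - {i}) = S" using i by auto
  ultimately have vi: "v {i} = a" using split[of "{i}" "S - {i}"] S(2) ab by auto
  have "t xs = xs ! i" if xs: "xs \<in> nlists n {a, b}" for xs
  proof -
    define T where "T = {j. j < n \<and> xs ! j = a}"
    have len: "length xs = n" using xs by simp
    have i': "i < n" using i S by auto
    have ent: "xs ! j \<in> {a, b}" if "j < n" for j using xs that by (rule nlistsE_nth_in)
    have "xs = map (\<lambda>j. if j \<in> T then a else b) [0..<n]"
      using ent len by (intro nth_equalityI) (auto simp: T_def)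
    then have tx: "t xs = v T" by (simp add: v_def)
    show ?thesis
    proof (cases "xs ! i = a")
      case True
      then have "{i} \<union> (T - {i}) = T" using i' by (auto simp: T_def)
      then show ?thesis using split[of "{i}" "T - {i}"] vi ab tx True by auto
    next
      case False
      then have "{i} \<inter> T = {}" "xs ! i = b" using ent[OF i'] by (auto simp: T_def)
      then show ?thesis using split[of "{i}" T] vi ab tx by auto
    qed
  qed
  then show False using t(2) i S by auto
qed

text \<open>Each of the three ways to identify two arguments of \<open>g\<close> yields the majority
  or the minority value. With no minority value \<open>g\<close> is a majority operation; with one
  it would be a projection; with two it is Pixley up to permutation; with three it is addition
  modulo 2 on a pair, which is medial.\<close>

lemma trivial_binary_case:
  assumes no: "\<And>g. \<not> proper g"
  shows "(\<exists>g. majority g) \<or> (\<exists>p. malcev p \<and> medial_on A p)"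
proof -
  obtain g where g: "ter g" and n1: "\<not> (\<forall>x\<in>A. \<forall>y\<in>A. \<forall>z\<in>A. g x y z = x)"
    and n2: "\<not> (\<forall>x\<in>A. \<forall>y\<in>A. \<forall>z\<in>A. g x y z = y)" and n3: "\<not> (\<forall>x\<in>A. \<forall>y\<in>A. \<forall>z\<in>A. g x y z = z)"
    using exists_ternary by blast
  have perm: "ter (\<lambda>x y z. g y x z)" "ter (\<lambda>x y z. g x z y)" "ter (\<lambda>x y z. g z y x)"
    by (intro ter_comp[OF g] ter_1 ter_2 ter_3)+
  have triv: "(\<forall>x\<in>A. \<forall>y\<in>A. h x y = x) \<or> (\<forall>x\<in>A. \<forall>y\<in>A. h x y = y)" if "bin h" for h
    using no[of h] that by (auto simp: proper_def)
  have 1: "(\<forall>x\<in>A. \<forall>y\<in>A. g x x y = x) \<or> (\<forall>x\<in>A. \<forall>y\<in>A. g x x y = y)"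
    by (rule triv) (intro bin_ter[OF g] bin_fst bin_snd)
  have 2: "(\<forall>x\<in>A. \<forall>y\<in>A. g x y x = x) \<or> (\<forall>x\<in>A. \<forall>y\<in>A. g x y x = y)"
    by (rule triv) (intro bin_ter[OF g] bin_fst bin_snd)
  have 3: "(\<forall>x\<in>A. \<forall>y\<in>A. g y x x = x) \<or> (\<forall>x\<in>A. \<forall>y\<in>A. g y x x = y)"
    by (rule triv) (intro bin_ter[OF g] bin_fst bin_snd)
  from 1 2 3 show ?thesis
  proof (elim disjE)
    assume "\<forall>x\<in>A. \<forall>y\<in>A. g x x y = x" "\<forall>x\<in>A. \<forall>y\<in>A. g x y x = x" "\<forall>x\<in>A. \<forall>y\<in>A. g y x x = x"
    then show ?thesis using g by (auto simp: majority_def)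
  next
    assume "\<forall>x\<in>A. \<forall>y\<in>A. g x x y = x" "\<forall>x\<in>A. \<forall>y\<in>A. g x y x = x" "\<forall>x\<in>A. \<forall>y\<in>A. g y x x = y"
    then show ?thesis using ter_fst[OF g] n1 by simp
  next
    assume "\<forall>x\<in>A. \<forall>y\<in>A. g x x y = x" "\<forall>x\<in>A. \<forall>y\<in>A. g x y x = y" "\<forall>x\<in>A. \<forall>y\<in>A. g y x x = x"
    then show ?thesis using ter_fst[OF perm(1)] n2 by simp
  next
    assume "\<forall>x\<in>A. \<forall>y\<in>A. g x x y = y" "\<forall>x\<in>A. \<forall>y\<in>A. g x y x = x" "\<forall>x\<in>A. \<forall>y\<in>A. g y x x = x"
    then show ?thesis using ter_fst[OF perm(3)] n3 by simp
  next
    assume "\<forall>x\<in>A. \<forall>y\<in>A. g x x y = x" "\<forall>x\<in>A. \<forall>y\<in>A. g x y x = y" "\<forall>x\<in>A. \<forall>y\<in>A. g y x x = y"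
    then show ?thesis using pixley_majority[OF perm(2)] by simp
  next
    assume "\<forall>x\<in>A. \<forall>y\<in>A. g x x y = y" "\<forall>x\<in>A. \<forall>y\<in>A. g x y x = x" "\<forall>x\<in>A. \<forall>y\<in>A. g y x x = y"
    then show ?thesis using pixley_majority[OF g] by simp
  next
    assume "\<forall>x\<in>A. \<forall>y\<in>A. g x x y = y" "\<forall>x\<in>A. \<forall>y\<in>A. g x y x = y" "\<forall>x\<in>A. \<forall>y\<in>A. g y x x = x"
    then show ?thesis using pixley_majority[OF perm(1)] by simp
  next
    assume m: "\<forall>x\<in>A. \<forall>y\<in>A. g x x y = y" "\<forall>x\<in>A. \<forall>y\<in>A. g x y x = y" "\<forall>x\<in>A. \<forall>y\<in>A. g y x x = y"
    then have mal: "malcev g" using g by (auto simp: malcev_def)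
    obtain a b where ab: "a \<in> A" "b \<in> A" "a \<noteq> b" using nontrivial_A by blast
    have "medial_on {a, b} g"
      unfolding medial_on_def using m ab by simp
    then show ?thesis using medial_transfer[OF mal ab] mal by blast
  qed
qed

subsection \<open>Minimal subalgebras\<close>

lemma bin_funpow: "bin f \<Longrightarrow> bin (\<lambda>x y. (f x ^^ k) y)"
proof (induction k)
  case 0
  then show ?case by (simp add: bin_snd)
next
  case (Suc k)
  then show ?case using bin_comp[OF Suc.prems bin_fst] by simp
qed

text \<open>For \<open>a, b\<close> in \<open>A\<close> this is the subalgebra of
  \<open>A \<times> A\<close> generated by \<open>(a, b)\<close> and \<open>(b, a)\<close>. Its
  diagonal elements record the binary operations that commute at \<open>a, b\<close>.\<close>

definition Rel :: "'a \<Rightarrow> 'a \<Rightarrow> ('a \<times> 'a) set" where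
  "Rel a b = {(g a b, g b a) |g. bin g}"

lemma Rel_intro: "bin g \<Longrightarrow> (g a b, g b a) \<in> Rel a b"
  unfolding Rel_def by blast

lemma Rel_gen: "(a, b) \<in> Rel a b"
  using Rel_intro[OF bin_fst] .

lemma Rel_sym: "(x, y) \<in> Rel a b \<Longrightarrow> (y, x) \<in> Rel a b"
  unfolding Rel_def using bin_swap by fastforce

lemma Rel_bin:
  assumes "bin f" "(x, y) \<in> Rel a b" "(x', y') \<in> Rel a b"
  shows "(f x x', f y y') \<in> Rel a b"
proof -
  obtain g h where "bin g" "x = g a b" "y = g b a" "bin h" "x' = h a b" "y' = h b a"
    using assms unfolding Rel_def by auto
  then show ?thesis using Rel_intro[OF bin_comp[OF assms(1), of g h]] by simp
qed

lemma Rel_sub: "sub B \<Longrightarrow> a \<in> B \<Longrightarrow> b \<in> B \<Longrightarrow> (x, y) \<in> Rel a b \<Longrightarrow> x \<in> B \<and> y \<in> B"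
  unfolding Rel_def using sub_bin by auto

lemma Rel_mono:
  assumes "(u, v) \<in> Rel a b"
  shows "Rel u v \<subseteq> Rel a b"
proof
  fix z assume "z \<in> Rel u v"
  then obtain g where "bin g" "z = (g u v, g v u)" unfolding Rel_def by blast
  then show "z \<in> Rel a b" using Rel_bin[OF _ assms Rel_sym[OF assms], of g] by simp
qed

definition two :: "'a set \<Rightarrow> bool" where
  "two B \<longleftrightarrow> (\<exists>x\<in>B. \<exists>y\<in>B. x \<noteq> y)"

definition minsub :: "'a set \<Rightarrow> bool" where
  "minsub B \<longleftrightarrow> sub B \<and> two B \<and> (\<forall>X. sub X \<and> two X \<and> X \<subseteq> B \<longrightarrow> X = B)"

lemma exists_minsub: "\<exists>B. minsub B"
proof -
  have "sub A \<and> two A" using sub_A nontrivial_A by (simp add: two_def)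
  from ex_has_least_nat[of "\<lambda>B. sub B \<and> two B", OF this, of card]
  obtain B where B: "sub B" "two B" "\<And>X. sub X \<Longrightarrow> two X \<Longrightarrow> card B \<le> card X" by auto
  have "finite B" using B(1) finite_A by (auto simp: sub_def intro: finite_subset)
  then have "X = B" if "sub X" "two X" "X \<subseteq> B" for X
    using card_seteq[of B X] B(3)[of X] that by blast
  then show ?thesis using B unfolding minsub_def by blast
qed

text \<open>This is how minimality of \<open>B\<close> is used: \<open>X\<close> will be a row of a
  relation or an image, closed under \<open>f\<close>, and two elements in it make it
  everything.\<close>

lemma minsub_eq:
  assumes "minsub B" "proper f" "X \<subseteq> B" "x \<in> X" "y \<in> X" "x \<noteq> y"
    "\<And>x y. x \<in> X \<Longrightarrow> y \<in> X \<Longrightarrow> f x y \<in> X"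
  shows "X = B"
proof -
  have "X \<subseteq> A" using assms(1,3) by (auto simp: minsub_def sub_def)
  then have "sub X" using assms sub_proper by blast
  moreover have "two X" using assms by (auto simp: two_def)
  ultimately show ?thesis using assms by (simp add: minsub_def)
qed

definition rigid :: "'a set \<Rightarrow> bool" where
  "rigid B \<longleftrightarrow> (\<forall>a\<in>B. \<forall>b\<in>B. a \<noteq> b \<longrightarrow> (\<forall>g. proper g \<longrightarrow> g a b \<noteq> a \<and> g a b \<noteq> b))"

lemma rigidD:
  assumes "rigid B" "a \<in> B" "b \<in> B" "a \<noteq> b" "proper g"
  shows "g a b \<noteq> a" "g a b \<noteq> b"
  using assms by (auto simp: rigid_def)

text \<open>Both \<open>(a, b)\<close> and \<open>(b, a)\<close> lie in \<open>Rel a b\<close>. If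
  this is a graph, \<open>g a b = a\<close> forces \<open>g b a = b\<close>, so \<open>g\<close> is
  a projection on the pair and hence on \<open>A\<close>; the value \<open>b\<close> is excluded
  likewise.\<close>

lemma rigid_if_functional:
  assumes B: "sub B"
    and fn: "\<And>a b c d d'. a \<in> B \<Longrightarrow> b \<in> B \<Longrightarrow> a \<noteq> b \<Longrightarrow> (c, d) \<in> Rel a b \<Longrightarrow> (c, d') \<in> Rel a b \<Longrightarrow> d = d'"
  shows "rigid B"
  unfolding rigid_def
proof (intro ballI impI allI)
  fix a b g assume ab: "a \<in> B" "b \<in> B" "a \<noteq> b" and g: "proper g"
  have A: "a \<in> A" "b \<in> A" using ab B sub_subset by blast+
  note bg = proper_bin[OF g]
  show "g a b \<noteq> a \<and> g a b \<noteq> b"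
  proof (intro conjI notI)
    assume eq: "g a b = a"
    have "(a, g b a) \<in> Rel a b" using Rel_intro[OF bg, of a b] eq by simp
    then have "g b a = b" using fn[OF ab _ Rel_gen] by blast
    then show False using pair_fst[OF bg A ab(3) eq] g by (auto simp: proper_def)
  next
    assume eq: "g a b = b"
    have "(b, g b a) \<in> Rel a b" using Rel_intro[OF bg, of a b] eq by simp
    then have "g b a = a" using fn[OF ab _ Rel_sym[OF Rel_gen]] by blast
    then show False using pair_snd[OF bg A ab(3) eq] g by (auto simp: proper_def)
  qed
qed

text \<open>By rigidity the iterates of \<open>f x\<close> from some \<open>y \<noteq> x\<close> in
  \<open>B\<close> never reach \<open>x\<close>. The idempotent power fixes its own value, so
  rigidity makes it a projection, namely the second. Hence a power of each \<open>f x\<close> is the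
  identity on all of \<open>A\<close>, and the preceding power is the inverse.\<close>

lemma rigid_division:
  assumes B: "minsub B" "rigid B" and f: "proper f"
  shows "\<exists>l. bin l \<and> (\<forall>x\<in>A. \<forall>y\<in>A. f x (l x y) = y \<and> l x (f x y) = y)"
proof -
  note bf = proper_bin[OF f]
  obtain N where N: "N > 0" "\<And>x y. x \<in> A \<Longrightarrow> y \<in> A \<Longrightarrow> (f x ^^ N) ((f x ^^ N) y) = (f x ^^ N) y"
    by (rule obtain_idempotent_power[of A f, OF finite_A bin_closed[OF bf]]) auto
  have sB: "sub B" using B by (simp add: minsub_def)
  obtain x y where xy: "x \<in> B" "y \<in> B" "x \<noteq> y" using B by (auto simp: minsub_def two_def)
  have xyA: "x \<in> A" "y \<in> A" using xy sB sub_subset by blast+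
  let ?t = "\<lambda>x y. (f x ^^ N) y"
  have ne: "(f x ^^ k) y \<in> B \<and> (f x ^^ k) y \<noteq> x" for k
  proof (induction k)
    case (Suc k)
    then have *: "(f x ^^ k) y \<in> B" "x \<noteq> (f x ^^ k) y" by auto
    show ?case
      using rigidD(1)[OF B(2) xy(1) * f] sub_bin[OF sB bf xy(1) *(1)] by simp
  qed (use xy in auto)
  have bt: "bin ?t" using bin_funpow[OF bf] .
  have "?t x (?t x y) = ?t x y" using N(2) xyA by blast
  then have "\<not> proper ?t" using rigidD(2)[OF B(2) xy(1), of "?t x y" ?t] ne[of N] by auto
  moreover have "\<not> (\<forall>x\<in>A. \<forall>y\<in>A. ?t x y = x)" using ne[of N] xyA by blast
  ultimately have t: "\<forall>x\<in>A. \<forall>y\<in>A. ?t x y = y" using bt unfolding proper_def by blast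
  obtain M where M: "N = Suc M" using N(1) by (cases N) auto
  have "f x ((f x ^^ M) y) = y \<and> (f x ^^ M) (f x y) = y" if "x \<in> A" "y \<in> A" for x y
    using t that by (simp add: M funpow_swap1)
  then show ?thesis using bin_funpow[OF bf, of M] by blast
qed

text \<open>
  The subalgebra \<open>T\<close> of \<open>B\<^sup>3\<close> generated by \<open>(a, a, b)\<close>, \<open>(a, b, a)\<close>, \<open>(b, a, a)\<close> avoids \<open>(a, a, a)\<close>,
  since otherwise there would be a majority operation. By rectangularity it is the graph of a
  homomorphism \<open>B \<times> B \<rightarrow> B\<close>, which is a sum up to automorphisms of \<open>B\<close>.
\<close>

lemma rigid_medial:
  assumes B: "minsub B" "rigid B" and f: "proper f"
  shows "\<exists>p. malcev p \<and> medial_on A p"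
proof -
  note bf = proper_bin[OF f]
  have sB: "sub B" using B by (simp add: minsub_def)
  have BA: "x \<in> A" if "x \<in> B" for x using that sB sub_subset by blast
  obtain l where l: "bin l" "\<And>x y. x \<in> A \<Longrightarrow> y \<in> A \<Longrightarrow> f x (l x y) = y \<and> l x (f x y) = y"
    using rigid_division[OF B f] by blast
  have "proper (\<lambda>x y. f y x)" using f bin_swap unfolding proper_def by blast
  then obtain r where r: "bin r" "\<And>x y. x \<in> A \<Longrightarrow> y \<in> A \<Longrightarrow> f (r x y) x = y \<and> r x (f y x) = y"
    using rigid_division[OF B, of "\<lambda>x y. f y x"] by blast
  \<comment> \<open>The Maltsev operation of a quasigroup: \<open>r y x\<close> solves
    \<open>f _ y = x\<close>, \<open>l y z\<close> solves \<open>f y _ = z\<close>, and both give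
    \<open>y\<close> on the diagonal.\<close>
  define p where "p x y z = f (r y x) (l y z)" for x y z
  have tp: "ter p"
    unfolding p_def by (intro ter_bin[OF bf] ter_bin[OF l(1)] ter_bin[OF r(1)] ter_1 ter_2 ter_3)
  have mal: "p x y y = x" "p y y x = x" if "x \<in> A" "y \<in> A" for x y
    using l(2)[of y x] r(2)[of y x] that bin_idem[OF l(1), of y] bin_idem[OF r(1), of y] by (simp_all add: p_def)
  have solve: "\<exists>w\<in>B. p x z w = y" if xzy: "x \<in> B" "z \<in> B" "y \<in> B" for x z y
  proof
    let ?w = "f z (l (r z x) y)"
    have rz: "r z x \<in> B" using sub_bin[OF sB r(1)] xzy by blast
    have lz: "l (r z x) y \<in> B" using sub_bin[OF sB l(1) rz] xzy by blast
    show "?w \<in> B" using sub_bin[OF sB bf] xzy lz by blast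
    show "p x z ?w = y" using l(2) BA rz lz xzy by (simp add: p_def)
  qed
  have main: "p (p u1 b v1) (p u2 b v2) (p u3 b v3) = p (p u1 u2 u3) b (p v1 v2 v3)"
    if ab: "a \<in> B" "b \<in> B" "a \<noteq> b"
      and uv: "u1 \<in> B" "u2 \<in> B" "u3 \<in> B" "v1 \<in> B" "v2 \<in> B" "v3 \<in> B" for a b u1 u2 u3 v1 v2 v3
  proof -
    note abA = BA[OF ab(1)] BA[OF ab(2)]
    define T where "T = {(s a a b, s a b a, s b a a) |s. ter s}"
    have T_intro: "(s a a b, s a b a, s b a a) \<in> T" if "ter s" for s
      unfolding T_def using that by blast
    have T_bin: "(g x x', g y y', g z z') \<in> T" if bg: "bin g" and in_T: "(x, y, z) \<in> T" "(x', y', z') \<in> T" for g x x' y y' z z'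
    proof -
      obtain s s' where s: "ter s" "x = s a a b" "y = s a b a" "z = s b a a"
        "ter s'" "x' = s' a a b" "y' = s' a b a" "z' = s' b a a" using in_T unfolding T_def by auto
      have "ter (\<lambda>x y z. g (s x y z) (s' x y z))" using ter_bin[OF bg s(1,5)] .
      from T_intro[OF this] show ?thesis by (simp add: s)
    qed
    have T_ter: "(p x x' x'', p y y' y'', p z z' z'') \<in> T"
      if in_T: "(x, y, z) \<in> T" "(x', y', z') \<in> T" "(x'', y'', z'') \<in> T" for x x' x'' y y' y'' z z' z''
    proof -
      obtain s s' s'' where s: "ter s" "x = s a a b" "y = s a b a" "z = s b a a"
        "ter s'" "x' = s' a a b" "y' = s' a b a" "z' = s' b a a"
        "ter s''" "x'' = s'' a a b" "y'' = s'' a b a" "z'' = s'' b a a"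
        using in_T unfolding T_def by auto
      have "ter (\<lambda>x y z. p (s x y z) (s' x y z) (s'' x y z))" using ter_comp[OF tp s(1,5,9)] .
      from T_intro[OF this] show ?thesis by (simp add: s)
    qed
    have T_gen: "(a, a, b) \<in> T" "(a, b, a) \<in> T" "(b, a, a) \<in> T"
      using T_intro[OF ter_1] T_intro[OF ter_2] T_intro[OF ter_3] by simp_all
    have T_B: "x \<in> B \<and> y \<in> B \<and> z \<in> B" if "(x, y, z) \<in> T" for x y z
      using that sub_ter[OF sB] ab unfolding T_def by auto
    \<comment> \<open>Rigidity turns the minors of such an \<open>s\<close> into projections, so
      \<open>s\<close> is a majority operation. It preserves \<open>{a, b}\<close>, which is then a
      subalgebra containing \<open>f a b\<close>, against rigidity.\<close>
    have T_diag: "(a, a, a) \<notin> T"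
    proof
      assume "(a, a, a) \<in> T"
      then obtain s where s: "ter s" "s a a b = a" "s a b a = a" "s b a a = a" unfolding T_def by auto
      have fst: "\<forall>x\<in>A. \<forall>y\<in>A. h x y = x" if "bin h" "h a b = a" for h
      proof -
        have "\<not> proper h" using rigidD(1)[OF B(2) ab, of h] that(2) by blast
        moreover have "h a b \<noteq> b" using that ab by simp
        ultimately show ?thesis using that(1) abA unfolding proper_def by blast
      qed
      have m: "\<forall>x\<in>A. \<forall>y\<in>A. s x x y = x" "\<forall>x\<in>A. \<forall>y\<in>A. s x y x = x" "\<forall>x\<in>A. \<forall>y\<in>A. s y x x = x"
        by (intro fst bin_ter[OF s(1)] bin_fst bin_snd s)+
      have "(\<lambda>xs\<in>nlists 3 A. s (xs ! 0) (xs ! 1) (xs ! 2)) \<notin> projections A 3"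
        using s(2-4) ab(3) by (intro ter_not_projection[OF s(1) abA]) (auto simp: less_Suc_eq numeral_3_eq_3)
      then have "sub {a, b}"
        using sub_min[OF ter_C[OF s(1)], of "{a, b}"] abA m by (simp add: ball_nlists_3 nlists_3)
      then have "f a b \<in> {a, b}" using sub_bin[OF _ bf] by blast
      then show False using rigidD[OF B(2) ab f] by blast
    qed
    have ex0: "\<exists>z. (a, y, z) \<in> T" if y: "y \<in> B" for y
    proof -
      have "{y \<in> B. \<exists>z. (a, y, z) \<in> T} = B"
      proof (rule minsub_eq[OF B(1) f _ _ _ ab(3)])
        fix x y assume "x \<in> {y \<in> B. \<exists>z. (a, y, z) \<in> T}" "y \<in> {y \<in> B. \<exists>z. (a, y, z) \<in> T}"
        then obtain z z' where xy: "x \<in> B" "y \<in> B" "(a, x, z) \<in> T" "(a, y, z') \<in> T" by blast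
        have "(f a a, f x y, f z z') \<in> T" using T_bin[OF bf xy(3,4)] .
        then show "f x y \<in> {y \<in> B. \<exists>z. (a, y, z) \<in> T}"
          using bin_idem[OF bf abA(1)] sub_bin[OF sB bf xy(1,2)] by auto
      qed (use T_gen ab in auto)
      then show ?thesis using y by blast
    qed
    have ex: "\<exists>z. (x, y, z) \<in> T" if x: "x \<in> B" and y: "y \<in> B" for x y
    proof -
      obtain z where z: "(a, y, z) \<in> T" using ex0[OF y] by blast
      \<comment> \<open>The Maltsev laws change the first coordinate from \<open>a\<close> to
        \<open>b\<close> and keep \<open>y\<close>; so two values of \<open>x\<close> occur with
        this \<open>y\<close>.\<close>
      have "(p a a b, p y a a, p z b a) \<in> T" using T_ter[OF z T_gen(1,3)] .
      then have z': "(b, y, p z b a) \<in> T" using mal abA BA[OF y] by simp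
      have "{x \<in> B. \<exists>z. (x, y, z) \<in> T} = B"
      proof (rule minsub_eq[OF B(1) f _ _ _ ab(3)])
        fix v w assume "v \<in> {x \<in> B. \<exists>z. (x, y, z) \<in> T}" "w \<in> {x \<in> B. \<exists>z. (x, y, z) \<in> T}"
        then obtain z z' where xy: "v \<in> B" "w \<in> B" "(v, y, z) \<in> T" "(w, y, z') \<in> T" by blast
        have "(f v w, f y y, f z z') \<in> T" using T_bin[OF bf xy(3,4)] .
        then show "f v w \<in> {x \<in> B. \<exists>z. (x, y, z) \<in> T}"
          using bin_idem[OF bf BA[OF y]] sub_bin[OF sB bf xy(1,2)] by auto
      qed (use z z' ab in auto)
      then show ?thesis using x by blast
    qed
    have unique: "z = z'" if z: "(x, y, z) \<in> T" and z': "(x, y, z') \<in> T" for x y z z'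
    proof (rule ccontr)
      assume ne: "z \<noteq> z'"
      have xy: "x \<in> B" "y \<in> B" "z \<in> B" "z' \<in> B" using T_B[OF z] T_B[OF z'] by auto
      have all: "{w \<in> B. (x, y, w) \<in> T} = B"
      proof (rule minsub_eq[OF B(1) f _ _ _ ne])
        fix v w assume "v \<in> {w \<in> B. (x, y, w) \<in> T}" "w \<in> {w \<in> B. (x, y, w) \<in> T}"
        then have vw: "v \<in> B" "w \<in> B" "(x, y, v) \<in> T" "(x, y, w) \<in> T" by auto
        have "(f x x, f y y, f v w) \<in> T" using T_bin[OF bf vw(3,4)] .
        then show "f v w \<in> {w \<in> B. (x, y, w) \<in> T}"
          using bin_idem[OF bf BA] xy sub_bin[OF sB bf vw(1,2)] by auto
      qed (use z z' xy in auto)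
      \<comment> \<open>Every third coordinate now occurs over \<open>(x, y)\<close>, so one can be
        chosen for which \<open>p\<close> produces the forbidden triple
        \<open>(a, a, a)\<close>.\<close>
      obtain w where w: "w \<in> B" "p b z w = a" using solve[OF ab(2) xy(3) ab(1)] by blast
      have "(p a x x, p a y y, p b z w) \<in> T" using T_ter[OF T_gen(1) z, of x y w] all w(1) by blast
      then show False using T_diag mal abA BA xy w(2) by simp
    qed
    define F where "F x y = (THE z. (x, y, z) \<in> T)" for x y
    have F: "(x, y, F x y) \<in> T" if "x \<in> B" "y \<in> B" for x y
      unfolding F_def by (rule theI', rule ex_ex1I[OF ex[OF that] unique])
    have F_eq: "F x y = z" if "(x, y, z) \<in> T" for x y z
      using F T_B[OF that] unique that by blast
    have FB: "F x y \<in> B" if "x \<in> B" "y \<in> B" for x y using T_B[OF F[OF that]] by blast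
    have F_bin: "F (f x x') (f y y') = f (F x y) (F x' y')" if "x \<in> B" "y \<in> B" "x' \<in> B" "y' \<in> B" for x y x' y'
      using F_eq[OF T_bin[OF bf F F]] that by blast
    have F_p: "F (p x x' x'') (p y y' y'') = p (F x y) (F x' y') (F x'' y'')"
      if "x \<in> B" "y \<in> B" "x' \<in> B" "y' \<in> B" "x'' \<in> B" "y'' \<in> B" for x y x' y' x'' y''
      using F_eq[OF T_ter[OF F F F]] that by blast
    have F_gen: "F a a = b" "F a b = a" "F b a = a" using F_eq T_gen by blast+
    \<comment> \<open>Write \<open>x = p x a a\<close> and \<open>y = p a a y\<close>; the middle
      argument becomes \<open>F a a = b\<close>.\<close>
    have F_sum: "F x y = p (F x a) b (F a y)" if xy: "x \<in> B" "y \<in> B" for x y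
      using F_p[of x a a a a y] xy ab mal abA BA F_gen by simp
    have surj1: "\<exists>x\<in>B. F x a = u" if "u \<in> B" for u
    proof -
      have "(\<lambda>x. F x a) ` B = B"
      proof (rule minsub_eq[OF B(1) f _ _ _ ab(3)])
        show "a \<in> (\<lambda>x. F x a) ` B" "b \<in> (\<lambda>x. F x a) ` B" using F_gen ab by force+
        show "(\<lambda>x. F x a) ` B \<subseteq> B" using FB ab by auto
        fix v w assume "v \<in> (\<lambda>x. F x a) ` B" "w \<in> (\<lambda>x. F x a) ` B"
        then obtain x y where xy: "x \<in> B" "y \<in> B" "v = F x a" "w = F y a" by auto
        have "f v w = F (f x y) a" using F_bin[of x a y a] xy ab bin_idem[OF bf abA(1)] by simp
        then show "f v w \<in> (\<lambda>x. F x a) ` B" using sub_bin[OF sB bf xy(1,2)] by blast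
      qed
      then have "u \<in> (\<lambda>x. F x a) ` B" using that by simp
      then show ?thesis by (elim imageE) auto
    qed
    have surj2: "\<exists>x\<in>B. F a x = u" if "u \<in> B" for u
    proof -
      have "(\<lambda>x. F a x) ` B = B"
      proof (rule minsub_eq[OF B(1) f _ _ _ ab(3)])
        show "a \<in> (\<lambda>x. F a x) ` B" "b \<in> (\<lambda>x. F a x) ` B" using F_gen ab by force+
        show "(\<lambda>x. F a x) ` B \<subseteq> B" using FB ab by auto
        fix v w assume "v \<in> (\<lambda>x. F a x) ` B" "w \<in> (\<lambda>x. F a x) ` B"
        then obtain x y where xy: "x \<in> B" "y \<in> B" "v = F a x" "w = F a y" by auto
        have "f v w = F a (f x y)" using F_bin[of a x a y] xy ab bin_idem[OF bf abA(1)] by simp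
        then show "f v w \<in> (\<lambda>x. F a x) ` B" using sub_bin[OF sB bf xy(1,2)] by blast
      qed
      then have "u \<in> (\<lambda>x. F a x) ` B" using that by simp
      then show ?thesis by (elim imageE) auto
    qed
    obtain x1 x2 x3 where x: "x1 \<in> B" "F x1 a = u1" "x2 \<in> B" "F x2 a = u2" "x3 \<in> B" "F x3 a = u3"
      using surj1 uv by metis
    obtain y1 y2 y3 where y: "y1 \<in> B" "F a y1 = v1" "y2 \<in> B" "F a y2 = v2" "y3 \<in> B" "F a y3 = v3"
      using surj2 uv by metis
    have xB: "p x1 x2 x3 \<in> B" and yB: "p y1 y2 y3 \<in> B" using sub_ter[OF sB tp] x y by auto
    have "p (p u1 b v1) (p u2 b v2) (p u3 b v3) = p (F x1 y1) (F x2 y2) (F x3 y3)"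
      using F_sum x y by simp
    also have "\<dots> = F (p x1 x2 x3) (p y1 y2 y3)" using F_p x y by simp
    also have "\<dots> = p (F (p x1 x2 x3) a) b (F a (p y1 y2 y3))" using F_sum xB yB by simp
    also have "F (p x1 x2 x3) a = p u1 u2 u3"
      using F_p[of x1 a x2 a x3 a] x ab ter_idem[OF tp abA(1)] by simp
    also have "F a (p y1 y2 y3) = p v1 v2 v3"
      using F_p[of a y1 a y2 a y3] y ab ter_idem[OF tp abA(1)] by simp
    finally show ?thesis .
  qed
  obtain a b where ab: "a \<in> B" "b \<in> B" "a \<noteq> b" using B by (auto simp: minsub_def two_def)
  have mp: "malcev p" using tp mal by (simp add: malcev_def)
  have "medial_on {a, b} p"
    unfolding medial_on_def
  proof (intro ballI)
    fix u1 u2 u3 c v1 v2 v3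
    assume u: "u1 \<in> {a, b}" "u2 \<in> {a, b}" "u3 \<in> {a, b}" and c: "c \<in> {a, b}"
      and v: "v1 \<in> {a, b}" "v2 \<in> {a, b}" "v3 \<in> {a, b}"
    have sb: "{a, b} \<subseteq> B" using ab by auto
    \<comment> \<open>The constant in \<open>main\<close> is the second element of a pair, so any
      \<open>d \<noteq> c\<close> in \<open>B\<close> serves as the first.\<close>
    obtain d where "d \<in> B" "c \<in> B" "d \<noteq> c" using c ab by blast
    then show "p (p u1 c v1) (p u2 c v2) (p u3 c v3) = p (p u1 u2 u3) c (p v1 v2 v3)"
      using u v sb by (intro main[of d c]) auto
  qed
  then show ?thesis using medial_transfer[OF mp BA[OF ab(1)] BA[OF ab(2)] ab(3)] mp by blast
qed

text \<open>Let \<open>f\<close> commute at as many pairs as possible. At a pair that is left,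
  applying on top of \<open>f\<close> an operation that commutes at \<open>(f a b, f b a)\<close>
  gains this pair and loses none.\<close>

lemma commuting_pairs:
  assumes all: "\<And>a b. a \<in> A \<Longrightarrow> b \<in> A \<Longrightarrow> \<exists>g. bin g \<and> g a b = g b a"
  shows "\<exists>f. bin f \<and> (\<forall>x\<in>A. \<forall>y\<in>A. f x y = f y x)"
proof -
  define K where "K f = {(x, y) \<in> A \<times> A. f x y = f y x}" for f :: "'a \<Rightarrow> 'a \<Rightarrow> 'a"
  have fin: "finite (A \<times> A)" using finite_A by simp
  have sub: "K f \<subseteq> A \<times> A" for f by (auto simp: K_def)
  have "card (K f) < Suc (card (A \<times> A))" for f
    using card_mono[OF fin sub[of f]] by simp
  then have "\<exists>f. bin f \<and> (\<forall>g. bin g \<longrightarrow> card (K g) \<le> card (K f))"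
    using ex_has_greatest_nat[of bin "\<lambda>x y. x" "\<lambda>f. card (K f)" "Suc (card (A \<times> A))"] bin_fst by auto
  then obtain f where f: "bin f" and max: "\<And>g. bin g \<Longrightarrow> card (K g) \<le> card (K f)" by blast
  have "f a b = f b a" if ab: "a \<in> A" "b \<in> A" for a b
  proof (rule ccontr)
    assume ne: "f a b \<noteq> f b a"
    obtain g where g: "bin g" "g (f a b) (f b a) = g (f b a) (f a b)"
      using all bin_closed[OF f] ab by blast
    define h where "h x y = g (f x y) (f y x)" for x y
    have h: "bin h" unfolding h_def by (rule bin_comp[OF g(1) f bin_swap[OF f]])
    have "(a, b) \<in> K h" "(a, b) \<notin> K f" using g ne ab by (auto simp: K_def h_def)
    moreover have "K f \<subseteq> K h" by (auto simp: K_def h_def)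
    ultimately have "K f \<subset> K h" by blast
    then have "card (K f) < card (K h)"
      using psubset_card_mono finite_subset[OF sub fin] by blast
    then show False using max[OF h] by simp
  qed
  then show ?thesis using f by blast
qed

text \<open>
  A non-commuting pair with \<open>Rel x y\<close> minimal can be recovered from its image under \<open>f\<close>; the
  composed operation is then the first projection on \<open>{x, y}\<close>, hence everywhere.
\<close>

lemma inverse_pair:
  assumes no: "a0 \<in> A" "b0 \<in> A" "\<And>g. bin g \<Longrightarrow> g a0 b0 \<noteq> g b0 a0" and f: "bin f"
  shows "\<exists>p. bin p \<and> (\<forall>x\<in>A. \<forall>y\<in>A. p (f x y) (f y x) = x)"
proof -
  define bad where "bad z \<longleftrightarrow> fst z \<in> A \<and> snd z \<in> A \<and> (\<forall>g. bin g \<longrightarrow> g (fst z) (snd z) \<noteq> g (snd z) (fst z))" for z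
  have "bad (a0, b0)" using no by (simp add: bad_def)
  from ex_has_least_nat[of bad, OF this, of "\<lambda>z. card (Rel (fst z) (snd z))"]
  obtain z where z: "bad z" "\<And>w. bad w \<Longrightarrow> card (Rel (fst z) (snd z)) \<le> card (Rel (fst w) (snd w))" by blast
  obtain x y where xy: "z = (x, y)" by (cases z)
  have A: "x \<in> A" "y \<in> A" and nc: "\<And>g. bin g \<Longrightarrow> g x y \<noteq> g y x" using z xy by (auto simp: bad_def)
  let ?u = "f x y" and ?v = "f y x"
  have uv: "(?u, ?v) \<in> Rel x y" by (rule Rel_intro[OF f])
  have "bad (?u, ?v)"
  proof -
    have "g ?u ?v \<noteq> g ?v ?u" if "bin g" for g
      using nc[OF bin_comp[OF that f bin_swap[OF f]]] .
    then show ?thesis using A bin_closed[OF f] by (simp add: bad_def)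
  qed
  then have le: "card (Rel x y) \<le> card (Rel ?u ?v)" using z(2) xy by fastforce
  have "Rel x y \<subseteq> A \<times> A" using Rel_sub[OF sub_A A] by auto
  then have "finite (Rel x y)" using finite_A by (meson finite_SigmaI finite_subset)
  then have "Rel ?u ?v = Rel x y" using card_seteq[OF _ Rel_mono[OF uv] le] by blast
  then have "(x, y) \<in> Rel ?u ?v" using Rel_gen by simp
  then obtain p where p: "bin p" "x = p ?u ?v" "y = p ?v ?u" unfolding Rel_def by auto
  have "bin (\<lambda>x y. p (f x y) (f y x))" by (rule bin_comp[OF p(1) f bin_swap[OF f]])
  moreover have "x \<noteq> y" using nc[OF bin_fst] .
  ultimately have "\<forall>x\<in>A. \<forall>y\<in>A. p (f x y) (f y x) = x"
    using pair_fst[of "\<lambda>x y. p (f x y) (f y x)" x y] A p(2,3) by auto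
  then show ?thesis using p(1) by blast
qed

text \<open>By \<open>inverse_pair\<close> the values \<open>g a b\<close> and \<open>g b a\<close>
  determine \<open>a\<close> and \<open>b\<close>, so \<open>Rel a b\<close> avoids the diagonal for
  \<open>a \<noteq> b\<close>. Two values over \<open>c\<close> would make the row of
  \<open>c\<close> all of \<open>B\<close> and put \<open>(c, c)\<close> into
  \<open>Rel a b\<close>.\<close>

lemma no_commutative_rigid:
  assumes no: "\<not> (\<exists>f. bin f \<and> (\<forall>x\<in>A. \<forall>y\<in>A. f x y = f y x))" and f: "proper f" and B: "minsub B"
  shows "rigid B"
proof -
  note bf = proper_bin[OF f]
  have sB: "sub B" using B by (simp add: minsub_def)
  obtain a0 b0 where 0: "a0 \<in> A" "b0 \<in> A" "\<And>g. bin g \<Longrightarrow> g a0 b0 \<noteq> g b0 a0"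
    using no commuting_pairs by blast
  have irr: "g a b \<noteq> g b a" if g: "bin g" and ab: "a \<in> A" "b \<in> A" "a \<noteq> b" for a b g
  proof
    assume eq: "g a b = g b a"
    obtain p where "\<forall>x\<in>A. \<forall>y\<in>A. p (g x y) (g y x) = x" using inverse_pair[OF 0 g] by blast
    then have "p (g a b) (g b a) = a" "p (g b a) (g a b) = b" using ab by auto
    then show False using eq ab by simp
  qed
  show ?thesis
  proof (rule rigid_if_functional[OF sB], rule ccontr)
    fix a b c d d'
    assume ab: "a \<in> B" "b \<in> B" "a \<noteq> b" and R: "(c, d) \<in> Rel a b" "(c, d') \<in> Rel a b" and ne: "d \<noteq> d'"
    have cB: "c \<in> B" "d \<in> B" "d' \<in> B" using Rel_sub[OF sB ab(1,2)] R by blast+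
    have "{x \<in> B. (c, x) \<in> Rel a b} = B"
    proof (rule minsub_eq[OF B f _ _ _ ne])
      fix x y assume "x \<in> {x \<in> B. (c, x) \<in> Rel a b}" "y \<in> {x \<in> B. (c, x) \<in> Rel a b}"
      then show "f x y \<in> {x \<in> B. (c, x) \<in> Rel a b}"
        using Rel_bin[OF bf, of c x a b c y] bin_idem[OF bf, of c] sub_subset[OF sB cB(1)] sub_bin[OF sB bf]
        by auto
    qed (use R cB in auto)
    then have "(c, c) \<in> Rel a b" using cB by blast
    then obtain g where "bin g" "g a b = c" "g b a = c" unfolding Rel_def by auto
    then show False using irr ab sub_subset[OF sB] by metis
  qed
qed

lemma commutative_proper:
  assumes "bin f" "\<And>x y. x \<in> A \<Longrightarrow> y \<in> A \<Longrightarrow> f x y = f y x"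
  shows "proper f"
proof -
  obtain a b where "a \<in> A" "b \<in> A" "a \<noteq> b" using nontrivial_A by blast
  then show ?thesis using assms unfolding proper_def by metis
qed

lemma proper_if_equal:
  assumes "bin g" "a \<in> A" "b \<in> A" "a \<noteq> b" "g a b = g b a"
  shows "proper g"
  using assms unfolding proper_def by metis

text \<open>If \<open>Rel a b\<close> is not a graph at \<open>c\<close>, the row of
  \<open>c\<close> is full. The elements with full rows form a subset closed under \<open>f\<close>
  other than \<open>B\<close>, so \<open>c\<close> is the only one, and by symmetry every other row
  is \<open>{c}\<close>. For \<open>x \<noteq> c\<close> the commutative \<open>f\<close> gives the
  diagonal pair at \<open>f x c\<close>, which forces \<open>f x c = c\<close>; then
  \<open>{x, c}\<close> would be \<open>B\<close>.\<close>

lemma commutative_rigid: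
  assumes f: "bin f" "\<And>x y. x \<in> A \<Longrightarrow> y \<in> A \<Longrightarrow> f x y = f y x" and B: "minsub B"
    and big: "\<And>x y. B \<noteq> {x, y}"
  shows "rigid B"
proof -
  have pf: "proper f" using f by (rule commutative_proper)
  have sB: "sub B" using B by (simp add: minsub_def)
  have BA: "x \<in> A" if "x \<in> B" for x using that sB sub_subset by blast
  show ?thesis
  proof (rule rigid_if_functional[OF sB], rule ccontr)
    fix a b c d d'
    assume ab: "a \<in> B" "b \<in> B" "a \<noteq> b" and R: "(c, d) \<in> Rel a b" "(c, d') \<in> Rel a b" and ne: "d \<noteq> d'"
    have cB: "c \<in> B" "d \<in> B" "d' \<in> B" using Rel_sub[OF sB ab(1,2)] R by blast+
    have row: "{x \<in> B. (u, x) \<in> Rel a b} = B"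
      if "(u, v) \<in> Rel a b" "(u, v') \<in> Rel a b" "v \<noteq> v'" for u v v'
    proof (rule minsub_eq[OF B pf _ _ _ that(3)])
      have uB: "u \<in> B" "v \<in> B" "v' \<in> B" using Rel_sub[OF sB ab(1,2)] that by blast+
      show "v \<in> {x \<in> B. (u, x) \<in> Rel a b}" "v' \<in> {x \<in> B. (u, x) \<in> Rel a b}" using that uB by auto
      fix x y assume "x \<in> {x \<in> B. (u, x) \<in> Rel a b}" "y \<in> {x \<in> B. (u, x) \<in> Rel a b}"
      then show "f x y \<in> {x \<in> B. (u, x) \<in> Rel a b}"
        using Rel_bin[OF f(1), of u x a b u y] bin_idem[OF f(1), of u] BA[OF uB(1)] sub_bin[OF sB f(1)]
        by auto
    qed auto
    have full_c: "(c, x) \<in> Rel a b" if "x \<in> B" for x using row[OF R ne] that by blast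
    have ab_notin: "\<not> (\<forall>x\<in>B. \<forall>y\<in>B. (x, y) \<in> Rel a b)"
    proof
      assume "\<forall>x\<in>B. \<forall>y\<in>B. (x, y) \<in> Rel a b"
      then have "(a, a) \<in> Rel a b" using ab by blast
      then obtain g where g: "bin g" "g a b = a" "g b a = a" unfolding Rel_def by auto
      then have pg: "proper g" using proper_if_equal[OF g(1), of a b] BA ab by auto
      have "{a, b} = B"
        using g ab bin_idem[OF g(1)] BA by (intro minsub_eq[OF B pg _ _ _ ab(3)]) auto
      then show False using big by blast
    qed
    have Z: "u = c" if u: "u \<in> B" "\<And>x. x \<in> B \<Longrightarrow> (u, x) \<in> Rel a b" for u
    proof (rule ccontr)
      assume "u \<noteq> c"
      then have "{u \<in> B. \<forall>x\<in>B. (u, x) \<in> Rel a b} = B"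
      proof (rule minsub_eq[OF B pf, rotated 3])
        show "u \<in> {u \<in> B. \<forall>x\<in>B. (u, x) \<in> Rel a b}" "c \<in> {u \<in> B. \<forall>x\<in>B. (u, x) \<in> Rel a b}"
          using u full_c cB by auto
        fix v w assume "v \<in> {u \<in> B. \<forall>x\<in>B. (u, x) \<in> Rel a b}" "w \<in> {u \<in> B. \<forall>x\<in>B. (u, x) \<in> Rel a b}"
        then have vw: "v \<in> B" "w \<in> B" "\<And>x. x \<in> B \<Longrightarrow> (v, x) \<in> Rel a b" "\<And>x. x \<in> B \<Longrightarrow> (w, x) \<in> Rel a b"
          by auto
        have "(f v w, x) \<in> Rel a b" if x: "x \<in> B" for x
          using Rel_bin[OF f(1) vw(3,4)[OF x]] bin_idem[OF f(1) BA[OF x]] by simp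
        then show "f v w \<in> {u \<in> B. \<forall>x\<in>B. (u, x) \<in> Rel a b}"
          using sub_bin[OF sB f(1) vw(1,2)] by blast
      qed auto
      then show False using ab_notin by blast
    qed
    have row_c: "v = c" if u: "u \<in> B" "u \<noteq> c" "(u, v) \<in> Rel a b" for u v
    proof (rule ccontr)
      assume "v \<noteq> c"
      then have "{x \<in> B. (u, x) \<in> Rel a b} = B" using row[OF u(3) Rel_sym[OF full_c[OF u(1)]]] by blast
      then show False using Z[OF u(1)] u(2) by blast
    qed
    obtain x where x: "x \<in> B" "x \<noteq> c" using ab by blast
    have "(f x c, f c x) \<in> Rel a b" using Rel_bin[OF f(1) Rel_sym[OF full_c[OF x(1)]] full_c[OF x(1)]] .
    then have "(f x c, f x c) \<in> Rel a b" using f(2)[of x c] BA x cB by simp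
    then have fc: "f x c = c" using row_c[of "f x c" "f x c"] sub_bin[OF sB f(1) x(1) cB(1)] by blast
    then have "f c x = c" using f(2)[of x c] BA x cB by simp
    then have "{x, c} = B"
      using fc x cB bin_idem[OF f(1)] BA by (intro minsub_eq[OF B pf _ _ _ x(2)]) auto
    then show False using big by blast
  qed
qed

lemma binary_case:
  assumes "proper f0"
  shows "(\<exists>p. malcev p \<and> medial_on A p) \<or>
    (\<exists>f u v. bin f \<and> (\<forall>x\<in>A. \<forall>y\<in>A. f x y = f y x) \<and> u \<in> A \<and> v \<in> A \<and> u \<noteq> v \<and> f u v = v)"
proof -
  obtain B where B: "minsub B" using exists_minsub by blast
  have sB: "sub B" using B by (simp add: minsub_def)
  show ?thesis
  proof (cases "rigid B")
    case True
    then show ?thesis using rigid_medial[OF B _ assms] by blast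
  next
    case False
    then obtain f where f: "bin f" "\<forall>x\<in>A. \<forall>y\<in>A. f x y = f y x"
      using no_commutative_rigid[OF _ assms B] by blast
    obtain x y where xy: "B = {x, y}" using commutative_rigid[OF f(1) _ B] f(2) False by blast
    have A: "x \<in> A" "y \<in> A" using sub_subset[OF sB] xy by auto
    have "x \<noteq> y" using B xy by (auto simp: minsub_def two_def)
    moreover have "f x y \<in> {x, y}" using sub_bin[OF sB f(1), of x y] xy by simp
    moreover have "f x y = f y x" using f(2) A by blast
    ultimately have "f x y = y \<or> f y x = x" "x \<noteq> y" "y \<noteq> x" by auto
    then show ?thesis using f A by blast
  qed
qed

end

subsection \<open>Commutative groupoids that are strongly connected by semilattice edges\<close>

text \<open>An edge from \<open>x\<close> to \<open>y\<close> means \<open>f x y = y\<close>. Strong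
  connectivity is stated without paths, as the absence of nonempty proper subsets closed under
  outgoing edges, so that it can be applied directly as an induction.\<close>

locale strongly_connected =
  fixes M :: "'a set" and f :: "'a \<Rightarrow> 'a \<Rightarrow> 'a"
  assumes finite_M: "finite M"
    and closed: "x \<in> M \<Longrightarrow> y \<in> M \<Longrightarrow> f x y \<in> M"
    and comm: "x \<in> M \<Longrightarrow> y \<in> M \<Longrightarrow> f x y = f y x"
    and idem: "x \<in> M \<Longrightarrow> f x x = x"
    and connected: "J \<subseteq> M \<Longrightarrow> J \<noteq> {} \<Longrightarrow> (\<And>x y. x \<in> J \<Longrightarrow> y \<in> M \<Longrightarrow> f x y = y \<Longrightarrow> y \<in> J) \<Longrightarrow> J = M"
begin

definition compatible :: "('a \<times> 'a) set \<Rightarrow> bool" where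
  "compatible Q \<longleftrightarrow> Q \<subseteq> M \<times> M \<and> (\<forall>x y x' y'. (x, y) \<in> Q \<longrightarrow> (x', y') \<in> Q \<longrightarrow> (f x x', f y y') \<in> Q)"

lemma compatibleD: "compatible Q \<Longrightarrow> (x, y) \<in> Q \<Longrightarrow> (x', y') \<in> Q \<Longrightarrow> (f x x', f y y') \<in> Q"
  unfolding compatible_def by blast

lemma compatible_carrier: "compatible Q \<Longrightarrow> (x, y) \<in> Q \<Longrightarrow> x \<in> M \<and> y \<in> M"
  unfolding compatible_def by blast

lemma compatible_relcomp:
  assumes "compatible Q" "compatible R"
  shows "compatible (Q O R)"
  unfolding compatible_def
proof (intro conjI allI impI)
  show "Q O R \<subseteq> M \<times> M" using assms compatible_carrier by blast
  fix x y x' y' assume "(x, y) \<in> Q O R" "(x', y') \<in> Q O R"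
  then obtain z z' where "(x, z) \<in> Q" "(z, y) \<in> R" "(x', z') \<in> Q" "(z', y') \<in> R" by blast
  then show "(f x x', f y y') \<in> Q O R" using compatibleD[OF assms(1)] compatibleD[OF assms(2)] by blast
qed

text \<open>
  For \<open>x \<rightarrow> x'\<close> an edge, the row of \<open>x'\<close> is closed under the edges starting in it if the row of \<open>x\<close>
  is full, so fullness propagates along edges.
\<close>

lemma full_row:
  assumes Q: "compatible Q" and total: "\<And>x. x \<in> M \<Longrightarrow> \<exists>y. (x, y) \<in> Q"
    and x0: "x0 \<in> M" "\<And>y. y \<in> M \<Longrightarrow> (x0, y) \<in> Q"
  shows "Q = M \<times> M"
proof -
  have "{x \<in> M. \<forall>y\<in>M. (x, y) \<in> Q} = M"
  proof (rule connected)
    fix x x' assume x: "x \<in> {x \<in> M. \<forall>y\<in>M. (x, y) \<in> Q}" and x': "x' \<in> M" "f x x' = x'"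
    have "{y \<in> M. (x', y) \<in> Q} = M"
    proof (rule connected)
      show "{y \<in> M. (x', y) \<in> Q} \<noteq> {}" using total[OF x'(1)] compatible_carrier[OF Q] by blast
      fix y y' assume y: "y \<in> {y \<in> M. (x', y) \<in> Q}" and y': "y' \<in> M" "f y y' = y'"
      have "(f x x', f y' y) \<in> Q" using compatibleD[OF Q, of x y' x' y] x y y' by blast
      then show "y' \<in> {y \<in> M. (x', y) \<in> Q}" using x' y y' comm[of y y'] by simp
    qed auto
    then show "x' \<in> {x \<in> M. \<forall>y\<in>M. (x, y) \<in> Q}" using x'(1) by blast
  qed (use x0 in auto)
  then show ?thesis using Q unfolding compatible_def by blast
qed

text \<open>The two free elements beside \<open>S\<close> turn the induction step into a statement
  about the binary relation \<open>W\<close>. It is compatible because idempotence keeps the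
  elements of \<open>insert x0 S\<close> in place, its row at \<open>x0\<close> is full by the
  induction hypothesis, and \<open>full_row\<close> applies.\<close>

lemma common_neighbour:
  assumes Q: "compatible Q" and two: "\<And>x y. x \<in> M \<Longrightarrow> y \<in> M \<Longrightarrow> \<exists>u. (x, u) \<in> Q \<and> (y, u) \<in> Q"
    and S: "finite S" "S \<subseteq> M" and yz: "y \<in> M" "z \<in> M"
  shows "\<exists>u\<in>M. \<forall>x\<in>S \<union> {y, z}. (x, u) \<in> Q"
  using S yz
proof (induction S arbitrary: y z)
  case empty
  then show ?case using two[of y z] compatible_carrier[OF Q] by blast
next
  case (insert x0 S)
  define W where "W = {(y, z) \<in> M \<times> M. \<exists>u\<in>M. \<forall>x\<in>insert x0 S \<union> {y, z}. (x, u) \<in> Q}"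
  have "W = M \<times> M"
  proof (rule full_row)
    show "compatible W"
      unfolding compatible_def
    proof (intro conjI allI impI)
      show "W \<subseteq> M \<times> M" by (auto simp: W_def)
      fix y z y' z' assume W: "(y, z) \<in> W" "(y', z') \<in> W"
      then obtain u u' where u: "u \<in> M" "\<forall>x\<in>insert x0 S \<union> {y, z}. (x, u) \<in> Q"
        and u': "u' \<in> M" "\<forall>x\<in>insert x0 S \<union> {y', z'}. (x, u') \<in> Q" by (auto simp: W_def)
      have "(x, f u u') \<in> Q" if "x \<in> insert x0 S" for x
        using compatibleD[OF Q, of x u x u'] u u' that idem[of x] insert.prems by auto
      moreover have "(f y y', f u u') \<in> Q" "(f z z', f u u') \<in> Q"
        using compatibleD[OF Q] u u' by blast+
      ultimately show "(f y y', f z z') \<in> W" using W u(1) u'(1) closed by (auto simp: W_def)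
    qed
    have row: "\<exists>u\<in>M. \<forall>x\<in>insert x0 S \<union> {x0, z}. (x, u) \<in> Q" if "z \<in> M" for z
      using insert.IH[of x0 z] insert.prems that by auto
    then show "(x0, z) \<in> W" if "z \<in> M" for z using that insert.prems unfolding W_def by auto
    show "x0 \<in> M" using insert.prems by simp
    show "\<exists>z. (y, z) \<in> W" if "y \<in> M" for y
      using row[OF that] that insert.prems unfolding W_def by auto
  qed
  then have "(y, z) \<in> W" using insert.prems by blast
  then show ?case by (auto simp: W_def)
qed

text \<open>Any two elements have a common neighbour, hence so do all elements of \<open>M\<close>
  together; the row of that neighbour is full.\<close>

lemma full_if_square_full:
  assumes Q: "compatible Q" "sym Q" and two: "Q O Q = M \<times> M"
  shows "Q = M \<times> M"
proof (cases "M = {}")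
  case True
  then show ?thesis using compatible_carrier[OF Q(1)] by fast
next
  case False
  then obtain y where y: "y \<in> M" by blast
  have "\<exists>u. (x, u) \<in> Q \<and> (y, u) \<in> Q" if "x \<in> M" "y \<in> M" for x y
  proof -
    have "(x, y) \<in> Q O Q" using two that by simp
    then show ?thesis using symD[OF Q(2)] by blast
  qed
  note nb = this
  obtain u where u: "u \<in> M" "\<forall>x\<in>M. (x, u) \<in> Q"
    using common_neighbour[OF Q(1) nb finite_M subset_refl y y] by blast
  show ?thesis
  proof (rule full_row[OF Q(1)])
    show "\<exists>y. (x, y) \<in> Q" if "x \<in> M" for x using u that by blast
    show "u \<in> M" by fact
    show "(u, x) \<in> Q" if "x \<in> M" for x using symD[OF Q(2)] u that by blast
  qed
qed

text \<open>\<open>N O N\<close> is reflexive because \<open>N\<close> is total and symmetric. Take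
  a largest proper compatible, reflexive and symmetric \<open>Q\<close> above it:
  \<open>Q O Q\<close> is again proper by \<open>full_if_square_full\<close>, so it equals
  \<open>Q\<close>, which is therefore transitive.\<close>

lemma full_or_congruence:
  assumes N: "compatible N" "sym N" and total: "\<And>x. x \<in> M \<Longrightarrow> \<exists>y. (x, y) \<in> N"
    and nf: "N \<noteq> M \<times> M"
  shows "\<exists>\<theta>. compatible \<theta> \<and> equiv M \<theta> \<and> \<theta> \<noteq> M \<times> M \<and> N O N \<subseteq> \<theta>"
proof -
  define \<F> where "\<F> Q \<longleftrightarrow> compatible Q \<and> sym Q \<and> Id_on M \<subseteq> Q \<and> Q \<noteq> M \<times> M \<and> N O N \<subseteq> Q" for Q
  have symO: "sym (Q O Q)" if "sym Q" for Q :: "('a \<times> 'a) set"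
    using that unfolding sym_def by blast
  have "\<F> (N O N)"
    unfolding \<F>_def
  proof (intro conjI)
    show "Id_on M \<subseteq> N O N"
    proof
      fix p assume "p \<in> Id_on M"
      then obtain x where x: "x \<in> M" "p = (x, x)" by blast
      obtain y where "(x, y) \<in> N" using total[OF x(1)] by blast
      then show "p \<in> N O N" using symD[OF N(2)] x(2) by blast
    qed
  qed (use N nf compatible_relcomp full_if_square_full symO in blast)+
  moreover have fin: "finite (M \<times> M)" using finite_M by simp
  have "card Q < Suc (card (M \<times> M))" if "\<F> Q" for Q
    using card_mono[OF fin, of Q] that unfolding \<F>_def compatible_def by auto
  ultimately obtain Q where Q: "\<F> Q" and max: "\<And>R. \<F> R \<Longrightarrow> card R \<le> card Q"
    using ex_has_greatest_nat[of \<F> "N O N" card "Suc (card (M \<times> M))"] by blast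
  have cQ: "compatible Q" and sQ: "sym Q" and rQ: "Id_on M \<subseteq> Q" and nQ: "Q \<noteq> M \<times> M" and NQ: "N O N \<subseteq> Q"
    using Q by (auto simp: \<F>_def)
  have QM: "Q \<subseteq> M \<times> M" using cQ by (simp add: compatible_def)
  have le: "Q \<subseteq> Q O Q" using rQ QM by (auto simp: Id_on_def)
  have "\<F> (Q O Q)"
    unfolding \<F>_def
    using compatible_relcomp[OF cQ cQ] symO[OF sQ] rQ le nQ NQ full_if_square_full[OF cQ sQ] by blast
  then have "card (Q O Q) \<le> card Q" by (rule max)
  moreover have "finite (Q O Q)"
    using compatible_relcomp[OF cQ cQ] finite_subset[OF _ fin] by (simp add: compatible_def)
  ultimately have "Q = Q O Q" using card_seteq[OF _ le] by blast
  then have "trans Q" unfolding trans_def by blast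
  then have "equiv M Q" using sQ rQ QM unfolding equiv_def refl_on_def by auto
  then show ?thesis using cQ nQ NQ by blast
qed

end

section \<open>Congruences, absorption and two-generated subalgebras\<close>

context minimal_taylor_clone begin

lemma bin_cong_induct:
  assumes g: "proper g" and X: "sub X" and eq: "equiv X \<theta>"
    and comp: "\<And>x y x' y'. (x, x') \<in> \<theta> \<Longrightarrow> (y, y') \<in> \<theta> \<Longrightarrow> (g x y, g x' y') \<in> \<theta>"
    and h: "bin h" and xy: "(x, x') \<in> \<theta>" "(y, y') \<in> \<theta>"
  shows "(h x y, h x' y') \<in> \<theta>"
proof -
  have \<theta>X: "u \<in> X \<and> v \<in> X" if "(u, v) \<in> \<theta>" for u v
    using eq that unfolding equiv_def refl_on_def by blast
  have XA: "u \<in> A" if "u \<in> X" for u using sub_subset[OF X that] .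
  define Q where "Q n f \<longleftrightarrow> (\<forall>xs\<in>nlists n A. \<forall>ys\<in>nlists n A. (\<forall>i<n. (xs ! i, ys ! i) \<in> \<theta>) \<longrightarrow> (f xs, f ys) \<in> \<theta>)"
    for n and f :: "'a list \<Rightarrow> 'a"
  have Qh: "Q 2 (\<lambda>xs\<in>nlists 2 A. h (xs ! 0) (xs ! 1))"
  proof (rule min_induct[OF bin_C[OF proper_bin[OF g]] proper_not_projection[OF g] _ _ _ bin_C[OF h]])
    show "Q 2 (\<lambda>xs\<in>nlists 2 A. g (xs ! 0) (xs ! 1))"
      unfolding Q_def using comp by simp
    show "Q n (\<lambda>xs\<in>nlists n A. xs ! i)" if "i < n" for n i
      unfolding Q_def using that by simp
    fix k n f gs
    assume f: "Q k f" and gs: "gs \<in> nlists k (C n)" "\<And>g. g \<in> set gs \<Longrightarrow> Q n g"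
    have "(f (map (\<lambda>g. g xs) gs), f (map (\<lambda>g. g ys) gs)) \<in> \<theta>"
      if xs: "xs \<in> nlists n A" "ys \<in> nlists n A" "\<forall>i<n. (xs ! i, ys ! i) \<in> \<theta>" for xs ys
    proof -
      have len: "length gs = k" using gs(1) by simp
      have "((gs ! i) xs, (gs ! i) ys) \<in> \<theta>" if i: "i < k" for i
      proof -
        have "Q n (gs ! i)" using gs(2) len i by simp
        then show ?thesis using xs unfolding Q_def by blast
      qed
      then have "\<forall>i<k. (map (\<lambda>g. g xs) gs ! i, map (\<lambda>g. g ys) gs ! i) \<in> \<theta>" using len by simp
      then show ?thesis
        using f[unfolded Q_def, rule_format, OF map_closed[OF gs(1) xs(1)] map_closed[OF gs(1) xs(2)]] by blast
    qed
    then show "Q n (\<lambda>xs\<in>nlists n A. f (map (\<lambda>g. g xs) gs))" unfolding Q_def by simp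
  qed
  have nl: "[x, y] \<in> nlists 2 A" "[x', y'] \<in> nlists 2 A"
    using \<theta>X[OF xy(1)] \<theta>X[OF xy(2)] XA by (auto simp: nlists_2)
  have "\<forall>i<2. ([x, y] ! i, [x', y'] ! i) \<in> \<theta>"
    using xy by (auto simp: less_2_cases_iff)
  from Qh[unfolded Q_def, rule_format, OF nl this[rule_format]] show ?thesis using nl by simp
qed

text \<open>On \<open>{x, w}\<close> the value of \<open>g\<close> is \<open>w\<close> whenever its
  first argument is. The implication \<open>p = w \<longrightarrow> q = w\<close> is a preorder, so
  \<open>h\<close> behaves in this way for one of its arguments.\<close>

lemma absorbing_induct:
  assumes g: "proper g" and x: "x \<in> A" "w \<in> A" and eq: "g x w = w" "g w x = w" and h: "bin h"
  shows "h x w = w \<or> h w x = w"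
proof -
  have "(\<forall>p\<in>{x, w}. \<forall>q\<in>{x, w}. p = w \<longrightarrow> h p q = w) \<or> (\<forall>p\<in>{x, w}. \<forall>q\<in>{x, w}. q = w \<longrightarrow> h p q = w)"
  proof (rule bin_coord_induct[OF g, where \<rho> = "\<lambda>p q. p = w \<longrightarrow> q = w"])
    fix p q assume pq: "p \<in> {x, w}" "q \<in> {x, w}"
    have "g x x = x" "g w w = w" using bin_idem[OF proper_bin[OF g]] x by auto
    then show "g p q \<in> {x, w} \<and> (p = w \<longrightarrow> g p q = w)" using pq eq by auto
  qed (use x h in auto)
  then show ?thesis by blast
qed

definition gen :: "'a \<Rightarrow> 'a \<Rightarrow> 'a set" where
  "gen a b = {h a b |h. bin h}"

lemma gen_intro: "bin h \<Longrightarrow> h a b \<in> gen a b"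
  unfolding gen_def by blast

lemma gen_swap: "gen a b = gen b a"
  unfolding gen_def using bin_swap by fastforce

lemma gen_generators: "a \<in> gen a b" "b \<in> gen a b"
  using gen_intro[OF bin_fst] gen_intro[OF bin_snd] by blast+

lemma gen_minimal:
  assumes "sub X" "a \<in> X" "b \<in> X"
  shows "gen a b \<subseteq> X"
  using assms sub_bin unfolding gen_def by blast

lemma gen_bin:
  assumes g: "bin g" and "x \<in> gen a b" "y \<in> gen a b"
  shows "g x y \<in> gen a b"
proof -
  obtain h k where "bin h" "x = h a b" "bin k" "y = k a b" using assms unfolding gen_def by blast
  then show ?thesis using gen_intro[OF bin_comp[OF g, of h k]] by simp
qed

lemma gen_subset: "a \<in> A \<Longrightarrow> b \<in> A \<Longrightarrow> gen a b \<subseteq> A"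
  by (rule gen_minimal[OF sub_A])

end

subsection \<open>Two-generated subalgebras in the presence of a semilattice edge\<close>

text \<open>The semilattice \<open>{u, v}\<close> is preserved by every binary operation; values at
  \<open>u, v\<close> serve to show that constructed operations are not projections.\<close>

locale semilattice_edge = minimal_taylor_clone A C for A :: "'a set" and C +
  fixes f :: "'a \<Rightarrow> 'a \<Rightarrow> 'a" and u v :: 'a
  assumes bin_f: "bin f" and comm_f: "\<And>x y. x \<in> A \<Longrightarrow> y \<in> A \<Longrightarrow> f x y = f y x"
    and uA: "u \<in> A" and vA: "v \<in> A" and uv: "u \<noteq> v" and fuv: "f u v = v"
begin

lemma proper_f: "proper f"
  using bin_f comm_f by (rule commutative_proper)

lemma f_idem: "x \<in> A \<Longrightarrow> f x x = x"
  by (rule bin_idem[OF bin_f])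

lemma fvu: "f v u = v"
  using comm_f[OF uA vA] fuv by simp

lemma sub_gen: "a \<in> A \<Longrightarrow> b \<in> A \<Longrightarrow> sub (gen a b)"
  by (intro sub_proper[OF proper_f gen_subset] gen_bin[OF bin_f])

lemma sub_edge: "sub {u, v}"
  using uA vA fuv fvu f_idem by (intro sub_proper[OF proper_f]) auto

lemma edge_closed: "bin g \<Longrightarrow> x \<in> {u, v} \<Longrightarrow> y \<in> {u, v} \<Longrightarrow> g x y \<in> {u, v}"
  by (rule sub_bin[OF sub_edge])

text \<open>Whatever operation exhibits \<open>{x, w}\<close> as a semilattice,
  \<open>absorbing_induct\<close> passes this on to \<open>f\<close>, where commutativity merges the
  two cases. Hence edges can be defined by \<open>f\<close> alone.\<close>

lemma absorb:
  assumes g: "bin g" and x: "x \<in> A" "w \<in> A" and eq: "g x w = w" "g w x = w"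
  shows "f x w = w"
proof (cases "x = w")
  case False
  have "proper g" using proper_if_equal[OF g x False] eq by simp
  then have "f x w = w \<or> f w x = w"
    by (rule absorbing_induct[OF _ x eq bin_f])
  then show ?thesis using comm_f x by auto
qed (use f_idem x in simp)

text \<open>
  With \<open>t(x, t(x, y)) = t(x, y)\<close>, the operation \<open>g(x, y) = t(x, t(y, x))\<close> satisfies \<open>g(w, x) = w\<close>
  whenever \<open>t(x, w) = w\<close>; iterating \<open>g\<close> in its second argument gives \<open>s\<close>.
\<close>

lemma partial_semilattice:
  obtains s where "proper s" "\<And>x y. x \<in> A \<Longrightarrow> y \<in> A \<Longrightarrow> f x (s x y) = s x y"
proof -
  obtain N where N: "N > 0" "\<And>x y. x \<in> A \<Longrightarrow> y \<in> A \<Longrightarrow> (f x ^^ N) ((f x ^^ N) y) = (f x ^^ N) y"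
    by (rule obtain_idempotent_power[of A f, OF finite_A bin_closed[OF bin_f]]) auto
  define t where "t x y = (f x ^^ N) y" for x y
  have t: "bin t" unfolding t_def by (rule bin_funpow[OF bin_f])
  have tt: "t x (t x y) = t x y" if "x \<in> A" "y \<in> A" for x y using N(2) that by (simp add: t_def)
  have "(f u ^^ k) v = v" for k by (induction k) (auto simp: fuv)
  then have tuv: "t u v = v" by (simp add: t_def)
  have "(f v ^^ Suc k) u = v" for k by (induction k) (auto simp: fvu f_idem vA)
  then have tvu: "t v u = v" using N(1) by (metis t_def gr0_implies_Suc)
  define g where "g x y = t x (t y x)" for x y
  have g: "bin g" unfolding g_def by (rule bin_comp[OF t bin_fst bin_swap[OF t]])
  obtain K where K: "K > 0" "\<And>x y. x \<in> A \<Longrightarrow> y \<in> A \<Longrightarrow> (g x ^^ K) ((g x ^^ K) y) = (g x ^^ K) y"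
    by (rule obtain_idempotent_power[of A g, OF finite_A bin_closed[OF g]]) auto
  define s where "s x y = (g x ^^ K) y" for x y
  have s: "bin s" unfolding s_def by (rule bin_funpow[OF g])
  obtain k where k: "K = Suc k" using K(1) by (cases K) auto
  have 1: "s x (s x y) = s x y" if "x \<in> A" "y \<in> A" for x y using K(2) that by (simp add: s_def)
  have 2: "s (s x y) x = s x y" if xy: "x \<in> A" "y \<in> A" for x y
  proof -
    let ?z = "s x y"
    have z: "?z \<in> A" using bin_closed[OF s xy] .
    have w: "(g x ^^ k) y \<in> A" using bin_closed[OF bin_funpow[OF g] xy] .
    have "?z = g x ((g x ^^ k) y)" by (simp add: s_def k)
    \<comment> \<open>\<open>?z\<close> is a value of \<open>t x\<close>, because \<open>g x\<close>
      applies \<open>t x\<close> last.\<close>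
    then have "t x ?z = ?z" using tt xy w bin_closed[OF t] by (simp add: g_def)
    then have gz: "g ?z x = ?z" using bin_idem[OF t z] by (simp add: g_def)
    have "(g ?z ^^ Suc i) x = ?z" for i
      by (induction i) (use gz bin_idem[OF g z] in auto)
    then show ?thesis unfolding s_def[of ?z x] k .
  qed
  have "g u v = v" "g v u = v" using tuv tvu bin_idem[OF t vA] by (simp_all add: g_def)
  then have "(g u ^^ i) v = v" "(g v ^^ Suc i) u = v" for i
    by (induction i) (use bin_idem[OF g vA] in auto)
  then have "s u v = v" "s v u = v" by (simp_all add: s_def k del: funpow.simps)
  then have "proper s" using proper_if_equal[OF s uA vA uv] by simp
  moreover have "f x (s x y) = s x y" if "x \<in> A" "y \<in> A" for x y
    using absorb[OF s that(1) bin_closed[OF s that]] 1 2 that by simp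
  ultimately show ?thesis using that by blast
qed

section \<open>Reachability and the terminal component of a two-generated subalgebra\<close>

definition edges :: "'a set \<Rightarrow> ('a \<times> 'a) set" where
  "edges X = {(x, y). x \<in> X \<and> y \<in> X \<and> f x y = y}"

text \<open>The operation \<open>s\<close> moves along one edge from its first argument, and
  reachability is a preorder.\<close>

lemma reach:
  assumes X: "sub X" and h: "bin h"
  shows "(\<forall>x\<in>X. \<forall>y\<in>X. (x, h x y) \<in> (edges X)\<^sup>*) \<or> (\<forall>x\<in>X. \<forall>y\<in>X. (y, h x y) \<in> (edges X)\<^sup>*)"
proof -
  obtain s where s: "proper s" "\<And>x y. x \<in> A \<Longrightarrow> y \<in> A \<Longrightarrow> f x (s x y) = s x y"
    by (rule partial_semilattice) auto
  have "s x y \<in> X \<and> (x, s x y) \<in> (edges X)\<^sup>*" if "x \<in> X" "y \<in> X" for x y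
    using that s(2) sub_bin[OF X proper_bin[OF s(1)]] sub_subset[OF X] by (auto simp: edges_def)
  then show ?thesis
    using X h unfolding sub_def by (intro bin_coord_induct[OF s(1)]) auto
qed

lemma reach_f:
  assumes X: "sub X" and xy: "x \<in> X" "y \<in> X"
  shows "(x, f x y) \<in> (edges X)\<^sup>*"
  using reach[OF X bin_f] xy comm_f[of x y] sub_subset[OF X] by metis

definition core :: "'a \<Rightarrow> 'a \<Rightarrow> 'a set \<Rightarrow> bool" where
  "core a b M \<longleftrightarrow> M \<subseteq> gen a b \<and> M \<noteq> {} \<and> gen a b \<subseteq> {a, b} \<union> M
    \<and> (\<forall>m\<in>M. \<forall>x\<in>gen a b. f m x \<in> M) \<and> strongly_connected M f"

lemma core_swap: "core a b M = core b a M"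
  unfolding core_def gen_swap[of a b] by (simp add: insert_commute)

text \<open>A smallest up-set of the reachability order is a terminal strongly connected component,
  and it is an ideal because \<open>f m x\<close> is reachable from \<open>m\<close>.\<close>

lemma exists_core:
  assumes ab: "a \<in> A" "b \<in> A"
  shows "\<exists>M. core a b M"
proof -
  let ?X = "gen a b"
  have X: "sub ?X" using sub_gen[OF ab] .
  have XA: "x \<in> A" if "x \<in> ?X" for x using sub_subset[OF X that] .
  have finX: "finite ?X" using gen_subset[OF ab] finite_A by (rule finite_subset)
  define up where "up m = {y. (m, y) \<in> (edges ?X)\<^sup>*}" for m
  have upX: "up m \<subseteq> ?X" if "m \<in> ?X" for m
  proof
    fix y assume "y \<in> up m"
    then have "(m, y) \<in> (edges ?X)\<^sup>*" by (simp add: up_def)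
    then show "y \<in> ?X" using that by (induction rule: rtrancl_induct) (auto simp: edges_def)
  qed
  from ex_has_least_nat[of "\<lambda>m. m \<in> ?X", OF gen_generators(1), of "\<lambda>m. card (up m)"]
  obtain m0 where m0: "m0 \<in> ?X" "\<And>m. m \<in> ?X \<Longrightarrow> card (up m0) \<le> card (up m)" by blast
  let ?M = "up m0"
  have MX: "?M \<subseteq> ?X" using upX[OF m0(1)] .
  have finM: "finite ?M" using MX finX by (rule finite_subset)
  have up_eq: "up m = ?M" if "m \<in> ?M" for m
  proof -
    have "up m \<subseteq> ?M" using that by (auto simp: up_def)
    then show ?thesis using card_seteq[OF finM] m0(2) MX that by blast
  qed
  have reachM: "y \<in> ?M" if "m \<in> ?M" "(m, y) \<in> (edges ?X)\<^sup>*" for m y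
    using that by (auto simp: up_def)
  have ideal: "f m x \<in> ?M" if "m \<in> ?M" "x \<in> ?X" for m x
    using reachM[OF that(1) reach_f[OF X]] MX that by blast
  have ideal': "f x m \<in> ?M" if "m \<in> ?M" "x \<in> ?X" for m x
    using ideal[OF that] comm_f[of x m] XA MX that by auto
  have sc: "strongly_connected ?M f"
  proof
    fix J assume J: "J \<subseteq> ?M" "J \<noteq> {}" and step: "\<And>x y. x \<in> J \<Longrightarrow> y \<in> ?M \<Longrightarrow> f x y = y \<Longrightarrow> y \<in> J"
    obtain j where j: "j \<in> J" using J by blast
    have "m \<in> J" if m: "m \<in> ?M" for m
    proof -
      have "(j, m) \<in> (edges ?X)\<^sup>*" using up_eq[of j] J(1) j m by (auto simp: up_def)
      then show ?thesis
      proof (induction rule: rtrancl_induct)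
        case (step y z)
        then have "z \<in> ?M" using reachM[of y z] J(1) by blast
        then show ?case using step \<open>\<And>x y. x \<in> J \<Longrightarrow> y \<in> ?M \<Longrightarrow> f x y = y \<Longrightarrow> y \<in> J\<close> by (auto simp: edges_def)
      qed (rule j)
    qed
    then show "J = ?M" using J by blast
  qed (use finM ideal MX comm_f XA f_idem in \<open>auto simp: subset_iff\<close>)
  have m0M: "m0 \<in> ?M" by (simp add: up_def)
  obtain k where k: "bin k" "k a b \<in> ?M" using m0(1) m0M unfolding gen_def by blast
  \<comment> \<open>\<open>f a b\<close> may lie outside the component. This commutative operation
    sends \<open>(a, b)\<close> into it and still absorbs arguments from it, so
    \<open>{a, b}\<close> together with the component is closed under \<open>g\<close>.\<close>
  define g where "g x y = f (k x y) (k y x)" for x y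
  have g: "bin g" unfolding g_def by (rule bin_comp[OF bin_f k(1) bin_swap[OF k(1)]])
  have gc: "g x y = g y x" if "x \<in> A" "y \<in> A" for x y
    unfolding g_def using comm_f bin_closed[OF k(1)] that by blast
  have "proper g" using g gc by (rule commutative_proper)
  have kX: "k x y \<in> ?X" if "x \<in> ?X" "y \<in> ?X" for x y using gen_bin[OF k(1) that] .
  have gM: "g x m \<in> ?M" if m: "m \<in> ?M" and x: "x \<in> ?X" for x m
  proof -
    have mX: "m \<in> ?X" using m MX by blast
    have "k x m \<in> ?M \<or> k m x \<in> ?M"
      using reach[OF X k(1)] reachM[OF m] mX x by blast
    then show ?thesis
      unfolding g_def using ideal[of "k x m" "k m x"] ideal'[of "k m x" "k x m"] kX[OF x mX] kX[OF mX x] by blast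
  qed
  have gab: "g a b \<in> ?M" unfolding g_def by (rule ideal[OF k(2) kX[OF gen_generators(2,1)]])
  have "sub ({a, b} \<union> ?M)"
  proof (rule sub_proper[OF \<open>proper g\<close>])
    show "{a, b} \<union> ?M \<subseteq> A" using ab XA MX by blast
    fix x y assume xy: "x \<in> {a, b} \<union> ?M" "y \<in> {a, b} \<union> ?M"
    have xyX: "x \<in> ?X" "y \<in> ?X" using xy MX gen_generators(1)[of a b] gen_generators(2)[of b a] by blast+
    consider "y \<in> ?M" | "x \<in> ?M" | "x = y" | "{x, y} = {a, b}" using xy by blast
    then show "g x y \<in> {a, b} \<union> ?M"
    proof cases
      case 1
      then show ?thesis using gM xyX by blast
    next
      case 2
      then show ?thesis using gM[OF 2 xyX(2)] gc[of x y] XA xyX by simp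
    next
      case 3
      then show ?thesis using bin_idem[OF g XA[OF xyX(1)]] xy by simp
    next
      case 4
      then show ?thesis using gab gc[OF ab] by (auto simp: doubleton_eq_iff)
    qed
  qed
  then have "?X \<subseteq> {a, b} \<union> ?M" by (rule gen_minimal) auto
  then show ?thesis using MX m0M ideal sc unfolding core_def by blast
qed

text \<open>
  If the part \<open>N\<close> of \<open>Rel a b\<close> inside \<open>M \<times> M\<close> were not full, it would induce a proper congruence \<open>\<theta>\<close>
  on \<open>M\<close>. There is a proper \<open>w\<close> with \<open>w(a, b) = a\<close> and \<open>w(b, a) = z \<in> M\<close>, and \<open>b\<close> acts on \<open>M\<close> like \<open>z\<close>
  modulo \<open>\<theta>\<close>. So \<open>w\<close> is the first projection on the classes of \<open>a\<close> and \<open>b\<close>, although the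
  commutative \<open>f\<close> is generated by \<open>w\<close>.
\<close>

lemma core_generator:
  assumes ab: "a \<in> A" "b \<in> A" "a \<noteq> b" and M: "core a b M" and aM: "a \<in> M"
  shows "f a b = a"
proof -
  let ?X = "gen a b"
  have X: "sub ?X" using sub_gen[OF ab(1,2)] .
  have XA: "x \<in> A" if "x \<in> ?X" for x using sub_subset[OF X that] .
  have aX: "a \<in> ?X" and bX: "b \<in> ?X" using gen_generators(1)[of a b] gen_generators(2)[of b a] by blast+
  have MX: "M \<subseteq> ?X" and XM: "?X \<subseteq> {a, b} \<union> M" and ideal: "\<And>m x. m \<in> M \<Longrightarrow> x \<in> ?X \<Longrightarrow> f m x \<in> M"
    and sc: "strongly_connected M f"
    using M by (auto simp: core_def)
  interpret S: strongly_connected M f by (rule sc)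
  have MA: "m \<in> A" if "m \<in> M" for m using that MX XA by blast
  have ideal': "f x m \<in> M" if "m \<in> M" "x \<in> ?X" for m x
    using ideal[OF that] comm_f[of x m] XA[OF that(2)] MA[OF that(1)] by simp
  \<comment> \<open>The condition at \<open>u, v\<close> ensures that \<open>w\<close> is not the
    first projection even when \<open>w a b = a\<close>.\<close>
  define P where "P m w \<longleftrightarrow> bin w \<and> w u v = v \<and> w a b = m \<and> w b a \<in> M" for m w
  have "{m \<in> M. \<exists>w. P m w} = M"
  proof (rule S.connected)
    have "f a b \<in> M" "f b a \<in> M" using ideal[OF aM bX] ideal'[OF aM bX] by simp_all
    then have "P (f a b) f" using bin_f fuv by (simp add: P_def)
    then show "{m \<in> M. \<exists>w. P m w} \<noteq> {}" using \<open>f a b \<in> M\<close> by blast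
  next
    fix m m' assume "m \<in> {m \<in> M. \<exists>w. P m w}" and m': "m' \<in> M" "f m m' = m'"
    then obtain w where m: "m \<in> M" and w: "P m w" by blast
    obtain k where k: "bin k" "m' = k a b" using subsetD[OF MX m'(1)] by (auto simp: gen_def)
    \<comment> \<open>This moves the value along the edge from \<open>m\<close> to
      \<open>m' = k a b\<close>. As \<open>v\<close> absorbs in \<open>{u, v}\<close>, the value at
      \<open>u, v\<close> survives whatever \<open>k u v\<close> is.\<close>
    define w' where "w' x y = f (w x y) (k x y)" for x y
    have bw: "bin w" using w by (simp add: P_def)
    have "bin w'" unfolding w'_def by (rule bin_comp[OF bin_f bw k(1)])
    moreover have "k u v \<in> {u, v}" by (rule edge_closed[OF k(1)]; simp)
    then have "w' u v = v" using w fvu f_idem[OF vA] by (auto simp: w'_def P_def)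
    moreover have "w' a b = m'" using w m' k by (simp add: w'_def P_def)
    moreover have "w' b a \<in> M" using w ideal[OF _ gen_bin[OF k(1) bX aX]] by (simp add: w'_def P_def)
    ultimately have "P m' w'" by (simp add: P_def)
    then show "m' \<in> {m \<in> M. \<exists>w. P m w}" using m' by blast
  qed auto
  then have P: "\<exists>w. P m w" if "m \<in> M" for m using that by blast
  define N where "N = {(x, y) \<in> Rel a b. x \<in> M \<and> y \<in> M}"
  have P_N: "(m, w b a) \<in> N" if "P m w" "m \<in> M" for m w
    using that Rel_intro[of w a b] by (auto simp: N_def P_def)
  have symN: "sym N" using Rel_sym by (auto simp: N_def sym_def)
  have compN: "S.compatible N"
    using Rel_bin[OF bin_f] S.closed by (auto simp: N_def S.compatible_def)
  have total: "\<exists>y. (x, y) \<in> N" if "x \<in> M" for x using P P_N that by blast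
  have "N = M \<times> M"
  proof (rule ccontr)
    assume "N \<noteq> M \<times> M"
    then obtain \<theta> where comp: "S.compatible \<theta>" and eq: "equiv M \<theta>" and nf: "\<theta> \<noteq> M \<times> M" and N\<theta>: "N O N \<subseteq> \<theta>"
      using S.full_or_congruence[OF compN symN total] by blast
    have \<theta>M: "x \<in> M \<and> y \<in> M" if "(x, y) \<in> \<theta>" for x y using S.compatible_carrier[OF comp that] .
    have refl: "(x, x) \<in> \<theta>" if "x \<in> M" for x using eq that by (auto simp: equiv_def refl_on_def)
    have symT: "(y, x) \<in> \<theta>" if "(x, y) \<in> \<theta>" for x y using eq that by (meson equiv_def symD)
    have trT: "(x, z) \<in> \<theta>" if "(x, y) \<in> \<theta>" "(y, z) \<in> \<theta>" for x y z using eq that by (meson equiv_def transD)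
    obtain w where w: "P a w" using P[OF aM] by blast
    define z where "z = w b a"
    have zM: "z \<in> M" using w by (simp add: z_def P_def)
    have bw: "bin w" using w by (simp add: P_def)
    have "w u v \<noteq> u" "w a b \<noteq> b" using w uv ab(3) by (simp_all add: P_def)
    then have pw: "proper w" using bw uA vA ab(1,2) unfolding proper_def by blast
    have azN: "(a, z) \<in> N" using P_N[OF w aM] by (simp add: z_def)
    have b_like_z: "(f b y, f z y) \<in> \<theta>" if y: "y \<in> M" for y
    proof -
      \<comment> \<open>For any neighbour \<open>x\<close> of \<open>y\<close>, both
        \<open>f b y\<close> and \<open>f z y\<close> are neighbours of
        \<open>f a x\<close>.\<close>
      obtain x where x: "(x, y) \<in> N" using total[OF y] symD[OF symN] by blast
      have xM: "x \<in> M" using x by (simp add: N_def)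
      have "(f a x, f b y) \<in> Rel a b" using Rel_bin[OF bin_f Rel_gen] x by (simp add: N_def)
      moreover have "f a x \<in> M" "f b y \<in> M" using S.closed aM xM ideal'[OF y bX] by auto
      ultimately have "(f a x, f b y) \<in> N" by (simp add: N_def)
      moreover have "(f a x, f z y) \<in> N" using S.compatibleD[OF compN azN x] .
      ultimately have "(f b y, f z y) \<in> N O N" using symD[OF symN] by blast
      then show ?thesis using N\<theta> by blast
    qed
    have bz: "(b, z) \<in> \<theta>" if b: "b \<in> M"
    proof -
      have "(b, f z b) \<in> \<theta>" using b_like_z[OF b] S.idem[OF b] by simp
      moreover have "(f z b, z) \<in> \<theta>" using b_like_z[OF zM] S.idem[OF zM] S.comm[OF b zM] by simp
      ultimately show ?thesis by (rule trT)
    qed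
    \<comment> \<open>Modulo \<open>\<theta>\<close>, replacing \<open>b\<close> by \<open>z\<close>
      is a homomorphism from the generated subalgebra to \<open>M\<close>; if \<open>b\<close> is
      itself in \<open>M\<close>, \<open>bz\<close> keeps this consistent. Its kernel
      \<open>\<tau>\<close> is a congruence.\<close>
    define c where "c x = (if x = b then z else x)" for x
    have cX: "c x \<in> M" if "x \<in> ?X" for x using that XM aM zM by (auto simp: c_def)
    have cM: "(c m, m) \<in> \<theta>" if "m \<in> M" for m using that refl symT[OF bz] by (auto simp: c_def)
    define \<tau> where "\<tau> = {(x, y). x \<in> ?X \<and> y \<in> ?X \<and> (c x, c y) \<in> \<theta>}"
    have key: "(c (f x y), f (c x) (c y)) \<in> \<theta>" if xy: "x \<in> ?X" "y \<in> ?X" for x y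
    proof -
      have left: "(c (f b y), f z y) \<in> \<theta>" if "y \<in> M" for y
        using cM[OF ideal'[OF that bX]] b_like_z[OF that] by (rule trT)
      have notb: "x \<in> M" if "x \<in> ?X" "x \<noteq> b" for x using that XM aM by blast
      show ?thesis
      proof (cases "x = b"; cases "y = b")
        assume "x = b" "y = b"
        then show ?thesis using f_idem[OF ab(2)] S.idem[OF zM] refl[OF zM] by (simp add: c_def)
      next
        assume "x = b" "y \<noteq> b"
        then show ?thesis using left notb[OF xy(2)] by (simp add: c_def)
      next
        assume "x \<noteq> b" "y = b"
        then show ?thesis
          using left[OF notb[OF xy(1)]] notb[OF xy(1)] comm_f[OF ab(2) XA[OF xy(1)]] S.comm[OF zM notb[OF xy(1)]]
          by (simp add: c_def)
      next
        assume "x \<noteq> b" "y \<noteq> b"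
        then show ?thesis using cM[OF S.closed[OF notb notb]] xy by (simp add: c_def)
      qed
    qed
    have eq\<tau>: "equiv ?X \<tau>"
    proof (rule equivI)
      show "refl_on ?X \<tau>" using refl cX by (auto simp: \<tau>_def refl_on_def)
      show "sym \<tau>" using symT by (auto simp: \<tau>_def sym_def)
      show "trans \<tau>" using trT by (auto simp: \<tau>_def trans_def)
    qed (auto simp: \<tau>_def)
    have comp\<tau>: "(f x y, f x' y') \<in> \<tau>" if "(x, x') \<in> \<tau>" "(y, y') \<in> \<tau>" for x y x' y'
    proof -
      have xX: "x \<in> ?X" "x' \<in> ?X" "y \<in> ?X" "y' \<in> ?X" using that by (auto simp: \<tau>_def)
      have "(f (c x) (c y), f (c x') (c y')) \<in> \<theta>" using S.compatibleD[OF comp] that by (auto simp: \<tau>_def)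
      then have "(c (f x y), c (f x' y')) \<in> \<theta>"
        using trT[OF key[OF xX(1,3)]] trT symT[OF key[OF xX(2,4)]] by blast
      then show ?thesis using xX gen_bin[OF bin_f] by (simp add: \<tau>_def)
    qed
    have cong: "(h x y, h x' y') \<in> \<tau>" if "bin h" "(x, x') \<in> \<tau>" "(y, y') \<in> \<tau>" for h x y x' y'
      using bin_cong_induct[OF proper_f X eq\<tau> comp\<tau> that] .
    have refl\<tau>: "(x, x) \<in> \<tau>" if "x \<in> ?X" for x using that refl cX by (simp add: \<tau>_def)
    have sym\<tau>: "(y, x) \<in> \<tau>" if "(x, y) \<in> \<tau>" for x y using that symT by (auto simp: \<tau>_def)
    have tr\<tau>: "(x, z) \<in> \<tau>" if "(x, y) \<in> \<tau>" "(y, z) \<in> \<tau>" for x y z using that trT by (auto simp: \<tau>_def)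
    have \<tau>X: "x \<in> ?X" if "(x, y) \<in> \<tau>" for x y using that by (simp add: \<tau>_def)
    have z\<tau>b: "(z, b) \<in> \<tau>" using cM[OF zM] zM MX bX by (auto simp: \<tau>_def c_def)
    \<comment> \<open>On these two classes \<open>w\<close> is the first projection modulo
      \<open>\<tau>\<close>, as \<open>w b a = z\<close> is related to \<open>b\<close>. So
      \<open>f\<close> follows one argument there, and its commutativity puts \<open>a\<close> and
      \<open>b\<close> into one class.\<close>
    let ?Y = "{x. (x, a) \<in> \<tau> \<or> (x, b) \<in> \<tau>}"
    have "(\<forall>x\<in>?Y. \<forall>y\<in>?Y. (x, f x y) \<in> \<tau>) \<or> (\<forall>x\<in>?Y. \<forall>y\<in>?Y. (y, f x y) \<in> \<tau>)"
    proof (rule bin_coord_induct[OF pw _ _ _ _ bin_f, where \<rho> = "\<lambda>x y. (x, y) \<in> \<tau>"])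
      show "?Y \<subseteq> A" using \<tau>X XA by blast
      show "(x, x) \<in> \<tau>" if "x \<in> ?Y" for x using that refl\<tau> \<tau>X by blast
      show "(x, z) \<in> \<tau>" if "(x, y) \<in> \<tau>" "(y, z) \<in> \<tau>" for x y z using tr\<tau>[OF that] .
      fix x y assume x: "x \<in> ?Y" and y: "y \<in> ?Y"
      have vals: "w a a = a" "w a b = a" "w b a = z" "w b b = b"
        using bin_idem[OF bw] ab w by (auto simp: P_def z_def)
      have "(w x y, x) \<in> \<tau>"
      proof -
        consider "(x, a) \<in> \<tau>" | "(x, b) \<in> \<tau>" using x by blast
        then show ?thesis
        proof cases
          case 1
          have "(w x y, a) \<in> \<tau>" using y cong[OF bw 1, of y a] cong[OF bw 1, of y b] unfolding vals by blast
          then show ?thesis using tr\<tau> sym\<tau>[OF 1] by blast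
        next
          case 2
          have "(w x y, z) \<in> \<tau> \<or> (w x y, b) \<in> \<tau>" using y cong[OF bw 2, of y a] cong[OF bw 2, of y b] unfolding vals by blast
          then have "(w x y, b) \<in> \<tau>" using tr\<tau>[OF _ z\<tau>b] by blast
          then show ?thesis using tr\<tau> sym\<tau>[OF 2] by blast
        qed
      qed
      then show "w x y \<in> ?Y \<and> (x, w x y) \<in> \<tau>" using x tr\<tau> sym\<tau> by blast
    qed
    moreover have "a \<in> ?Y" "b \<in> ?Y" using refl\<tau> aX bX by auto
    ultimately have "(a, f a b) \<in> \<tau> \<and> (b, f b a) \<in> \<tau> \<or> (b, f a b) \<in> \<tau> \<and> (a, f b a) \<in> \<tau>" by blast
    then have ab\<tau>: "(b, a) \<in> \<tau>" using comm_f[OF ab(1,2)] tr\<tau> sym\<tau> by metis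
    have all: "(x, a) \<in> \<tau>" if in_X: "x \<in> ?X" for x
    proof -
      obtain h where h: "bin h" "x = h a b" using in_X by (auto simp: gen_def)
      show ?thesis using cong[OF h(1) refl\<tau>[OF aX] ab\<tau>] bin_idem[OF h(1) ab(1)] h(2) by simp
    qed
    have "(m, a) \<in> \<theta>" if m: "m \<in> M" for m
    proof -
      have "(c m, c a) \<in> \<theta>" using all MX m by (auto simp: \<tau>_def)
      then show ?thesis using trT[OF symT[OF cM[OF m]]] ab(3) by (simp add: c_def)
    qed
    then have "M \<times> M \<subseteq> \<theta>" using trT symT by blast
    moreover have "\<theta> \<subseteq> M \<times> M" using \<theta>M by auto
    ultimately show False using nf by simp
  qed
  then have "(a, a) \<in> Rel a b" using aM by (auto simp: N_def)
  then obtain g where g: "bin g" "g a b = a" "g b a = a" unfolding Rel_def by auto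
  have "f b a = a" using absorb[OF g(1) ab(2,1) g(3,2)] .
  then show ?thesis using comm_f[OF ab(1,2)] by simp
qed

lemma spiral_condition:
  assumes ab: "a \<in> A" "b \<in> A" "a \<noteq> b"
  shows "gen a b = {a, b} \<or>
    (\<exists>M. a \<notin> M \<and> b \<notin> M \<and> M \<noteq> {} \<and> gen a b = {a, b} \<union> M \<and> f a b \<in> M \<and> (\<forall>m\<in>M. \<forall>x\<in>gen a b. f m x \<in> M \<and> f x m \<in> M))"
proof -
  have closed: "gen a b = {a, b}" if "f a b \<in> {a, b}"
  proof -
    have "sub {a, b}"
      using that ab comm_f[OF ab(1,2)] f_idem by (intro sub_proper[OF proper_f]) auto
    then show ?thesis
      using gen_minimal[of "{a, b}" a b] gen_generators(1)[of a b] gen_generators(2)[of b a] by blast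
  qed
  obtain M where M: "core a b M" using exists_core[OF ab(1,2)] by blast
  consider "a \<in> M" | "b \<in> M" | "a \<notin> M" "b \<notin> M" by blast
  then show ?thesis
  proof cases
    case 1
    then show ?thesis using core_generator[OF ab M] closed by simp
  next
    case 2
    have "f b a = b" using core_generator[OF ab(2,1) _ _ 2] M ab(3) core_swap by metis
    then show ?thesis using comm_f[OF ab(1,2)] closed by simp
  next
    case 3
    have X: "x \<in> A" if "x \<in> gen a b" for x using gen_subset[OF ab(1,2)] that by blast
    have aX: "a \<in> gen a b" and bX: "b \<in> gen a b" using gen_generators(1)[of a b] gen_generators(2)[of b a] by blast+
    have MX: "M \<subseteq> gen a b" "M \<noteq> {}" and XM: "gen a b \<subseteq> {a, b} \<union> M" and ideal: "\<And>m x. m \<in> M \<Longrightarrow> x \<in> gen a b \<Longrightarrow> f m x \<in> M"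
      using M by (auto simp: core_def)
    have ideal': "f x m \<in> M" if "m \<in> M" "x \<in> gen a b" for m x
      using ideal[OF that] comm_f[of x m] X MX that by auto
    show ?thesis
    proof (cases "f a b \<in> M")
      case True
      have "gen a b = {a, b} \<union> M" using MX XM aX bX by blast
      with 3 True MX(2) ideal ideal' show ?thesis by (intro disjI2 exI[of _ M]) simp
    next
      case False
      then have "f a b \<in> {a, b}" using gen_bin[OF bin_f aX bX] XM by blast
      then show ?thesis using closed by blast
    qed
  qed
qed

end

subsection \<open>Affine algebras\<close>

locale additive_group =
  fixes A :: "'a set" and add :: "'a \<Rightarrow> 'a \<Rightarrow> 'a" and z :: 'a and neg :: "'a \<Rightarrow> 'a"
  assumes add_closed: "x \<in> A \<Longrightarrow> y \<in> A \<Longrightarrow> add x y \<in> A"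
    and zero_closed: "z \<in> A"
    and neg_closed: "x \<in> A \<Longrightarrow> neg x \<in> A"
    and assoc: "x \<in> A \<Longrightarrow> y \<in> A \<Longrightarrow> w \<in> A \<Longrightarrow> add (add x y) w = add x (add y w)"
    and commute: "x \<in> A \<Longrightarrow> y \<in> A \<Longrightarrow> add x y = add y x"
    and zero: "x \<in> A \<Longrightarrow> add x z = x"
    and neg: "x \<in> A \<Longrightarrow> add x (neg x) = z"
begin

lemma zero_left: "x \<in> A \<Longrightarrow> add z x = x"
  using commute zero zero_closed by simp

lemma neg_left: "x \<in> A \<Longrightarrow> add (neg x) x = z"
  using commute neg neg_closed by simp

lemma interchange:
  assumes "x \<in> A" "y \<in> A" "v \<in> A" "w \<in> A"
  shows "add (add x y) (add v w) = add (add x v) (add y w)"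
proof -
  have "add y (add v w) = add v (add y w)"
    using assms assoc[of y v w] assoc[of v y w] commute[of y v] by simp
  then show ?thesis using assms assoc add_closed by simp
qed

lemma double_zero:
  assumes "x \<in> A" "add x x = x"
  shows "x = z"
  using assoc[of "neg x" x x] neg_left[of x] zero_left[of x] assms neg_closed[of x] by simp

text \<open>The additive endomorphisms of the group, taken extensional so that the ring laws hold as
  equations between functions.\<close>

definition E :: "('a \<Rightarrow> 'a) set" where
  "E = {\<phi> \<in> A \<rightarrow>\<^sub>E A. \<forall>x\<in>A. \<forall>y\<in>A. \<phi> (add x y) = add (\<phi> x) (\<phi> y)}"

definition endo_ring :: "('a \<Rightarrow> 'a) ring" where
  "endo_ring = \<lparr>carrier = E, monoid.mult = (\<lambda>\<phi> \<psi>. \<lambda>x\<in>A. \<phi> (\<psi> x)), one = (\<lambda>x\<in>A. x),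
    ring.zero = (\<lambda>x\<in>A. z), ring.add = (\<lambda>\<phi> \<psi>. \<lambda>x\<in>A. add (\<phi> x) (\<psi> x))\<rparr>"

definition endo_module :: "('a \<Rightarrow> 'a, 'a) module" where
  "endo_module = \<lparr>carrier = A, monoid.mult = (\<lambda>x y. z), one = z,
    ring.zero = z, ring.add = add, smult = (\<lambda>\<phi> x. \<phi> x)\<rparr>"

lemma endo_module_simps [simp]:
  "carrier endo_module = A" "\<zero>\<^bsub>endo_module\<^esub> = z" "x \<oplus>\<^bsub>endo_module\<^esub> y = add x y"
  "\<phi> \<odot>\<^bsub>endo_module\<^esub> x = \<phi> x"
  by (simp_all add: endo_module_def)

lemma E_closed: "\<phi> \<in> E \<Longrightarrow> x \<in> A \<Longrightarrow> \<phi> x \<in> A"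
  by (auto simp: E_def)

lemma E_add: "\<phi> \<in> E \<Longrightarrow> x \<in> A \<Longrightarrow> y \<in> A \<Longrightarrow> \<phi> (add x y) = add (\<phi> x) (\<phi> y)"
  by (simp add: E_def)

lemma E_ext:
  assumes "\<phi> \<in> E" "\<psi> \<in> E" "\<And>x. x \<in> A \<Longrightarrow> \<phi> x = \<psi> x"
  shows "\<phi> = \<psi>"
proof (rule extensionalityI[of _ A])
  show "\<phi> \<in> extensional A" "\<psi> \<in> extensional A" using assms(1,2) by (auto simp: E_def PiE_def)
qed (rule assms(3))

lemma E_intro:
  assumes "\<And>x. x \<in> A \<Longrightarrow> \<phi> x \<in> A" "\<And>x y. x \<in> A \<Longrightarrow> y \<in> A \<Longrightarrow> \<phi> (add x y) = add (\<phi> x) (\<phi> y)"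
  shows "(\<lambda>x\<in>A. \<phi> x) \<in> E"
  using assms add_closed by (auto simp: E_def)

lemma E_sum: "\<phi> \<in> E \<Longrightarrow> \<psi> \<in> E \<Longrightarrow> (\<lambda>x\<in>A. add (\<phi> x) (\<psi> x)) \<in> E"
  by (rule E_intro) (simp_all add: add_closed E_closed E_add interchange)

lemma E_comp: "\<phi> \<in> E \<Longrightarrow> \<psi> \<in> E \<Longrightarrow> (\<lambda>x\<in>A. \<phi> (\<psi> x)) \<in> E"
  by (rule E_intro) (simp_all add: E_closed E_add)

lemma E_const: "(\<lambda>x\<in>A. z) \<in> E"
  by (rule E_intro) (simp_all add: zero_closed zero)

lemma E_id: "(\<lambda>x\<in>A. x) \<in> E"
  by (rule E_intro) simp_all

lemma E_neg: "\<phi> \<in> E \<Longrightarrow> (\<lambda>x\<in>A. neg (\<phi> x)) \<in> E"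
proof (rule E_intro)
  fix x y assume \<phi>: "\<phi> \<in> E" and xy: "x \<in> A" "y \<in> A"
  let ?a = "\<phi> x" and ?b = "\<phi> y"
  have A: "?a \<in> A" "?b \<in> A" using E_closed \<phi> xy by auto
  note cl = A neg_closed[OF A(1)] neg_closed[OF A(2)] add_closed neg_closed
  have "add (neg (add ?a ?b)) (add (add ?a ?b) (add (neg ?a) (neg ?b))) = add (neg ?a) (neg ?b)"
    using cl assoc[of "neg (add ?a ?b)" "add ?a ?b" "add (neg ?a) (neg ?b)", symmetric]
    by (simp add: neg_left zero_left)
  moreover have "add (add ?a ?b) (add (neg ?a) (neg ?b)) = z"
    using cl by (simp add: interchange[of ?a ?b] neg zero zero_closed)
  ultimately show "neg (\<phi> (add x y)) = add (neg ?a) (neg ?b)"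
    using cl E_add[OF \<phi> xy] by (simp add: zero)
qed (simp add: neg_closed E_closed)

lemma abelian_group_module: "abelian_group endo_module"
proof (rule abelian_groupI)
  fix x assume "x \<in> carrier endo_module"
  then show "\<exists>y\<in>carrier endo_module. y \<oplus>\<^bsub>endo_module\<^esub> x = \<zero>\<^bsub>endo_module\<^esub>"
    by (intro bexI[of _ "neg x"]) (simp_all add: neg_left neg_closed)
qed (auto simp: add_closed zero_closed assoc zero_left intro: commute)

lemma ring_endo: "ring endo_ring"
proof (rule ringI)
  show "abelian_group endo_ring"
  proof (rule abelian_groupI)
    fix \<phi> assume \<phi>: "\<phi> \<in> carrier endo_ring"
    show "\<exists>\<psi>\<in>carrier endo_ring. \<psi> \<oplus>\<^bsub>endo_ring\<^esub> \<phi> = \<zero>\<^bsub>endo_ring\<^esub>"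
      using \<phi> by (intro bexI[of _ "\<lambda>x\<in>A. neg (\<phi> x)"]) (auto simp: endo_ring_def E_neg neg_left E_closed)
  next
    fix \<phi> \<psi> assume "\<phi> \<in> carrier endo_ring" "\<psi> \<in> carrier endo_ring"
    then have "\<phi> \<in> E" "\<psi> \<in> E" by (simp_all add: endo_ring_def)
    then have "(\<lambda>x\<in>A. add (\<phi> x) (\<psi> x)) = (\<lambda>x\<in>A. add (\<psi> x) (\<phi> x))"
      by (intro restrict_ext) (rule commute; rule E_closed; assumption)
    then show "\<phi> \<oplus>\<^bsub>endo_ring\<^esub> \<psi> = \<psi> \<oplus>\<^bsub>endo_ring\<^esub> \<phi>"
      by (simp add: endo_ring_def)
  qed (auto simp: endo_ring_def E_sum E_const assoc E_closed zero_left zero_closed add_closed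
      intro!: E_ext restrict_ext E_sum E_sum[unfolded restrict_def] E_const[unfolded restrict_def])
  show "monoid endo_ring"
  proof (rule monoidI)
    fix \<phi> assume "\<phi> \<in> carrier endo_ring"
    then have \<phi>: "\<phi> \<in> E" by (simp add: endo_ring_def)
    show "\<one>\<^bsub>endo_ring\<^esub> \<otimes>\<^bsub>endo_ring\<^esub> \<phi> = \<phi>"
      using E_ext[OF E_comp[OF E_id \<phi>] \<phi>] E_closed[OF \<phi>] by (simp add: endo_ring_def)
    show "\<phi> \<otimes>\<^bsub>endo_ring\<^esub> \<one>\<^bsub>endo_ring\<^esub> = \<phi>"
      using E_ext[OF E_comp[OF \<phi> E_id] \<phi>] E_closed[OF \<phi>] by (simp add: endo_ring_def)
  qed (auto simp: endo_ring_def E_comp E_id E_closed intro!: restrict_ext)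
qed (auto simp: endo_ring_def E_sum E_comp E_closed E_add add_closed intro!: restrict_ext)

lemma left_module_endo: "left_module endo_ring endo_module"
proof -
  interpret R: ring endo_ring by (rule ring_endo)
  interpret M: abelian_group endo_module by (rule abelian_group_module)
  show ?thesis
    by unfold_locales (auto simp: endo_ring_def E_closed E_add)
qed

text \<open>The scalar \<open>r i\<close> is \<open>f\<close> restricted to the \<open>i\<close>-th
  axis, and \<open>xs\<close> is the sum of its components on the axes, added up prefix by prefix
  with zero padding. The constant is \<open>z\<close>, since additive maps preserve zero.\<close>

lemma additive_decomposition:
  assumes cl: "\<And>xs. xs \<in> nlists n A \<Longrightarrow> f xs \<in> A"
    and ad: "\<And>xs ys. xs \<in> nlists n A \<Longrightarrow> ys \<in> nlists n A \<Longrightarrow> f (map2 add xs ys) = add (f xs) (f ys)"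
  shows "\<exists>r\<in>{..<n} \<rightarrow> carrier endo_ring. \<exists>c\<in>carrier endo_module. \<forall>xs\<in>nlists n A.
    f xs = (\<Oplus>\<^bsub>endo_module\<^esub>i\<in>{..<n}. r i \<odot>\<^bsub>endo_module\<^esub> (xs ! i)) \<oplus>\<^bsub>endo_module\<^esub> c"
proof -
  interpret M: abelian_group endo_module by (rule abelian_group_module)
  let ?u = "\<lambda>i x. (replicate n z)[i := x]"
  have u: "?u i x \<in> nlists n A" if "x \<in> A" for i x
    using that zero_closed by (intro nlists_update_in_list nlists_replicateI)
  define r where "r i = (\<lambda>x\<in>A. f (?u i x))" for i
  have r: "r i \<in> E" for i
    unfolding r_def
  proof (rule E_intro)
    fix x y assume xy: "x \<in> A" "y \<in> A"
    have "map2 add (?u i x) (?u i y) = ?u i (add x y)"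
    proof (rule nth_equalityI)
      fix j assume "j < length (map2 add (?u i x) (?u i y))"
      then show "map2 add (?u i x) (?u i y) ! j = ?u i (add x y) ! j"
        by (cases "i = j") (simp_all add: zero zero_closed)
    qed simp
    then show "f (?u i (add x y)) = add (f (?u i x)) (f (?u i y))"
      using ad[OF u u, of x y i i] xy by simp
  qed (use cl u in auto)
  have rcl: "r i x \<in> A" if "x \<in> A" for i x using E_closed[OF r that] .
  have f0: "f (replicate n z) = z"
  proof (rule double_zero)
    have nl: "replicate n z \<in> nlists n A" using zero_closed by (rule nlists_replicateI)
    then show "f (replicate n z) \<in> A" by (rule cl)
    show "add (f (replicate n z)) (f (replicate n z)) = f (replicate n z)"
      using ad[OF nl nl] by (simp add: zero zero_closed)
  qed
  have main: "f (take k xs @ replicate (n - k) z) = (\<Oplus>\<^bsub>endo_module\<^esub>i\<in>{..<k}. r i (xs ! i))"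
    if xs: "xs \<in> nlists n A" and "k \<le> n" for k xs
    using that(2)
  proof (induction k)
    case 0
    then show ?case using f0 by simp
  next
    case (Suc k)
    have len: "length xs = n" using xs by simp
    have ent: "xs ! i \<in> A" if "i < n" for i using xs that by (rule nlistsE_nth_in)
    let ?t = "take k xs @ replicate (n - k) z"
    have "set ?t \<subseteq> A" using nlistsE_set[OF xs] zero_closed set_take_subset[of k xs] by auto
    then have t: "?t \<in> nlists n A" using Suc.prems len by (intro nlistsI) auto
    have "take (Suc k) xs @ replicate (n - Suc k) z = map2 add (?u k (xs ! k)) ?t"
    proof (rule nth_equalityI)
      show "length (take (Suc k) xs @ replicate (n - Suc k) z) = length (map2 add (?u k (xs ! k)) ?t)"
        using Suc.prems len by simp
      fix i assume "i < length (take (Suc k) xs @ replicate (n - Suc k) z)"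
      then have i: "i < n" using Suc.prems len by simp
      then show "(take (Suc k) xs @ replicate (n - Suc k) z) ! i = map2 add (?u k (xs ! k)) ?t ! i"
        using Suc.prems len ent[OF i]
        by (cases "i < k"; cases "i = k") (auto simp: nth_append zero zero_left zero_closed)
    qed
    then have "f (take (Suc k) xs @ replicate (n - Suc k) z) = add (f (?u k (xs ! k))) (f ?t)"
      using ad[OF u t] ent Suc.prems by simp
    also have "\<dots> = add (r k (xs ! k)) (\<Oplus>\<^bsub>endo_module\<^esub>i\<in>{..<k}. r i (xs ! i))"
      using Suc ent by (simp add: r_def)
    also have "\<dots> = (\<Oplus>\<^bsub>endo_module\<^esub>i\<in>{..<Suc k}. r i (xs ! i))"
      unfolding lessThan_Suc using rcl ent Suc.prems
      by (subst M.finsum_insert) auto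
    finally show ?case .
  qed
  show ?thesis
  proof (rule bexI[of _ r], rule bexI[of _ z], rule ballI)
    show "z \<in> carrier endo_module" by (simp add: zero_closed)
    show "r \<in> {..<n} \<rightarrow> carrier endo_ring" using r by (simp add: endo_ring_def)
    fix xs assume xs: "xs \<in> nlists n A"
    have "f xs = (\<Oplus>\<^bsub>endo_module\<^esub>i\<in>{..<n}. r i (xs ! i))"
      using main[OF xs, of n] xs by simp
    moreover have "f xs \<in> A" using xs by (rule cl)
    ultimately show "f xs = (\<Oplus>\<^bsub>endo_module\<^esub>i\<in>{..<n}. r i \<odot>\<^bsub>endo_module\<^esub> (xs ! i)) \<oplus>\<^bsub>endo_module\<^esub> z"
      by (simp add: zero)
  qed
qed

lemma affine_algebraI:
  assumes A: "carrier \<AA> = A"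
    and p: "(\<lambda>xs\<in>nlists 3 A. add (add (xs ! 0) (neg (xs ! 1))) (xs ! 2)) \<in> term_ops \<AA> 3"
    and cl: "\<And>n f xs. f \<in> term_ops \<AA> n \<Longrightarrow> xs \<in> nlists n A \<Longrightarrow> f xs \<in> A"
    and ad: "\<And>n f xs ys. f \<in> term_ops \<AA> n \<Longrightarrow> xs \<in> nlists n A \<Longrightarrow> ys \<in> nlists n A \<Longrightarrow>
      f (map2 add xs ys) = add (f xs) (f ys)"
  shows "affine_algebra \<AA>"
  unfolding affine_algebra_def
proof (intro exI conjI allI ballI)
  interpret M: abelian_group endo_module by (rule abelian_group_module)
  show "left_module endo_ring endo_module" by (rule left_module_endo)
  show "carrier endo_module = carrier \<AA>" by (simp add: A)
  have "\<ominus>\<^bsub>endo_module\<^esub> y = neg y" if "y \<in> A" for y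
    using that by (intro M.minus_equality) (simp_all add: neg_left neg_closed)
  then have "(x \<ominus>\<^bsub>endo_module\<^esub> y) \<oplus>\<^bsub>endo_module\<^esub> w = add (add x (neg y)) w" if "y \<in> A" for x y w
    using that by (simp add: a_minus_def)
  then have "(\<lambda>xs\<in>nlists 3 (carrier \<AA>). (xs ! 0 \<ominus>\<^bsub>endo_module\<^esub> xs ! 1) \<oplus>\<^bsub>endo_module\<^esub> xs ! 2) =
      (\<lambda>xs\<in>nlists 3 A. add (add (xs ! 0) (neg (xs ! 1))) (xs ! 2))"
    unfolding A using nlistsE_nth_in[of _ 3 A 1] by (intro restrict_ext) simp
  then show "(\<lambda>xs\<in>nlists 3 (carrier \<AA>). (xs ! 0 \<ominus>\<^bsub>endo_module\<^esub> xs ! 1) \<oplus>\<^bsub>endo_module\<^esub> xs ! 2) \<in> term_ops \<AA> 3"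
    using p by simp
  fix n f assume f: "f \<in> term_ops \<AA> n"
  show "\<exists>r\<in>{..<n} \<rightarrow> carrier endo_ring. \<exists>c\<in>carrier endo_module. \<forall>xs\<in>nlists n (carrier \<AA>).
      f xs = (\<Oplus>\<^bsub>endo_module\<^esub>i\<in>{..<n}. r i \<odot>\<^bsub>endo_module\<^esub> (xs ! i)) \<oplus>\<^bsub>endo_module\<^esub> c"
    unfolding A using cl[OF f] ad[OF f] by (rule additive_decomposition)
qed

end

section \<open>The abelian group of a medial Maltsev operation\<close>

context minimal_taylor_clone begin

text \<open>An arbitrary \<open>z\<close> is chosen as origin. Associativity, commutativity and the
  inverse law are instances of the medial identity with several arguments set to \<open>z\<close>,
  simplified by the Maltsev laws.\<close>

lemma medial_group:
  assumes p: "malcev p" and med: "medial_on A p" and z: "z \<in> A"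
  shows "additive_group A (\<lambda>x y. p x z y) z (\<lambda>x. p z x z)"
    and "\<And>x y w. x \<in> A \<Longrightarrow> y \<in> A \<Longrightarrow> w \<in> A \<Longrightarrow> p (p x z (p z y z)) z w = p x y w"
proof -
  have tp: "ter p" and mal: "\<And>x y. x \<in> A \<Longrightarrow> y \<in> A \<Longrightarrow> p x y y = x \<and> p y y x = x"
    using p by (auto simp: malcev_def)
  have med': "p (p u1 z v1) (p u2 z v2) (p u3 z v3) = p (p u1 u2 u3) z (p v1 v2 v3)"
    if "u1 \<in> A" "u2 \<in> A" "u3 \<in> A" "v1 \<in> A" "v2 \<in> A" "v3 \<in> A" for u1 u2 u3 v1 v2 v3
    using med that z unfolding medial_on_def by blast
  note cl = ter_closed[OF tp]
  have assoc: "p (p x z y) z w = p x z (p y z w)" if "x \<in> A" "y \<in> A" "w \<in> A" for x y w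
    using med'[of x z z y z w] that z mal by simp
  show "additive_group A (\<lambda>x y. p x z y) z (\<lambda>x. p z x z)"
  proof
    fix x y assume xy: "x \<in> A" "y \<in> A"
    show "p x z y = p y z x" using med'[of z z y x z z] xy z mal by simp
  next
    fix x assume x: "x \<in> A"
    show "p x z (p z x z) = z" using med'[of x z z z x z] x z mal by simp
  qed (use cl z mal assoc in auto)
  show "p (p x z (p z y z)) z w = p x y w" if A: "x \<in> A" "y \<in> A" "w \<in> A" for x y w
  proof -
    have 1: "p x y w = p x z (p z y w)" using med'[of x z z z y w] A z mal by simp
    have 2: "p z y w = p (p z y z) z w" using med'[of z y z z z w] A z mal by simp
    show ?thesis using 1 2 assoc[OF A(1) cl[OF z A(2) z] A(3)] by simp
  qed
qed

text \<open>Additivity of \<open>p\<close> itself is the medial identity. Additivity survives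
  composition, and \<open>p\<close> is not a projection, so it reaches every operation.\<close>

lemma medial_additive:
  assumes p: "malcev p" and med: "medial_on A p" and z: "z \<in> A" and f: "f \<in> C n"
    and "xs \<in> nlists n A" "ys \<in> nlists n A"
  shows "f (map2 (\<lambda>x y. p x z y) xs ys) = p (f xs) z (f ys)"
proof -
  have tp: "ter p" and mal: "\<And>x y. x \<in> A \<Longrightarrow> y \<in> A \<Longrightarrow> p x y y = x \<and> p y y x = x"
    using p by (auto simp: malcev_def)
  let ?add = "\<lambda>x y. p x z y"
  have nl: "map2 ?add xs ys \<in> nlists n A" if "xs \<in> nlists n A" "ys \<in> nlists n A" for n xs ys
  proof (rule nlistsI)
    show "length (map2 ?add xs ys) = n" using that by simp
    show "set (map2 ?add xs ys) \<subseteq> A"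
      using nlistsE_set[OF that(1)] nlistsE_set[OF that(2)] z
      by (auto dest: set_zip_leftD set_zip_rightD intro!: ter_closed[OF tp])
  qed
  obtain a b where ab: "a \<in> A" "b \<in> A" "a \<noteq> b" using nontrivial_A by blast
  have np: "(\<lambda>xs\<in>nlists 3 A. p (xs ! 0) (xs ! 1) (xs ! 2)) \<notin> projections A 3"
    using ab mal by (intro ter_not_projection[OF tp ab(1,2)]) (auto simp: less_Suc_eq numeral_3_eq_3)
  define Q where "Q n f \<longleftrightarrow> (\<forall>xs\<in>nlists n A. \<forall>ys\<in>nlists n A. f (map2 ?add xs ys) = ?add (f xs) (f ys))"
    for n and f :: "'a list \<Rightarrow> 'a"
  have "Q n f"
  proof (rule min_induct[OF ter_C[OF tp] np _ _ _ f])
    show "Q 3 (\<lambda>xs\<in>nlists 3 A. p (xs ! 0) (xs ! 1) (xs ! 2))"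
      unfolding Q_def ball_nlists_3 using med[unfolded medial_on_def] z ter_closed[OF tp]
      by (simp add: nlists_3)
    show "Q n (\<lambda>xs\<in>nlists n A. xs ! i)" if i: "i < n" for n i
      unfolding Q_def using nl i by simp
    fix k n f gs
    assume f: "Q k f" and gs: "gs \<in> nlists k (C n)" "\<And>g. g \<in> set gs \<Longrightarrow> Q n g"
    have "f (map (\<lambda>g. g (map2 ?add xs ys)) gs) = ?add (f (map (\<lambda>g. g xs) gs)) (f (map (\<lambda>g. g ys) gs))"
      if xs: "xs \<in> nlists n A" "ys \<in> nlists n A" for xs ys
    proof -
      have "map (\<lambda>g. g (map2 ?add xs ys)) gs = map2 ?add (map (\<lambda>g. g xs) gs) (map (\<lambda>g. g ys) gs)"
      proof (rule nth_equalityI)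
        fix i assume "i < length (map (\<lambda>g. g (map2 ?add xs ys)) gs)"
        then have i: "i < length gs" by simp
        then have "Q n (gs ! i)" using gs(2) by simp
        then have "(gs ! i) (map2 ?add xs ys) = ?add ((gs ! i) xs) ((gs ! i) ys)"
          using xs unfolding Q_def by blast
        then show "map (\<lambda>g. g (map2 ?add xs ys)) gs ! i = map2 ?add (map (\<lambda>g. g xs) gs) (map (\<lambda>g. g ys) gs) ! i"
          using i by simp
      qed simp
      then show ?thesis
        using f[unfolded Q_def, rule_format, OF map_closed[OF gs(1) xs(1)] map_closed[OF gs(1) xs(2)]] by simp
    qed
    then show "Q n (\<lambda>xs\<in>nlists n A. f (map (\<lambda>g. g xs) gs))"
      unfolding Q_def using nl by simp
  qed
  then show ?thesis using assms(5,6) unfolding Q_def by blast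
qed

lemma medial_affine:
  assumes p: "malcev p" and med: "medial_on A p" and \<AA>: "carrier \<AA> = A" "term_ops \<AA> = C"
  shows "affine_algebra \<AA>"
proof -
  obtain z where z: "z \<in> A" using nontrivial_A by blast
  have tp: "ter p" using p by (simp add: malcev_def)
  interpret G: additive_group A "\<lambda>x y. p x z y" z "\<lambda>x. p z x z"
    by (rule medial_group(1)[OF p med z])
  show ?thesis
  proof (rule G.affine_algebraI[OF \<AA>(1)])
    have "(\<lambda>xs\<in>nlists 3 A. p (p (xs ! 0) z (p z (xs ! 1) z)) z (xs ! 2)) =
        (\<lambda>xs\<in>nlists 3 A. p (xs ! 0) (xs ! 1) (xs ! 2))"
      by (rule restrict_ext) (auto simp: nlists_3 medial_group(2)[OF p med z])
    then show "(\<lambda>xs\<in>nlists 3 A. p (p (xs ! 0) z (p z (xs ! 1) z)) z (xs ! 2)) \<in> term_ops \<AA> 3"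
      using ter_C[OF tp] by (simp add: \<AA>)
    show "f xs \<in> A" if "f \<in> term_ops \<AA> n" "xs \<in> nlists n A" for n f xs
      using C_closed that by (simp add: \<AA>)
    show "f (map2 (\<lambda>x y. p x z y) xs ys) = p (f xs) z (f ys)"
      if "f \<in> term_ops \<AA> n" "xs \<in> nlists n A" "ys \<in> nlists n A" for n f xs ys
      using medial_additive[OF p med z] that by (simp add: \<AA>)
  qed
qed

end

subsection \<open>Term equivalence\<close>

primrec subst_term :: "'f trm list \<Rightarrow> 'f trm \<Rightarrow> 'f trm" where
  "subst_term us (Var i) = us ! i"
| "subst_term us (App f ts) = App f (map (subst_term us) ts)"

lemma subst_term_terms:
  assumes "t \<in> terms \<AA> k" and us: "length us = k" "set us \<subseteq> terms \<AA> n"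
  shows "subst_term us t \<in> terms \<AA> n"
  using assms(1)
proof (induction t rule: terms.induct)
  case (Var i)
  then show ?case using us nth_mem by fastforce
next
  case (App f ts)
  then show ?case by (auto intro!: terms.App)
qed

lemma eval_subst_term:
  assumes "t \<in> terms \<AA> k" and us: "length us = k"
  shows "eval_term \<AA> xs (subst_term us t) = eval_term \<AA> (map (eval_term \<AA> xs) us) t"
  using assms(1)
proof (induction t rule: terms.induct)
  case (App f ts)
  then have "map (eval_term \<AA> xs \<circ> subst_term us) ts = map (eval_term \<AA> (map (eval_term \<AA> xs) us)) ts"
    by (intro map_cong) auto
  then show ?case by (simp only: subst_term.simps eval_term.simps list.map_comp)
qed (simp add: us)

text \<open>Composition of operations is substitution of terms. By \<open>cl\<close> the inner
  values form a tuple at which the restricted function \<open>f\<close> agrees with its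
  term.\<close>

lemma term_ops_comp:
  assumes f: "f \<in> term_ops \<AA> k" and gs: "gs \<in> nlists k (term_ops \<AA> n)"
    and cl: "\<And>g xs. g \<in> term_ops \<AA> n \<Longrightarrow> xs \<in> nlists n (carrier \<AA>) \<Longrightarrow> g xs \<in> carrier \<AA>"
  shows "(\<lambda>xs\<in>nlists n (carrier \<AA>). f (map (\<lambda>g. g xs) gs)) \<in> term_ops \<AA> n"
proof -
  let ?N = "nlists n (carrier \<AA>)"
  obtain t where t: "t \<in> terms \<AA> k" "f = (\<lambda>xs\<in>nlists k (carrier \<AA>). eval_term \<AA> xs t)"
    using f by (auto simp: term_ops_def)
  have "\<forall>g\<in>set gs. \<exists>u. u \<in> terms \<AA> n \<and> g = (\<lambda>xs\<in>?N. eval_term \<AA> xs u)"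
    using nlistsE_set[OF gs] by (auto simp: term_ops_def)
  then have "\<exists>T. \<forall>g\<in>set gs. T g \<in> terms \<AA> n \<and> g = (\<lambda>xs\<in>?N. eval_term \<AA> xs (T g))"
    by (rule bchoice)
  then obtain T where ex: "\<forall>g\<in>set gs. T g \<in> terms \<AA> n \<and> g = (\<lambda>xs\<in>?N. eval_term \<AA> xs (T g))" ..
  have T: "T g \<in> terms \<AA> n" and T': "g = (\<lambda>xs\<in>?N. eval_term \<AA> xs (T g))" if "g \<in> set gs" for g
    by (rule conjunct1[OF bspec[OF ex that]], rule conjunct2[OF bspec[OF ex that]])
  let ?us = "map T gs"
  have us: "length ?us = k" "set ?us \<subseteq> terms \<AA> n" using T nlistsE_length[OF gs] by auto
  have "f (map (\<lambda>g. g xs) gs) = eval_term \<AA> xs (subst_term ?us t)" if xs: "xs \<in> ?N" for xs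
  proof -
    have "g xs = eval_term \<AA> xs (T g)" if "g \<in> set gs" for g
      using fun_cong[OF T'[OF that], of xs] xs by simp
    then have eq: "map (\<lambda>g. g xs) gs = map (eval_term \<AA> xs) ?us" by simp
    have "g xs \<in> carrier \<AA>" if "g \<in> set gs" for g
      using cl[OF _ xs] nlistsE_set[OF gs] that by blast
    then have "map (\<lambda>g. g xs) gs \<in> nlists k (carrier \<AA>)"
      using nlistsE_length[OF gs] by (intro nlistsI) auto
    then have "f (map (\<lambda>g. g xs) gs) = eval_term \<AA> (map (\<lambda>g. g xs) gs) t" by (simp add: t(2))
    then show ?thesis by (simp only: eq eval_subst_term[OF t(1) us(1)])
  qed
  then have "(\<lambda>xs\<in>?N. f (map (\<lambda>g. g xs) gs)) = (\<lambda>xs\<in>?N. eval_term \<AA> xs (subst_term ?us t))"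
    by (rule restrict_ext)
  then show ?thesis
    using subst_term_terms[OF t(1) us] by (simp add: term_ops_def)
qed

section \<open>Term equivalence with algebras having one basic operation\<close>

context minimal_taylor_clone begin

text \<open>Terms over \<open>g\<close> stay in the clone; conversely, being given by such a term
  holds for \<open>g\<close> and for projections and survives composition, so
  \<open>min_induct\<close> applies.\<close>

lemma single_op_term_ops:
  assumes g: "g \<in> C k" "g \<notin> projections A k"
  shows "term_ops (single_op_algebra A k g) = C"
proof
  fix n
  let ?B = "single_op_algebra A k g"
  have car: "carrier ?B = A" by (simp add: single_op_algebra_def)
  have in_C: "(\<lambda>xs\<in>nlists n A. eval_term ?B xs t) \<in> C n" if "t \<in> terms ?B n" for n t
    using that
  proof (induction t rule: terms.induct)
    case (Var i)
    then show ?case using C_proj[OF Var] by (simp only: eval_term.simps)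
  next
    case (App f ts)
    let ?gs = "map (\<lambda>t. \<lambda>xs\<in>nlists n A. eval_term ?B xs t) ts"
    have "length ts = k" using App by (simp add: single_op_algebra_def)
    moreover have "(\<lambda>xs\<in>nlists n A. eval_term ?B xs t) \<in> C n" if "t \<in> set ts" for t
      using bspec[OF App(3) that] by (rule conjunct2)
    ultimately have gs: "?gs \<in> nlists k (C n)" by (intro nlistsI) auto
    have eq: "(\<lambda>xs\<in>nlists n A. g (map (\<lambda>g. g xs) ?gs)) = (\<lambda>xs\<in>nlists n A. eval_term ?B xs (App f ts))"
      by (rule restrict_ext) (simp add: single_op_algebra_def comp_def)
    show ?case using C_comp[OF g(1) gs] unfolding eq .
  qed
  have sub: "term_ops ?B n \<subseteq> C n" for n using in_C by (auto simp: term_ops_def car)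
  show "term_ops ?B n = C n"
  proof (rule subset_antisym[OF sub], rule subsetI)
    fix f assume f: "f \<in> C n"
    show "f \<in> term_ops ?B n"
    proof (rule min_induct[OF g _ _ _ f, where Q = "\<lambda>n f. f \<in> term_ops ?B n"])
      have "App () (map Var [0..<k]) \<in> terms ?B k"
        by (rule terms.App) (auto simp: single_op_algebra_def intro: terms.Var)
      moreover have "g = (\<lambda>xs\<in>nlists k A. eval_term ?B xs (App () (map Var [0..<k])))"
      proof -
        have "g xs = eval_term ?B xs (App () (map Var [0..<k]))" if "xs \<in> nlists k A" for xs
        proof -
          have "map (eval_term ?B xs \<circ> Var) [0..<k] = xs"
            using that by (intro nth_equalityI) auto
          then show ?thesis by (simp add: single_op_algebra_def)
        qed
        then show ?thesis using C_restrict[OF g(1)] by (metis restrict_ext)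
      qed
      ultimately show "g \<in> term_ops ?B k" unfolding term_ops_def car by blast
      show "(\<lambda>xs\<in>nlists n A. xs ! i) \<in> term_ops ?B n" if "i < n" for n i
        unfolding term_ops_def car using terms.Var[OF that, of ?B] by force
      show "(\<lambda>xs\<in>nlists n A. f (map (\<lambda>g. g xs) gs)) \<in> term_ops ?B n"
        if "f \<in> term_ops ?B k" "gs \<in> nlists k (C n)" "\<And>g. g \<in> set gs \<Longrightarrow> g \<in> term_ops ?B n" for k n f gs
      proof -
        have "gs \<in> nlists k (term_ops ?B n)"
          using nlistsE_length[OF that(2)] that(3) by (intro nlistsI) auto
        moreover have "g xs \<in> A" if "g \<in> term_ops ?B n" "xs \<in> nlists n A" for g xs
          using C_closed[OF subsetD[OF sub that(1)] that(2)] .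
        ultimately show ?thesis using term_ops_comp[OF that(1), of gs n] by (simp add: car)
      qed
    qed
  qed
qed

lemma single_op_equivalent:
  assumes g: "g \<in> C k" "g \<notin> projections A k" and \<AA>: "carrier \<AA> = A" "term_ops \<AA> = C"
  shows "term_equivalent \<AA> (single_op_algebra A k g)" "universal_algebra (single_op_algebra A k g)"
proof -
  show "term_equivalent \<AA> (single_op_algebra A k g)"
    unfolding term_equivalent_def using single_op_term_ops[OF g] \<AA> by (simp add: single_op_algebra_def)
  show "universal_algebra (single_op_algebra A k g)"
    using nontrivial_A C_closed[OF g(1)] by unfold_locales (auto simp: single_op_algebra_def)
qed

lemma majority_equivalent:
  assumes m: "majority m" and \<AA>: "carrier \<AA> = A" "term_ops \<AA> = C"
  shows "\<exists>\<BB>. term_equivalent \<AA> \<BB> \<and> majority_algebra \<BB>"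
proof -
  let ?m = "\<lambda>xs\<in>nlists 3 A. m (xs ! 0) (xs ! 1) (xs ! 2)"
  have tm: "ter m" and eq: "\<And>x y. x \<in> A \<Longrightarrow> y \<in> A \<Longrightarrow> m x x y = x \<and> m x y x = x \<and> m y x x = x"
    using m by (auto simp: majority_def)
  obtain a b where ab: "a \<in> A" "b \<in> A" "a \<noteq> b" using nontrivial_A by blast
  have np: "?m \<notin> projections A 3"
    using ab eq by (intro ter_not_projection[OF tm ab(1,2)]) (auto simp: less_Suc_eq numeral_3_eq_3)
  have "majority_algebra (single_op_algebra A 3 ?m)"
    unfolding majority_algebra_def
  proof (intro conjI exI[of _ A] exI[of _ ?m] ballI)
    show "universal_algebra (single_op_algebra A 3 ?m)"
      by (rule single_op_equivalent(2)[OF ter_C[OF tm] np \<AA>])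
  qed (simp_all add: nlists_3 eq)
  then show ?thesis using single_op_equivalent(1)[OF ter_C[OF tm] np \<AA>] by blast
qed

end

context semilattice_edge begin

lemma spiral_equivalent:
  assumes \<AA>: "carrier \<AA> = A" "term_ops \<AA> = C"
  shows "\<exists>\<BB>. term_equivalent \<AA> \<BB> \<and> spiral \<BB>"
proof -
  let ?f = "\<lambda>xs\<in>nlists 2 A. f (xs ! 0) (xs ! 1)"
  let ?B = "single_op_algebra A 2 ?f"
  have fC: "?f \<in> C 2" "?f \<notin> projections A 2"
    using bin_C[OF bin_f] proper_not_projection[OF proper_f] by auto
  have app: "?f [x, y] = f x y" if "x \<in> A" "y \<in> A" for x y using that by (simp add: nlists_2)
  have hull: "subuniverse ?B hull {a, b} = gen a b" if ab: "a \<in> A" "b \<in> A" for a b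
  proof (rule hull_unique)
    show "{a, b} \<subseteq> gen a b" using gen_generators(1)[of a b] gen_generators(2)[of b a] by blast
    have XA: "gen a b \<subseteq> A" by (rule gen_subset[OF ab])
    then show "subuniverse ?B (gen a b)"
      using gen_bin[OF bin_f, of _ a b]
      by (auto simp: subuniverse_def single_op_algebra_def nlists_2 subset_iff)
    fix X assume X: "{a, b} \<subseteq> X" "subuniverse ?B X"
    have XA': "X \<subseteq> A" using X(2) by (simp add: subuniverse_def single_op_algebra_def)
    have "f x y \<in> X" if "x \<in> X" "y \<in> X" for x y
    proof -
      have "[x, y] \<in> nlists 2 X" using that by (simp add: nlists_2)
      then have "?f [x, y] \<in> X" using X(2) by (simp add: subuniverse_def single_op_algebra_def)
      then show ?thesis
        by (simp only: app[OF subsetD[OF XA' that(1)] subsetD[OF XA' that(2)]])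
    qed
    then have "sub X" by (rule sub_proper[OF proper_f XA'])
    then show "gen a b \<subseteq> X" using X(1) by (intro gen_minimal) auto
  qed
  have "spiral ?B"
    unfolding spiral_def
  proof (intro conjI exI[of _ A] exI[of _ ?f] ballI impI)
    show "universal_algebra ?B" by (rule single_op_equivalent(2)[OF fC \<AA>])
    show "?B = single_op_algebra A 2 ?f" ..
    show "?f [x, y] = ?f [y, x]" if "x \<in> A" "y \<in> A" for x y using app comm_f that by simp
    show "?f [x, x] = x" if "x \<in> A" for x using app f_idem that by simp
    fix a b assume ab: "a \<in> A" "b \<in> A" "a \<noteq> b"
    let ?G = "generated_subalgebra ?B {a, b}"
    have carG: "carrier ?G = gen a b" using hull[OF ab(1,2)] by (simp add: generated_subalgebra_def)
    have XA: "x \<in> A" if "x \<in> gen a b" for x using gen_subset[OF ab(1,2)] that by blast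
    from spiral_condition[OF ab]
    show "card (carrier ?G) = 2 \<or> (\<exists>h. homomorphism ?G free_semilattice2 h \<and>
        h ` carrier ?G = carrier free_semilattice2)"
    proof (elim disjE exE conjE)
      assume "gen a b = {a, b}"
      then show ?thesis using carG ab(3) by simp
    next
      fix M assume M: "a \<notin> M" "b \<notin> M" "M \<noteq> {}" "gen a b = {a, b} \<union> M" "f a b \<in> M"
        and ideal: "\<forall>m\<in>M. \<forall>x\<in>gen a b. f m x \<in> M \<and> f x m \<in> M"
      \<comment> \<open>The ideal \<open>M\<close> goes to the top element \<open>UNIV\<close>, the
        join of the images of \<open>a\<close> and \<open>b\<close>; this fits because
        \<open>f a b\<close> lies in \<open>M\<close>.\<close>
      define h where "h x = (if x = a then {False} else if x = b then {True} else (UNIV :: bool set))" for x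
      have hM: "h m = UNIV" if "m \<in> M" for m using that M(1,2) by (auto simp: h_def)
      have hab: "h a = {False}" "h b = {True}" using ab(3) by (auto simp: h_def)
      have un: "{False} \<union> {True} = (UNIV :: bool set)" "{True} \<union> {False} = (UNIV :: bool set)" by auto
      have fba: "f b a \<in> M" using M(5) comm_f[OF ab(1,2)] by simp
      have hom: "h (f x y) = h x \<union> h y" if xy: "x \<in> gen a b" "y \<in> gen a b" for x y
      proof -
        consider "x \<in> M" | "y \<in> M" | "x = y" | "x = a" "y = b" | "x = b" "y = a" using xy unfolding M(4) by auto
        then show ?thesis
        proof cases
          case 1 then show ?thesis using hM ideal xy by simp
        next
          case 2 then show ?thesis using hM ideal xy by simp
        next
          case 3 then show ?thesis using f_idem XA xy by simp
        next
          case 4 then show ?thesis using hM[OF M(5)] hab un by simp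
        next
          case 5 then show ?thesis using hM[OF fba] hab un by simp
        qed
      qed
      have "homomorphism ?G free_semilattice2 h"
        unfolding homomorphism_def
      proof (intro conjI ballI)
        show "h \<in> carrier ?G \<rightarrow> carrier free_semilattice2"
          by (auto simp: h_def free_semilattice2_def single_op_algebra_def)
        fix s xs assume "s \<in> symbols ?G" "xs \<in> nlists (arity ?G s) (carrier ?G)"
        then obtain x y where xy: "xs = [x, y]" "x \<in> gen a b" "y \<in> gen a b"
          unfolding carG by (auto simp: generated_subalgebra_def single_op_algebra_def nlists_2)
        then show "h (interp ?G s xs) = interp free_semilattice2 s (map h xs)"
          using hom app XA by (simp add: generated_subalgebra_def free_semilattice2_def single_op_algebra_def)
      qed (simp_all add: generated_subalgebra_def free_semilattice2_def single_op_algebra_def)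
      moreover have "h ` carrier ?G = carrier free_semilattice2"
      proof -
        have "h ` M = {UNIV}" using hM M(3) by auto
        then have "h ` carrier ?G = {{False}, {True}, UNIV}"
          unfolding carG M(4) by (simp add: image_Un hab)
        also have "\<dots> = - {{}}"
        proof -
          have "- {{}} = Pow (UNIV :: bool set) - {{}}" by auto
          also have "\<dots> = {{False}, {True}, UNIV}" unfolding UNIV_bool Pow_insert Pow_empty by auto
          finally show ?thesis ..
        qed
        finally show ?thesis by (simp add: free_semilattice2_def single_op_algebra_def)
      qed
      ultimately show ?thesis by blast
    qed
  qed
  then show ?thesis using single_op_equivalent(1)[OF fC \<AA>] by blast
qed

end

section \<open>Combining the cases, and the one-element carrier\<close>

lemma (in minimal_taylor_clone) trichotomy:
  assumes \<AA>: "carrier \<AA> = A" "term_ops \<AA> = C"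
  shows "affine_algebra \<AA> \<or>
    (\<exists>\<BB>. term_equivalent \<AA> \<BB> \<and> majority_algebra \<BB>) \<or>
    (\<exists>\<BB>. term_equivalent \<AA> \<BB> \<and> spiral \<BB>)"
proof -
  consider (majority) g where "majority g" | (medial) p where "malcev p" "medial_on A p"
    | (edge) f u v where "bin f" "\<forall>x\<in>A. \<forall>y\<in>A. f x y = f y x" "u \<in> A" "v \<in> A" "u \<noteq> v" "f u v = v"
    using trivial_binary_case binary_case by metis
  then show ?thesis
  proof cases
    case majority
    then show ?thesis using majority_equivalent[OF _ \<AA>] by blast
  next
    case medial
    then show ?thesis using medial_affine[OF _ _ \<AA>] by blast
  next
    case edge
    interpret semilattice_edge A C f u v by unfold_locales (use edge in auto)
    show ?thesis using spiral_equivalent[OF \<AA>] by blast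
  qed
qed

text \<open>A one-element carrier does admit a minimal clone, with a nullary constant as its
  non-projection, but lies outside \<open>minimal_taylor_clone\<close>. The zero group makes it
  affine.\<close>

lemma singleton_affine:
  assumes A: "carrier \<AA> = {z}"
    and cl: "\<And>n f xs. f \<in> term_ops \<AA> n \<Longrightarrow> xs \<in> nlists n {z} \<Longrightarrow> f xs \<in> {z}"
  shows "affine_algebra \<AA>"
proof -
  interpret additive_group "{z}" "\<lambda>x y. z" z "\<lambda>x. z" by unfold_locales auto
  show ?thesis
  proof (rule affine_algebraI[OF A])
    have "(\<lambda>xs\<in>nlists 3 {z}. z) = (\<lambda>xs\<in>nlists 3 {z}. eval_term \<AA> xs (Var 0))"
      by (rule restrict_ext) (auto simp: numeral_3_eq_3 in_nlists_Suc_iff)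
    moreover have "Var 0 \<in> terms \<AA> 3" by (rule terms.Var) simp
    ultimately show "(\<lambda>xs\<in>nlists 3 {z}. z) \<in> term_ops \<AA> 3"
      unfolding term_ops_def A by (rule image_eqI)
    show "f xs \<in> {z}" if "f \<in> term_ops \<AA> n" "xs \<in> nlists n {z}" for n f xs using cl that .
    show "f (map2 (\<lambda>x y. z) xs ys) = z"
      if "f \<in> term_ops \<AA> n" "xs \<in> nlists n {z}" "ys \<in> nlists n {z}" for n f xs ys
    proof -
      have "map2 (\<lambda>x y. z) xs ys \<in> nlists n {z}" using that(2,3) by (intro nlistsI) auto
      then show ?thesis using cl[OF that(1)] by blast
    qed
  qed
qed

text \<open>The Taylor identity for position \<open>i\<close> has different variables there on its
  two sides; a coordinate \<open>i\<close> would equate \<open>a\<close> and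
  \<open>b\<close>.\<close>

lemma taylor_term_not_coordinate:
  assumes t: "taylor_term \<AA> n t" and ab: "a \<in> carrier \<AA>" "b \<in> carrier \<AA>" "a \<noteq> b" and i: "i < n"
  shows "\<not> (\<forall>xs\<in>nlists n {a, b}. eval_term \<AA> xs t = xs ! i)"
proof
  assume *: "\<forall>xs\<in>nlists n {a, b}. eval_term \<AA> xs t = xs ! i"
  let ?m = "map (\<lambda>c. if c then a else b)"
  have "\<exists>u v :: bool list. length u = n \<and> length v = n \<and> u ! i = True \<and> v ! i = False \<and>
      eval_term \<AA> (?m u) t = eval_term \<AA> (?m v) t"
    using t ab(1,2) i unfolding taylor_term_def by blast
  then obtain u v where uv: "length u = n" "length v = n" "u ! i" "\<not> v ! i"
    and eq: "eval_term \<AA> (?m u) t = eval_term \<AA> (?m v) t" by auto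
  have "?m u \<in> nlists n {a, b}" "?m v \<in> nlists n {a, b}" using uv(1,2) by (auto intro!: nlistsI)
  then have "eval_term \<AA> (?m u) t = ?m u ! i" "eval_term \<AA> (?m v) t = ?m v ! i" using * by blast+
  then show False using eq uv i ab(3) by simp
qed

theorem theorem1:
  fixes \<AA> :: "('f, 'a) ualgebra"
  assumes "universal_algebra \<AA>"
    and "finite (carrier \<AA>)"
    and "minimal_clone (carrier \<AA>) (term_ops \<AA>)"
    and "\<exists>n t. taylor_term \<AA> n t"
  shows "affine_algebra \<AA> \<or>
    (\<exists>\<BB>. term_equivalent \<AA> \<BB> \<and> majority_algebra \<BB>) \<or>
    (\<exists>\<BB>. term_equivalent \<AA> \<BB> \<and> spiral \<BB>)"
proof (cases "\<exists>a\<in>carrier \<AA>. \<exists>b\<in>carrier \<AA>. a \<noteq> b")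
  case False
  have "carrier \<AA> \<noteq> {}" using assms(1) by (rule universal_algebra.carrier_not_empty)
  then obtain z where z: "carrier \<AA> = {z}" using False by auto
  have "term_ops \<AA> n \<subseteq> nlists n (carrier \<AA>) \<rightarrow>\<^sub>E carrier \<AA>" for n
    using assms(3) by (simp add: minimal_clone_def clone_on_def)
  then have "f xs \<in> {z}" if "f \<in> term_ops \<AA> n" "xs \<in> nlists n {z}" for n f xs
    using that PiE_mem[OF subsetD, of "term_ops \<AA> n" "nlists n (carrier \<AA>)" "\<lambda>_. carrier \<AA>" f xs] z by auto
  then show ?thesis using singleton_affine[OF z] by blast
next
  case True
  obtain n t where t: "taylor_term \<AA> n t" using assms(4) by blast
  interpret minimal_taylor_clone "carrier \<AA>" "term_ops \<AA>"
  proof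
    fix a b assume ab: "a \<in> carrier \<AA>" "b \<in> carrier \<AA>" "a \<noteq> b"
    let ?t = "\<lambda>xs\<in>nlists n (carrier \<AA>). eval_term \<AA> xs t"
    have sub: "nlists n {a, b} \<subseteq> nlists n (carrier \<AA>)" using ab by (intro nlists_mono) auto
    have "?t \<in> term_ops \<AA> n" using t by (simp add: taylor_term_def term_ops_def)
    moreover have "\<forall>x\<in>carrier \<AA>. ?t (replicate n x) = x"
      using t by (simp add: taylor_term_def nlists_replicateI)
    moreover have "\<not> (\<exists>i<n. \<forall>xs\<in>nlists n {a, b}. ?t xs = xs ! i)"
      using taylor_term_not_coordinate[OF t ab] sub by (auto simp: subset_iff)
    ultimately show "\<exists>n. \<exists>t\<in>term_ops \<AA> n. (\<forall>x\<in>carrier \<AA>. t (replicate n x) = x) \<and>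
        \<not> (\<exists>i<n. \<forall>xs\<in>nlists n {a, b}. t xs = xs ! i)" by blast
  qed (use assms True in auto)
  show ?thesis by (rule trichotomy) simp_all
qed

end
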